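(* Let $0<r<1$. Then $\kappa_0(r^{-1}\overline{\mathbb{D}}\setminus\{0\})$ is a minimal closed von Neumann set for $\kappa_0(PA_r)$ and for $\kappa_0(QA_r)$.
   Context: All operators are bounded linear maps on complex Hilbert spaces; $r^{-1}\overline{\mathbb{D}}=\{z\in\mathbb{C}:|z|\le r^{-1}\}$. $\kappa_0:\mathbb{C}\setminus\{0\}\to\mathbb{C}^2$ is $\kappa_0(z)=\left(\frac{z}{\sqrt{r^{-2}+r^2}},\frac{z^{-1}}{\sqrt{r^{-2}+r^2}}\right)$; for an invertible operator $T$, $\kappa_0(T)=\left(\frac{T}{\sqrt{r^{-2}+r^2}},\frac{T^{-1}}{\sqrt{r^{-2}+r^2}}\right)$; for a class $\mathcal{C}$ of invertible operators, $\kappa_0(\mathcal{C})=\{\kappa_0(T):T\in\mathcal{C}\}$. $PA_r=\{T: T\text{ is invertible and } (r^2+r^{-2})I-T^*T-T^{-*}T^{-1}\ge0\}$, where $T^{-*}=(T^{-1})^*$, and $QA_r=\{T: T\text{ is invertible and }\|T\|\le r^{-1},\ \|T^{-1}\|\le r^{-1}\}$. A set $Y\subseteq\mathbb{C}^n$ is a von Neumann set for a commuting $n$-tuple $\underline{T}$ if its Taylor joint spectrum satisfies $\sigma_T(\underline{T})\subseteq Y$ and $\|f(\underline{T})\|\le\sup_{\xi\in Y}|f(\xi)|$ (possibly $+\infty$) for every rational function $f=p/g$ with $p,g\in\mathbb{C}[z_1,\dots,z_n]$ and $g$ having no zeros in $Y$, where $f(\underline{T})=p(\underline{T})g(\underline{T})^{-1}$.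 A closed set $Y\subset\mathbb{C}^n$ is a minimal closed von Neumann set for a class $\mathcal{S}$ of commuting $n$-tuples if $Y$ is a von Neumann set for each member of $\mathcal{S}$ and for every proper closed subset $Y_1$ of $Y$ there is $\underline{S}\in\mathcal{S}$ such that $Y_1$ is not a von Neumann set for $\underline{S}$. *)

theory Defs
  imports
    "HOL-Analysis.Analysis"
    "HOL-Algebra.Module"
    "HOL-Algebra.Algebraic_Closure_Type"
    "HOL-Library.Poly_Mapping"
begin

section \<open>Complex Hilbert spaces\<close>

text \<open>
  The classes of operators below range over all Hilbert spaces, so Hilbert spaces are objects with
  a carrier set and not instances of a type class. As always in HOL-Algebra, the ring
  multiplication and the unit of the \<open>module\<close> record carry no meaning for a module.
  The type \<open>'a\<close> is the universe of the carriers. If it has fewer elements than \<open>complex\<close>, it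
  accommodates the zero space only; otherwise every separable Hilbert space has a copy in it.
\<close>

record 'a chilbert = "(complex, 'a) module" +
  cinner :: "'a \<Rightarrow> 'a \<Rightarrow> complex"

definition hnorm :: "'a chilbert \<Rightarrow> 'a \<Rightarrow> real" where
  "hnorm H x = sqrt (Re (cinner H x x))"

locale complex_hilbert_space =
  module "ring_of_type_algebra :: complex ring" H for H :: "'a chilbert" (structure) +
  assumes cinner_add_left:
      "\<lbrakk>x \<in> carrier H; y \<in> carrier H; z \<in> carrier H\<rbrakk> \<Longrightarrow>
        cinner H (x \<oplus>\<^bsub>H\<^esub> y) z = cinner H x z + cinner H y z"
    and cinner_smult_left:
      "\<lbrakk>x \<in> carrier H; y \<in> carrier H\<rbrakk> \<Longrightarrow> cinner H (c \<odot>\<^bsub>H\<^esub> x) y = c * cinner H x y"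
    and cinner_commute:
      "\<lbrakk>x \<in> carrier H; y \<in> carrier H\<rbrakk> \<Longrightarrow> cinner H y x = cnj (cinner H x y)"
    and cinner_pos:
      "\<lbrakk>x \<in> carrier H; x \<noteq> \<zero>\<^bsub>H\<^esub>\<rbrakk> \<Longrightarrow> 0 < Re (cinner H x x)"
    and complete:
      "\<lbrakk>\<And>n :: nat. u n \<in> carrier H;
        \<And>e :: real. 0 < e \<Longrightarrow> \<exists>N. \<forall>m\<ge>N. \<forall>n\<ge>N. hnorm H (u m \<ominus>\<^bsub>H\<^esub> u n) < e\<rbrakk> \<Longrightarrow>
        \<exists>l\<in>carrier H. (\<lambda>n. hnorm H (u n \<ominus>\<^bsub>H\<^esub> l)) \<longlonglongrightarrow> 0"


section \<open>Bounded operators\<close>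

text \<open>
  An operator on \<open>H\<close> is a function on the ambient type of which only the values on \<open>carrier H\<close>
  matter.
\<close>

definition bounded_op :: "'a chilbert \<Rightarrow> ('a \<Rightarrow> 'a) \<Rightarrow> bool" where
  "bounded_op H A \<longleftrightarrow>
     A \<in> carrier H \<rightarrow> carrier H \<and>
     (\<forall>x\<in>carrier H. \<forall>y\<in>carrier H. A (x \<oplus>\<^bsub>H\<^esub> y) = A x \<oplus>\<^bsub>H\<^esub> A y) \<and>
     (\<forall>c. \<forall>x\<in>carrier H. A (c \<odot>\<^bsub>H\<^esub> x) = c \<odot>\<^bsub>H\<^esub> A x) \<and>
     (\<exists>K. \<forall>x\<in>carrier H. hnorm H (A x) \<le> K * hnorm H x)"

definition op_norm :: "'a chilbert \<Rightarrow> ('a \<Rightarrow> 'a) \<Rightarrow> real" where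
  "op_norm H A = Sup {hnorm H (A x) |x. x \<in> carrier H \<and> hnorm H x \<le> 1}"

definition invertible_op :: "'a chilbert \<Rightarrow> ('a \<Rightarrow> 'a) \<Rightarrow> bool" where
  "invertible_op H A \<longleftrightarrow>
     bounded_op H A \<and>
     (\<exists>B. bounded_op H B \<and> (\<forall>x\<in>carrier H. B (A x) = x \<and> A (B x) = x))"

definition op_inv :: "'a chilbert \<Rightarrow> ('a \<Rightarrow> 'a) \<Rightarrow> 'a \<Rightarrow> 'a" where
  "op_inv H A = inv_into (carrier H) A"

definition op_adj :: "'a chilbert \<Rightarrow> ('a \<Rightarrow> 'a) \<Rightarrow> 'a \<Rightarrow> 'a" where
  "op_adj H A y =
     (THE z. z \<in> carrier H \<and> (\<forall>x\<in>carrier H. cinner H (A x) y = cinner H x z))"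

definition positive_op :: "'a chilbert \<Rightarrow> ('a \<Rightarrow> 'a) \<Rightarrow> bool" where
  "positive_op H A \<longleftrightarrow> (\<forall>x\<in>carrier H. cinner H (A x) x \<in> \<real>\<^sub>\<ge>\<^sub>0)"


section \<open>Taylor joint spectrum\<close>

text \<open>
  Tuples are indexed by a finite linearly ordered type \<open>'n\<close>. An element of the Koszul complex
  (the tensor product of \<open>H\<close> with the exterior algebra on generators \<open>e\<^sub>i\<close>, for \<open>i :: 'n\<close>) is given
  by its coefficients: \<open>\<omega> S\<close> is the coefficient of the wedge of the \<open>e\<^sub>i\<close>, \<open>i \<in> S\<close>, taken in
  increasing order. The differential is the sum over \<open>i\<close> of \<open>T $ i\<close> tensored with left exterior
  multiplication by \<open>e\<^sub>i\<close>. It raises the degree by one, hence exactness in every degree is the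
  equality of its kernel and its range on the whole complex.
\<close>

definition commuting_tuple :: "'a chilbert \<Rightarrow> ('a \<Rightarrow> 'a) ^ 'n::finite \<Rightarrow> bool" where
  "commuting_tuple H T \<longleftrightarrow>
     (\<forall>i. bounded_op H (T $ i)) \<and>
     (\<forall>i j. \<forall>x\<in>carrier H. (T $ i) ((T $ j) x) = (T $ j) ((T $ i) x))"

definition koszul_space :: "'a chilbert \<Rightarrow> ('n::finite set \<Rightarrow> 'a) set" where
  "koszul_space H = UNIV \<rightarrow> carrier H"

definition koszul_diff ::
    "'a chilbert \<Rightarrow> ('a \<Rightarrow> 'a) ^ 'n::{finite,linorder} \<Rightarrow> ('n set \<Rightarrow> 'a) \<Rightarrow> 'n set \<Rightarrow> 'a" where
  "koszul_diff H T \<omega> S =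
     finsum H (\<lambda>i. ((-1) ^ card {j \<in> S. j < i}) \<odot>\<^bsub>H\<^esub> (T $ i) (\<omega> (S - {i}))) S"

definition koszul_exact :: "'a chilbert \<Rightarrow> ('a \<Rightarrow> 'a) ^ 'n::{finite,linorder} \<Rightarrow> bool" where
  "koszul_exact H T \<longleftrightarrow>
     {\<omega> \<in> koszul_space H. \<forall>S. koszul_diff H T \<omega> S = \<zero>\<^bsub>H\<^esub>} = koszul_diff H T ` koszul_space H"

definition taylor_spectrum ::
    "'a chilbert \<Rightarrow> ('a \<Rightarrow> 'a) ^ 'n::{finite,linorder} \<Rightarrow> (complex ^ 'n::{finite,linorder}) set" where
  "taylor_spectrum H T =
     {z. \<not> koszul_exact H (\<chi> i. (\<lambda>x. (T $ i) x \<ominus>\<^bsub>H\<^esub> (z $ i) \<odot>\<^bsub>H\<^esub> x))}"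


section \<open>Polynomials and rational functions of tuples\<close>

text \<open>The ring of complex polynomials in the variables \<open>z\<^sub>i\<close>, \<open>i :: 'n\<close>.\<close>

type_synonym 'n cpoly = "('n \<Rightarrow>\<^sub>0 nat) \<Rightarrow>\<^sub>0 complex"

definition poly_at :: "'n::finite cpoly \<Rightarrow> complex ^ 'n::finite \<Rightarrow> complex" where
  "poly_at p z =
     (\<Sum>m\<in>Poly_Mapping.keys p.
        Poly_Mapping.lookup p m * (\<Prod>i\<in>UNIV. (z $ i) ^ Poly_Mapping.lookup m i))"

definition monom_op ::
    "('a \<Rightarrow> 'a) ^ 'n::{finite,linorder} \<Rightarrow> ('n \<Rightarrow>\<^sub>0 nat) \<Rightarrow> 'a \<Rightarrow> 'a" where
  "monom_op T m =
     foldr (\<lambda>i A. ((T $ i) ^^ Poly_Mapping.lookup m i) \<circ> A) (sorted_list_of_set UNIV) id"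

definition poly_op ::
    "'a chilbert \<Rightarrow> 'n::{finite,linorder} cpoly \<Rightarrow> ('a \<Rightarrow> 'a) ^ 'n::{finite,linorder} \<Rightarrow> 'a \<Rightarrow> 'a" where
  "poly_op H p T x =
     finsum H (\<lambda>m. Poly_Mapping.lookup p m \<odot>\<^bsub>H\<^esub> monom_op T m x) (Poly_Mapping.keys p)"

definition rational_op ::
    "'a chilbert \<Rightarrow> 'n::{finite,linorder} cpoly \<Rightarrow> 'n cpoly \<Rightarrow>
     ('a \<Rightarrow> 'a) ^ 'n::{finite,linorder} \<Rightarrow> 'a \<Rightarrow> 'a" where
  "rational_op H p g T = poly_op H p T \<circ> op_inv H (poly_op H g T)"


section \<open>Von Neumann sets\<close>

text \<open>
  The supremum is taken in \<open>ennreal\<close>, so it may be \<open>\<infinity>\<close>. By the spectral mapping theorem \<open>g(T)\<close> is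
  invertible whenever the Taylor spectrum of \<open>T\<close> lies in \<open>Y\<close> and \<open>g\<close> has no zeros in \<open>Y\<close>.
\<close>

definition von_neumann_set ::
    "(complex ^ 'n::{finite,linorder}) set \<Rightarrow> 'a chilbert \<Rightarrow>
     ('a \<Rightarrow> 'a) ^ 'n::{finite,linorder} \<Rightarrow> bool" where
  "von_neumann_set Y H T \<longleftrightarrow>
     commuting_tuple H T \<and>
     taylor_spectrum H T \<subseteq> Y \<and>
     (\<forall>p g. g \<noteq> 0 \<and> (\<forall>\<xi>\<in>Y. poly_at g \<xi> \<noteq> 0) \<longrightarrow>
        ennreal (op_norm H (rational_op H p g T))
          \<le> (SUP \<xi>\<in>Y. ennreal (cmod (poly_at p \<xi> / poly_at g \<xi>))))"

definition minimal_closed_von_neumann_set ::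
    "(complex ^ 'n::{finite,linorder}) set \<Rightarrow>
     ('a chilbert \<times> (('a \<Rightarrow> 'a) ^ 'n::{finite,linorder})) set \<Rightarrow> bool" where
  "minimal_closed_von_neumann_set Y \<S> \<longleftrightarrow>
     closed Y \<and>
     (\<forall>(H, T)\<in>\<S>. von_neumann_set Y H T) \<and>
     (\<forall>Y\<^sub>1. closed Y\<^sub>1 \<and> Y\<^sub>1 \<subset> Y \<longrightarrow> (\<exists>(H, T)\<in>\<S>. \<not> von_neumann_set Y\<^sub>1 H T))"


section \<open>The operator classes and the map $\kappa_0$\<close>

definition PA_class :: "real \<Rightarrow> ('a chilbert \<times> ('a \<Rightarrow> 'a)) set" where
  "PA_class r = {(H, T). complex_hilbert_space H \<and> invertible_op H T \<and>
     positive_op H (\<lambda>x. complex_of_real (r\<^sup>2 + 1 / r\<^sup>2) \<odot>\<^bsub>H\<^esub> x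
       \<ominus>\<^bsub>H\<^esub> op_adj H T (T x)
       \<ominus>\<^bsub>H\<^esub> op_adj H (op_inv H T) (op_inv H T x))}"

definition QA_class :: "real \<Rightarrow> ('a chilbert \<times> ('a \<Rightarrow> 'a)) set" where
  "QA_class r = {(H, T). complex_hilbert_space H \<and> invertible_op H T \<and>
     op_norm H T \<le> 1 / r \<and> op_norm H (op_inv H T) \<le> 1 / r}"

text \<open>The type \<open>2\<close> has the two elements \<open>1\<close> and \<open>2\<close>, which index the first and second coordinate.\<close>

definition kappa0 :: "real \<Rightarrow> complex \<Rightarrow> complex ^ 2" where
  "kappa0 r z = (\<chi> i. (if i = 1 then z else inverse z) / complex_of_real (sqrt (1 / r\<^sup>2 + r\<^sup>2)))"

definition kappa0_op :: "real \<Rightarrow> 'a chilbert \<Rightarrow> ('a \<Rightarrow> 'a) \<Rightarrow> ('a \<Rightarrow> 'a) ^ 2" where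
  "kappa0_op r H T = (\<chi> i. (\<lambda>x. complex_of_real (1 / sqrt (1 / r\<^sup>2 + r\<^sup>2)) \<odot>\<^bsub>H\<^esub>
     (if i = 1 then T x else op_inv H T x)))"

definition kappa0_class ::
    "real \<Rightarrow> ('a chilbert \<times> ('a \<Rightarrow> 'a)) set \<Rightarrow> ('a chilbert \<times> (('a \<Rightarrow> 'a) ^ 2)) set" where
  "kappa0_class r \<C> = (\<lambda>(H, T). (H, kappa0_op r H T)) ` \<C>"

end

theory Submission
  imports Defs "HOL-Complex_Analysis.Complex_Analysis" "HOL-Real_Asymp.Real_Asymp"
begin

text \<open>
  If a rational function is bounded on \<open>\<kappa>\<^sub>0\<close> of the punctured disc, its pull-back to the disc has a
  removable singularity at \<open>0\<close>, so the von Neumann property reduces to von Neumann's inequality for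
  rational functions of the contraction \<open>r T\<close>. That inequality is proved for positive semidefinite
  forms on polynomials by discrete Fourier analysis on roots of unity.

  For minimality, a closed proper subset \<open>Y\<^sub>1\<close> misses some \<open>\<kappa>\<^sub>0(w)\<close>. If \<open>\<bar>w\<bar> \<ge> r\<close>, the scalar operator \<open>w\<close>
  lies in \<open>PA\<^sub>r\<close> and has its spectrum outside \<open>Y\<^sub>1\<close>. If \<open>\<bar>w\<bar> < r\<close>, let \<open>T\<close> be the adjoint of the bilateral
  weighted shift \<open>M\<close> with weights \<open>1/r\<close> on \<open>n \<ge> 0\<close> and \<open>r\<close> on \<open>n < 0\<close>. There is a quotient \<open>f\<close> of Blaschke
  products for the disc of radius \<open>1/r\<close> with a simple pole at \<open>w\<close> that is bounded by \<open>1\<close> off a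
  small neighbourhood of \<open>w\<close>. Unimodularity of \<open>f\<close> on the circle of radius \<open>1/r\<close> makes \<open>f(M)\<close>
  preserve the norm of \<open>L\<^sup>2\<close> of that circle; the pole forces negative Fourier coefficients, on which
  the norm of the model space is strictly larger. Hence \<open>f(T)\<close> has norm above \<open>1\<close>.
\<close>

hide_const (open) Module.smult UnivPoly.up_ring.coeff UnivPoly.up_ring.monom
  Polynomials.degree Polynomials.lead_coeff Coset.order

no_notation fps_nth (infixl "$" 75)

section \<open>Polynomial forms and the inequality for polynomials\<close>

text \<open>The split at \<open>r\<close> is forced: every operator in \<open>QA_class r\<close> has
  its spectrum in the annulus between the radii r and 1/r, so for |w| < r only the norm inequality
  can fail. The witness is the adjoint T and not M itself because at the jump of the weights the
  condition of \<open>PA_class\<close> reads r^2 + r^2 for T, but 1/r^2 + 1/r^2 for M, which is too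
  large. The gap is nevertheless visible on M, where supports move to one side, and has to be
  carried back by duality.

  Estimates compare P(T)x with G(T)x instead of mentioning an inverse of G(T); invertibility of G(T)
  is a consequence of such an estimate and not a prerequisite. Forms on polynomials are only
  semidefinite since three different ones are needed: p, q -> <p(T)x, q(T)x>, the defect B(p, q) -
  B(zp, zq), and the form of the circle. The first two degenerate in general.

  With v the Blaschke factor at the pole, the quotient f is the square of a second Blaschke factor
  divided by v: 1/v gives the pole, and one factor alone would leave values above 1 far away from
  it.\<close>

lemma smult_sum_right: "smult c (\<Sum>i\<in>A. f i) = (\<Sum>i\<in>A. smult c (f i))"
  by (induction A rule: infinite_finite_induct) (simp_all add: smult_add_right)

lemma norm_one_power_mult_cnj: "cmod z = 1 \<Longrightarrow> z ^ n * cnj z ^ n = 1"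
  by (metis complex_cnj_power complex_norm_square norm_power of_real_1 power_one)

locale poly_form =
  fixes B :: "complex poly \<Rightarrow> complex poly \<Rightarrow> complex"
  assumes add_left: "B (p + q) s = B p s + B q s"
    and smult_left: "B (smult c p) s = c * B p s"
    and commute: "B q p = cnj (B p q)"
    and pos: "0 \<le> Re (B p p)"
begin

definition E :: "complex poly \<Rightarrow> real" where
  "E p = Re (B p p)"

lemma E_nonneg: "0 \<le> E p"
  by (simp add: E_def pos)

lemma B_self: "B p p = complex_of_real (E p)"
  using commute[of p p] by (simp add: E_def complex_eq_iff)

lemma add_right: "B s (p + q) = B s p + B s q"
  by (metis add_left commute complex_cnj_add)

lemma smult_right: "B s (smult c p) = cnj c * B s p"
  by (metis smult_left commute complex_cnj_mult)

lemma zero_left: "B 0 s = 0"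
  using smult_left[of 0 0 s] by simp

lemma zero_right: "B s 0 = 0"
  using smult_right[of s 0 0] by simp

lemma sum_left: "B (\<Sum>i\<in>A. f i) s = (\<Sum>i\<in>A. B (f i) s)"
  by (induction A rule: infinite_finite_induct) (simp_all add: zero_left add_left)

lemma sum_right: "B s (\<Sum>i\<in>A. f i) = (\<Sum>i\<in>A. B s (f i))"
  by (induction A rule: infinite_finite_induct) (simp_all add: zero_right add_right)

lemma E_smult: "E (smult c p) = (cmod c)\<^sup>2 * E p"
proof -
  have "B (smult c p) (smult c p) = complex_of_real ((cmod c)\<^sup>2 * E p)"
    by (simp only: smult_left smult_right) (simp add: B_self complex_norm_square del: of_real_power flip: of_real_power)
  then show ?thesis by (simp add: E_def)
qed

text \<open>Averaging over the L-th roots of unity replaces integration over the circle: expanding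
  both arguments of the form leaves character sums, and distinct indices below L give distinct
  characters, so only the diagonal survives.\<close>

lemma roots_of_unity_parseval:
  assumes "0 < L"
  defines "\<omega> \<equiv> cis (2 * pi / real L)"
  shows "(\<Sum>k<L. E (\<Sum>n<L. smult (\<omega> ^ (k * n)) (c n))) = real L * (\<Sum>n<L. E (c n))"
proof -
  have orth: "(\<Sum>k<L. \<omega> ^ (k * n) * cnj (\<omega> ^ (k * m))) = (if n = m then of_nat L else 0)"
    if "n < L" "m < L" for n m
  proof (cases "n = m")
    case True
    then have "\<omega> ^ (k * n) * cnj (\<omega> ^ (k * m)) = 1" for k
      using norm_one_power_mult_cnj[of \<omega>] by (simp add: \<omega>_def)
    then show ?thesis using True by simp
  next
    case False
    define q where "q = cis (2 * pi * (real n - real m) / real L)"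
    have q: "\<omega> ^ (k * n) * cnj (\<omega> ^ (k * m)) = q ^ k" for k
    proof -
      have "\<omega> ^ n * cnj (\<omega> ^ m) = q"
        unfolding \<omega>_def q_def Complex.DeMoivre cis_cnj cis_mult
        by (rule arg_cong[where f = cis]) (simp add: ring_distribs diff_divide_distrib mult_ac)
      then show ?thesis
        by (simp add: power_mult[of _ n] power_mult[of _ m] mult.commute[of k] flip: power_mult_distrib)
    qed
    have "q \<noteq> 1"
    proof
      assume "q = 1"
      then obtain i :: int where "2 * pi * (real n - real m) / real L = 2 * pi * of_int i"
        unfolding q_def cis_conv_exp exp_eq_1 by (auto simp: mult_ac)
      then have "2 * pi * (real n - real m) = 2 * pi * (of_int i * real L)"
        using assms(1) by (simp add: divide_simps mult_ac)
      then have "real n - real m = of_int i * real L"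
        by (simp only: mult_cancel_left) simp
      then have "real_of_int (int n - int m) = of_int (i * int L)"
        by simp
      then have *: "int n - int m = i * int L" by (simp only: of_int_eq_iff)
      moreover have "\<bar>int n - int m\<bar> < int L" using that by linarith
      ultimately have "\<bar>i\<bar> * int L < 1 * int L" by (simp add: abs_mult)
      then have "i = 0" using assms(1) by (simp only: mult_less_cancel_right) auto
      then show False using * False by simp
    qed
    moreover have "q ^ L = 1"
      unfolding q_def Complex.DeMoivre using assms(1) cis_multiple_2pi[of "real n - real m"]
      by (simp add: mult_ac)
    ultimately show ?thesis using False geometric_sum[of q L] by (simp only: q) simp
  qed
  have "complex_of_real (\<Sum>k<L. E (\<Sum>n<L. smult (\<omega> ^ (k * n)) (c n)))
      = (\<Sum>k<L. \<Sum>n<L. \<Sum>m<L. (\<omega> ^ (k * n) * cnj (\<omega> ^ (k * m))) * B (c n) (c m))"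
    by (simp only: of_real_sum B_self[symmetric] sum_left)
      (simp add: sum_right smult_left smult_right sum_distrib_left mult_ac)
  also have "\<dots> = (\<Sum>n<L. \<Sum>k<L. \<Sum>m<L. (\<omega> ^ (k * n) * cnj (\<omega> ^ (k * m))) * B (c n) (c m))"
    by (rule sum.swap)
  also have "\<dots> = (\<Sum>n<L. \<Sum>m<L. \<Sum>k<L. (\<omega> ^ (k * n) * cnj (\<omega> ^ (k * m))) * B (c n) (c m))"
    by (intro sum.cong refl sum.swap)
  also have "\<dots> = (\<Sum>n<L. \<Sum>m<L. (if n = m then of_nat L else 0) * B (c n) (c m))"
    by (intro sum.cong refl) (simp only: sum_distrib_right[symmetric] orth lessThan_iff)
  also have "\<dots> = (\<Sum>n<L. of_nat L * B (c n) (c n))"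
    by (intro sum.cong refl) (simp add: if_distrib[of "\<lambda>x. x * _"] sum.delta cong: if_cong)
  also have "\<dots> = complex_of_real (real L * (\<Sum>n<L. E (c n)))"
    by (simp add: B_self sum_distrib_left)
  finally show ?thesis by (simp only: of_real_eq_iff)
qed

text \<open>The sequence z^n P, n < N, is convolved with the reversed coefficients of f. A discrete
  Fourier transform turns the convolution into multiplication by a value of f on the circle, bounded
  by M, and Parseval translates back. No relation between B and multiplication by z is used, so the
  bound is available for every semidefinite form.\<close>

lemma shifted_sum_le:
  assumes deg: "degree f \<le> d" and "d \<le> N"
    and bound: "\<And>z. cmod z = 1 \<Longrightarrow> cmod (poly f z) \<le> M"
  shows "(\<Sum>i<N - d. E (monom 1 i * (f * P))) \<le> M\<^sup>2 * (\<Sum>n<N. E (monom 1 n * P))"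
proof (cases "N = 0")
  case True
  then show ?thesis by simp
next
  case False
  \<comment> \<open>The convolution is supported on indices up to d + N - 1, so a period of N + d
    avoids wrap-around.\<close>
  define L where "L = N + d"
  define \<omega> where "\<omega> = cis (2 * pi / real L)"
  have L: "0 < L" using False by (simp add: L_def)
  define S where "S = {..d} \<times> {..<N}"
  define c where "c m = (\<Sum>(j, n)\<in>{x\<in>S. fst x + snd x = m}. smult (coeff f (d - j)) (monom 1 n * P))" for m
  define Y where "Y k = (\<Sum>n<N. smult (\<omega> ^ (k * n)) (monom 1 n * P))" for k
  have norm_\<omega>: "cmod \<omega> = 1" by (simp add: \<omega>_def)
  have gY: "(\<Sum>m<L. smult (\<omega> ^ (k * m)) (c m))
      = smult (\<omega> ^ (k * d) * poly f (cnj (\<omega> ^ k))) (Y k)" for k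
  proof -
    have "(\<Sum>m<L. smult (\<omega> ^ (k * m)) (c m)) =
      (\<Sum>m<L. \<Sum>x\<in>{x\<in>S. fst x + snd x = m}.
        smult (\<omega> ^ (k * (fst x + snd x)) * coeff f (d - fst x)) (monom 1 (snd x) * P))"
      unfolding c_def smult_sum_right by (intro sum.cong refl) auto
    also have "\<dots> = (\<Sum>x\<in>S. smult (\<omega> ^ (k * (fst x + snd x)) * coeff f (d - fst x)) (monom 1 (snd x) * P))"
      by (rule sum.group) (auto simp: S_def L_def)
    also have "\<dots> = (\<Sum>j\<le>d. \<Sum>n<N. smult (\<omega> ^ (k * j) * coeff f (d - j)) (smult (\<omega> ^ (k * n)) (monom 1 n * P)))"
      unfolding S_def sum.cartesian_product by (intro sum.cong refl) (auto simp: power_add distrib_left mult_ac)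
    also have "\<dots> = smult (\<Sum>j\<le>d. \<omega> ^ (k * j) * coeff f (d - j)) (Y k)"
      unfolding Y_def smult_sum by (simp add: smult_sum_right)
    also have "(\<Sum>j\<le>d. \<omega> ^ (k * j) * coeff f (d - j)) = (\<Sum>i\<le>d. \<omega> ^ (k * (d - i)) * coeff f i)"
      by (rule sum.reindex_bij_witness[of _ "\<lambda>i. d - i" "\<lambda>i. d - i"]) auto
    also have "\<dots> = (\<Sum>i\<le>d. \<omega> ^ (k * d) * (coeff f i * cnj (\<omega> ^ k) ^ i))"
    proof (intro sum.cong refl)
      fix i assume "i \<in> {..d}"
      then have "\<omega> ^ (k * d) = \<omega> ^ (k * (d - i)) * \<omega> ^ (k * i)"
        by (simp add: power_add[symmetric] distrib_left[symmetric])
      moreover have "\<omega> ^ (k * i) * cnj (\<omega> ^ k) ^ i = 1"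
        using norm_one_power_mult_cnj[OF norm_\<omega>, of "k * i"] by (simp add: power_mult)
      ultimately show "\<omega> ^ (k * (d - i)) * coeff f i = \<omega> ^ (k * d) * (coeff f i * cnj (\<omega> ^ k) ^ i)"
        by (simp add: mult_ac)
    qed
    also have "\<dots> = \<omega> ^ (k * d) * poly f (cnj (\<omega> ^ k))"
      unfolding sum_distrib_left[symmetric] poly_altdef[of f]
      by (subst sum.mono_neutral_right[of "{..d}" "{..degree f}"]) (auto simp: deg coeff_eq_0)
    finally show ?thesis .
  qed
  \<comment> \<open>For d <= m < N the window of f lies entirely inside the range n < N, so the
    convolution is a genuine shift of f P. The remaining m are boundary terms.\<close>
  have c_mid: "c m = monom 1 (m - d) * (f * P)" if "d \<le> m" "m < N" for m
  proof -
    have "c m = (\<Sum>i\<le>d. smult (coeff f i) (monom 1 (m - d + i) * P))"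
      unfolding c_def S_def using that
      by (intro sum.reindex_bij_witness[of _ "\<lambda>i. (d - i, m - d + i)" "\<lambda>x. d - fst x"]) auto
    also have "\<dots> = monom 1 (m - d) * ((\<Sum>i\<le>d. monom (coeff f i) i) * P)"
    proof -
      have "smult (coeff f i) (monom 1 (m - d + i) * P) = monom 1 (m - d) * (monom (coeff f i) i * P)" for i
        by (simp only: mult_smult_left[symmetric] mult.assoc[symmetric] mult_monom smult_monom) simp
      then show ?thesis by (simp add: sum_distrib_left sum_distrib_right)
    qed
    also have "(\<Sum>i\<le>d. monom (coeff f i) i) = f"
      by (rule poly_as_sum_of_monoms') (rule deg)
    finally show ?thesis .
  qed
  have "(\<Sum>i<N - d. E (monom 1 i * (f * P))) = (\<Sum>m=d..<N. E (c m))"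
    using assms(2) c_mid
    by (intro sum.reindex_bij_witness[of _ "\<lambda>m. m - d" "\<lambda>i. i + d"]) auto
  \<comment> \<open>The boundary terms are not identified; being nonnegative, they can only enlarge
    the sum.\<close>
  also have "\<dots> \<le> (\<Sum>m<L. E (c m))"
    by (intro sum_mono2) (auto simp: L_def E_nonneg)
  finally have "real L * (\<Sum>i<N - d. E (monom 1 i * (f * P))) \<le> real L * (\<Sum>m<L. E (c m))"
    by (simp add: mult_left_mono)
  also have "\<dots> = (\<Sum>k<L. E (\<Sum>m<L. smult (\<omega> ^ (k * m)) (c m)))"
    unfolding \<omega>_def by (rule roots_of_unity_parseval[OF L, symmetric])
  also have "\<dots> \<le> (\<Sum>k<L. M\<^sup>2 * E (Y k))"
  proof (intro sum_mono)
    fix k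
    have "cmod (\<omega> ^ (k * d) * poly f (cnj (\<omega> ^ k))) \<le> M"
      using bound[of "cnj (\<omega> ^ k)"] by (simp add: norm_mult norm_power norm_\<omega>)
    then show "E (\<Sum>m<L. smult (\<omega> ^ (k * m)) (c m)) \<le> M\<^sup>2 * E (Y k)"
      unfolding gY E_smult by (intro mult_right_mono power_mono) (auto simp: E_nonneg)
  qed
  \<comment> \<open>Zero padding from length N to length L makes Parseval applicable to the input
    sequence too.\<close>
  also have "\<dots> = M\<^sup>2 * (\<Sum>k<L. E (\<Sum>n<L. smult (\<omega> ^ (k * n)) (if n < N then monom 1 n * P else 0)))"
  proof -
    have "Y k = (\<Sum>n<L. smult (\<omega> ^ (k * n)) (if n < N then monom 1 n * P else 0))" for k
      unfolding Y_def by (rule sum.mono_neutral_cong_left) (auto simp: L_def)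
    then show ?thesis by (simp add: sum_distrib_left)
  qed
  also have "\<dots> = M\<^sup>2 * (real L * (\<Sum>n<L. E (if n < N then monom 1 n * P else 0)))"
    unfolding \<omega>_def by (subst roots_of_unity_parseval[OF L]) simp
  also have "(\<Sum>n<L. E (if n < N then monom 1 n * P else 0)) = (\<Sum>n<N. E (monom 1 n * P))"
    by (rule sum.mono_neutral_cong_right) (auto simp: L_def E_def zero_left)
  finally show ?thesis using L by (simp add: mult_ac)
qed


text \<open>
  \<open>shifted_sum_le\<close> is used twice: the form \<open>B(p, q) - B(zp, zq)\<close> telescopes and gives the bound up
  to the tail \<open>E(z\<^sup>n f P)\<close>, and \<open>B\<close> itself bounds that tail on average.
\<close>

lemma E_contraction_le:
  assumes contr: "\<And>p. E (monom 1 1 * p) \<le> E p"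
    and bound: "\<And>z. cmod z = 1 \<Longrightarrow> cmod (poly f z) \<le> M"
  shows "E (f * P) \<le> M\<^sup>2 * E P"
proof -
  define B' where "B' p q = B p q - B (monom 1 1 * p) (monom 1 1 * q)" for p q
  interpret D: poly_form B'
    unfolding B'_def by unfold_locales
      (use contr in \<open>auto simp: E_def add_left smult_left algebra_simps commute[symmetric]\<close>)
  have shift: "monom 1 1 * (monom 1 n * p) = monom 1 (Suc n) * p" for n and p :: "complex poly"
    by (simp add: mult_monom flip: mult.assoc)
  have D: "D.E p = E p - E (monom 1 1 * p)" for p
    by (simp add: D.E_def E_def B'_def)
  have telescope: "(\<Sum>i<n. D.E (monom 1 i * p)) = E p - E (monom 1 n * p)" for n p
    by (induction n) (simp_all add: D shift[unfolded One_nat_def])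
  have anti: "E (monom 1 (n + m) * p) \<le> E (monom 1 m * p)" for n m p
  proof (induction n)
    case (Suc n)
    then show ?case using contr[of "monom 1 (n + m) * p"] by (simp only: shift add_Suc)
  qed simp
  define d where "d = degree f"
  define e where "e n = E (monom 1 n * P)" for n
  have "decseq e"
    using anti[where p = P] unfolding decseq_def e_def by (metis le_add_diff_inverse2)
  moreover have "0 \<le> e n" for n by (simp add: e_def E_nonneg)
  ultimately obtain l where l: "e \<longlonglongrightarrow> l"
    by (metis decseq_convergent)
  \<comment> \<open>Telescoping over N + k terms leaves the tail at N - d + k. That tail is at most
    each of the N - d earlier values summed by \<open>shifted_sum_le\<close> for z^k P, hence at
    most their average. The offset k makes both \<open>e k\<close> and \<open>e (N + k)\<close>
    approach the same limit.\<close>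
  have main: "E (f * P) \<le> M\<^sup>2 * (real N / real (N - d) * e k - e (N + k) + E P)"
    if "d < N" for N k
  proof -
    have "real (N - d) * E (monom 1 (N - d + k) * (f * P)) = (\<Sum>i<N - d. E (monom 1 (N - d + k) * (f * P)))"
      by (simp only: sum_constant card_lessThan)
    also have "\<dots> \<le> (\<Sum>i<N - d. E (monom 1 i * (f * (monom 1 k * P))))"
    proof (intro sum_mono)
      fix i assume "i \<in> {..<N - d}"
      then have "E (monom 1 (N - d - i + (i + k)) * (f * P)) \<le> E (monom 1 (i + k) * (f * P))"
        by (intro anti)
      moreover have "monom 1 (i + k) * (f * P) = monom 1 i * (f * (monom 1 k * P))"
        using mult_monom[of "1 :: complex" i 1 k] by (simp add: mult_ac)
      ultimately show "E (monom 1 (N - d + k) * (f * P)) \<le> E (monom 1 i * (f * (monom 1 k * P)))"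
        using \<open>i \<in> _\<close> by simp
    qed
    also have "\<dots> \<le> M\<^sup>2 * (\<Sum>n<N. E (monom 1 n * (monom 1 k * P)))"
      using that by (intro shifted_sum_le bound) (auto simp: d_def)
    also have "\<dots> \<le> M\<^sup>2 * (\<Sum>n<N. e k)"
    proof (intro mult_left_mono sum_mono)
      fix n
      show "E (monom 1 n * (monom 1 k * P)) \<le> e k"
        using anti[of n k P] by (simp add: e_def mult_monom flip: mult.assoc)
    qed simp
    finally have 1: "E (monom 1 (N - d + k) * (f * P)) \<le> M\<^sup>2 * (real N / real (N - d) * e k)"
      using that by (simp add: field_simps)
    have "E (f * P) - E (monom 1 (N - d + k) * (f * P)) = (\<Sum>i<(N + k) - d. D.E (monom 1 i * (f * P)))"
      using that by (simp only: telescope Nat.add_diff_assoc2 less_imp_le)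
    also have "\<dots> \<le> M\<^sup>2 * (\<Sum>n<N + k. D.E (monom 1 n * P))"
      using that by (intro D.shifted_sum_le bound) (auto simp: d_def)
    also have "\<dots> = M\<^sup>2 * (E P - e (N + k))"
      by (simp add: telescope e_def)
    finally show ?thesis using 1 by (simp add: algebra_simps)
  qed
  \<comment> \<open>The limits are taken in this order: k first, with N fixed, turns both tails into
    l; then N, for which the boundary loss N / (N - d) tends to 1 and the two copies of l
    cancel.\<close>
  have lim: "E (f * P) \<le> M\<^sup>2 * (real N / real (N - d) * l - l + E P)" if "d < N" for N
  proof (rule LIMSEQ_le_const)
    show "(\<lambda>k. M\<^sup>2 * (real N / real (N - d) * e k - e (N + k) + E P))
        \<longlonglongrightarrow> M\<^sup>2 * (real N / real (N - d) * l - l + E P)"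
      using LIMSEQ_ignore_initial_segment[OF l, of N]
      by (intro tendsto_intros l) (simp add: add.commute)
  qed (use main[OF that] in auto)
  have "E (f * P) \<le> M\<^sup>2 * (1 * l - l + E P)"
  proof (rule LIMSEQ_le_const)
    have "(\<lambda>N. real (N + Suc d) / real (Suc N)) \<longlonglongrightarrow> 1" by real_asymp
    then show "(\<lambda>N. M\<^sup>2 * (real (N + Suc d) / real (Suc N) * l - l + E P)) \<longlonglongrightarrow> M\<^sup>2 * (1 * l - l + E P)"
      by (intro tendsto_intros)
  qed (use lim[of "_ + Suc d"] in \<open>auto simp: Suc_diff_le\<close>)
  then show ?thesis by simp
qed

end

text \<open>The discriminant argument, stated for bare numbers because it serves three quadratic
  functions: the one of a semidefinite form, the one of the inner product, and the near-minimality
  inequality in the Riesz theorem. Semidefinite forms make the case d = 0 unavoidable.\<close>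

lemma quadratic_cauchy_schwarz:
  assumes "\<And>c. 0 \<le> a + 2 * Re (c * b) + (cmod c)\<^sup>2 * d" and "0 \<le> d"
  shows "(cmod b)\<^sup>2 \<le> a * d"
proof (cases "d = 0")
  case True
  have "b = 0"
  proof (rule ccontr)
    assume "b \<noteq> 0"
    define t where "t = (\<bar>a\<bar> + 1) / (cmod b)\<^sup>2"
    have "Re (- of_real t * cnj b * b) = - t * (cmod b)\<^sup>2"
      by (simp add: cmod_power2) (simp add: power2_eq_square algebra_simps)
    then have "0 \<le> a - 2 * (t * (cmod b)\<^sup>2)"
      using assms(1)[of "- of_real t * cnj b"] True by simp
    then show False using \<open>b \<noteq> 0\<close> by (simp add: t_def)
  qed
  then show ?thesis using True by simp
next
  case False
  define c where "c = - cnj b / of_real d"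
  have "Re (c * b) = - (cmod b)\<^sup>2 / d"
    by (simp add: c_def cmod_power2 Re_divide_of_real) (simp add: power2_eq_square add_divide_distrib diff_divide_distrib)
  moreover have "(cmod c)\<^sup>2 * d = (cmod b)\<^sup>2 / d"
    using False assms(2) by (simp add: c_def norm_divide power2_eq_square)
  ultimately have "0 \<le> a - (cmod b)\<^sup>2 / d"
    using assms(1)[of c] by simp
  then show ?thesis using False assms(2) by (simp add: field_simps)
qed

lemma quadratic_triangle:
  assumes "(cmod b)\<^sup>2 \<le> a * d" and "0 \<le> a" and "0 \<le> d"
  shows "sqrt (a + 2 * Re b + d) \<le> sqrt a + sqrt d"
proof (rule real_le_lsqrt)
  have "cmod b \<le> sqrt a * sqrt d"
    using assms by (simp add: real_le_rsqrt flip: real_sqrt_mult)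
  then have "Re b \<le> sqrt a * sqrt d"
    using complex_Re_le_cmod[of b] by linarith
  then show "a + 2 * Re b + d \<le> (sqrt a + sqrt d)\<^sup>2"
    using assms by (simp add: power2_sum)
qed (use assms in simp)

text \<open>By compactness the zeros of G keep a positive distance from the closed disc, so P / G is
  holomorphic on a larger disc and its Taylor sums converge uniformly on the smaller one.\<close>

lemma rational_uniform_approx:
  fixes P G :: "complex poly"
  assumes "0 < R" and G: "\<And>z. cmod z \<le> R \<Longrightarrow> poly G z \<noteq> 0"
  shows "\<exists>F :: nat \<Rightarrow> complex poly. \<forall>e>0. \<forall>\<^sub>F n in sequentially. \<forall>z. cmod z \<le> R \<longrightarrow> cmod (poly (F n) z - poly P z / poly G z) < e"
proof -
  have "open (- {z. poly G z = 0})"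
    by (intro open_Compl closed_Collect_eq continuous_intros)
  then obtain \<epsilon> where \<epsilon>: "\<epsilon> > 0" "(\<Union>x\<in>cball 0 R. ball x \<epsilon>) \<subseteq> - {z. poly G z = 0}"
    by (rule compact_subset_open_imp_ball_epsilon_subset[OF compact_cball]) (use G in auto)
  define f where "f z = poly P z / poly G z" for z
  have nz: "poly G z \<noteq> 0" if z: "cmod z < R + \<epsilon>" for z
  proof (cases "cmod z \<le> R")
    case True
    then show ?thesis using G by simp
  next
    case False
    \<comment> \<open>The radial projection of z onto the circle of radius R; its distance from z is
      |z| - R.\<close>
    define x where "x = of_real (R / cmod z) * z"
    have "cmod x = R" using False assms(1) unfolding x_def norm_mult norm_of_real by auto
    moreover have "dist x z < \<epsilon>"
    proof -
      have "x - z = of_real (R / cmod z - 1) * z" by (simp add: x_def algebra_simps)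
      then have "dist x z = \<bar>R / cmod z - 1\<bar> * cmod z" by (simp only: dist_norm norm_mult norm_of_real)
      also have "\<dots> = cmod z - R"
      proof -
        have "R / cmod z - 1 \<le> 0" using False assms(1) by (simp add: divide_le_eq)
        moreover have "cmod z \<noteq> 0" using False assms(1) by linarith
        ultimately show ?thesis by (simp add: abs_of_nonpos algebra_simps)
      qed
      finally show ?thesis using z by simp
    qed
    ultimately have "z \<in> (\<Union>x\<in>cball 0 R. ball x \<epsilon>)" by auto
    then show ?thesis using \<epsilon>(2) by blast
  qed
  have "f holomorphic_on ball 0 (R + \<epsilon>)"
    unfolding f_def using nz by (intro holomorphic_intros) auto
  define a where "a n = (deriv ^^ n) f 0 / fact n" for n
  have sums: "(\<lambda>n. a n * z ^ n) sums f z" if "cmod z < R + \<epsilon>" for z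
    using holomorphic_power_series[OF \<open>f holomorphic_on _\<close>, of z] that by (simp add: a_def)
  have "ereal R < conv_radius a"
  proof -
    have "cmod (of_real (R + \<epsilon> / 2)) \<le> conv_radius a"
      using sums[of "of_real (R + \<epsilon> / 2)"] \<epsilon>(1) assms(1)
      by (intro conv_radius_geI) (auto simp: sums_iff simp del: of_real_add of_real_divide)
    moreover have "ereal R < cmod (of_real (R + \<epsilon> / 2))"
      using \<epsilon>(1) assms(1) by (simp del: of_real_add of_real_divide)
    ultimately show ?thesis by (rule order.strict_trans2[rotated])
  qed
  from powser_uniform_limit[OF this, of 0]
  have lim: "uniform_limit (cball 0 R) (\<lambda>n z. \<Sum>i<n. a i * z ^ i) (\<lambda>z. suminf (\<lambda>i. a i * z ^ i)) sequentially"
    by simp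
  define F where "F n = (\<Sum>i<n. monom (a i) i)" for n
  have "\<forall>\<^sub>F n in sequentially. \<forall>z. cmod z \<le> R \<longrightarrow> cmod (poly (F n) z - poly P z / poly G z) < e"
    if "0 < e" for e
  proof -
    have "\<forall>\<^sub>F n in sequentially. \<forall>z\<in>cball 0 R. dist (\<Sum>i<n. a i * z ^ i) (suminf (\<lambda>i. a i * z ^ i)) < e"
      using lim that unfolding uniform_limit_iff by blast
    then show ?thesis
    proof (rule eventually_mono, intro allI impI)
      fix n z assume *: "\<forall>z\<in>cball 0 R. dist (\<Sum>i<n. a i * z ^ i) (suminf (\<lambda>i. a i * z ^ i)) < e" and z: "cmod z \<le> R"
      have "suminf (\<lambda>i. a i * z ^ i) = poly P z / poly G z"
        using sums[of z] z \<epsilon>(1) by (simp add: sums_iff f_def)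
      then show "cmod (poly (F n) z - poly P z / poly G z) < e"
        using bspec[OF *, of z] z by (simp add: F_def poly_sum poly_monom dist_norm)
    qed
  qed
  then show ?thesis by blast
qed

section \<open>From polynomials to rational functions\<close>

context poly_form
begin

lemma E_add: "E (p + q) = E p + 2 * Re (B p q) + E q"
  using commute[of p q] by (simp add: E_def add_left add_right)

lemma sqrt_E_add_le: "sqrt (E (p + q)) \<le> sqrt (E p) + sqrt (E q)"
proof -
  have "(cmod (B p q))\<^sup>2 \<le> E p * E q"
  proof (rule quadratic_cauchy_schwarz)
    fix c
    show "0 \<le> E p + 2 * Re (c * B p q) + (cmod c)\<^sup>2 * E q"
      using E_nonneg[of "p + smult (cnj c) q"] by (simp add: E_add E_smult smult_right)
  qed (rule E_nonneg)
  then show ?thesis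
    unfolding E_add by (rule quadratic_triangle) (rule E_nonneg)+
qed

text \<open>Substituting z / R for the variable and pulling the form back reduces to the contractive
  case on the unit circle.\<close>

lemma E_polynomial_le:
  assumes "0 < R"
    and contr: "\<And>p. E (monom 1 1 * p) \<le> R\<^sup>2 * E p"
    and bound: "\<And>z. cmod z \<le> R \<Longrightarrow> cmod (poly f z) \<le> M"
  shows "E (f * P) \<le> M\<^sup>2 * E P"
proof -
  define s where "s p = pcompose p [:0, complex_of_real (1 / R):]" for p
  define s' where "s' p = pcompose p [:0, complex_of_real R:]" for p
  have ss': "s (s' p) = p" for p
    using assms(1) by (simp add: s_def s'_def pcompose_assoc[symmetric] pcompose_pCons pcompose_idR)
  define B' where "B' p q = B (s p) (s q)" for p q
  interpret S: poly_form B'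
    unfolding B'_def s_def
    by unfold_locales
      (auto simp: pcompose_add pcompose_smult add_left smult_left commute[symmetric] pos)
  have E': "S.E p = E (s p)" for p
    by (simp add: S.E_def E_def B'_def)
  have "S.E (monom 1 1 * p) \<le> S.E p" for p
  proof -
    have "s (monom 1 1 * p) = smult (of_real (1 / R)) (monom 1 1 * s p)"
      by (simp add: s_def pcompose_mult monom_altdef pcompose_pCons)
    then have "S.E (monom 1 1 * p) = (1 / R)\<^sup>2 * E (monom 1 1 * s p)"
      using assms(1) by (simp only: E' E_smult norm_of_real) simp
    also have "\<dots> \<le> (1 / R)\<^sup>2 * (R\<^sup>2 * E (s p))"
      by (intro mult_left_mono contr) auto
    finally show ?thesis using assms(1) by (simp add: E' power_divide)
  qed
  moreover have "cmod (poly (s' f) z) \<le> M" if "cmod z = 1" for z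
    using that assms(1) bound[of "z * of_real R"] by (simp add: s'_def poly_pcompose norm_mult)
  ultimately have "S.E (s' f * s' P) \<le> M\<^sup>2 * S.E (s' P)"
    by (rule S.E_contraction_le)
  moreover have "s (s' f * s' P) = f * P"
    using ss' by (simp add: s_def pcompose_mult)
  ultimately show ?thesis by (simp add: E' ss')
qed

text \<open>Nothing can be divided by G inside the polynomials, hence the cross-multiplied form.
  With F a polynomial close to P / G, write P Q = F (G Q) + (P - F G) Q: the first factor is bounded
  by M + e, the second by a multiple of e, and e tends to 0.\<close>

theorem E_rational_le:
  assumes "0 < R"
    and contr: "\<And>p. E (monom 1 1 * p) \<le> R\<^sup>2 * E p"
    and nz: "\<And>z. cmod z \<le> R \<Longrightarrow> poly G z \<noteq> 0"
    and bound: "\<And>z. cmod z \<le> R \<Longrightarrow> cmod (poly P z) \<le> M * cmod (poly G z)"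
  shows "E (P * Q) \<le> M\<^sup>2 * E (G * Q)"
proof -
  have norm_le: "sqrt (E (f * p)) \<le> m * sqrt (E p)"
    if "\<And>z. cmod z \<le> R \<Longrightarrow> cmod (poly f z) \<le> m" for f p m
  proof -
    have "0 \<le> m" using that[of 0] assms(1) order_trans[OF norm_ge_zero[of "poly f 0"]] by simp
    moreover have "sqrt (E (f * p)) \<le> sqrt (m\<^sup>2 * E p)"
      using E_polynomial_le[OF assms(1) contr that] by simp
    ultimately show ?thesis by (simp add: real_sqrt_mult)
  qed
  have "0 \<le> M"
  proof -
    have "0 \<le> M * cmod (poly G 0)"
      using bound[of 0] assms(1) order_trans[OF norm_ge_zero[of "poly P 0"]] by simp
    then show ?thesis using nz[of 0] assms(1) by (simp add: zero_le_mult_iff)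
  qed
  obtain F where F: "\<And>e. 0 < e \<Longrightarrow> \<forall>\<^sub>F n in sequentially. \<forall>z. cmod z \<le> R \<longrightarrow> cmod (poly (F n) z - poly P z / poly G z) < e"
    using rational_uniform_approx[OF assms(1) nz, where P = P] by blast
  have "bounded (poly G ` cball 0 R)"
    by (intro compact_imp_bounded compact_continuous_image continuous_intros) auto
  then obtain K where K: "\<forall>z\<in>cball 0 R. cmod (poly G z) \<le> K"
    unfolding bounded_iff by auto
  have *: "sqrt (E (P * Q)) \<le> (M + e) * sqrt (E (G * Q)) + e * K * sqrt (E Q)" if e: "0 < e" for e
  proof -
    obtain n where "\<forall>z. cmod z \<le> R \<longrightarrow> cmod (poly (F n) z - poly P z / poly G z) < e"
      using eventually_happens'[OF sequentially_bot F[OF e]] by blast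
    then have n: "cmod z \<le> R \<Longrightarrow> cmod (poly (F n) z - poly P z / poly G z) < e" for z by blast
    have 1: "cmod (poly (F n) z) \<le> M + e" if "cmod z \<le> R" for z
    proof -
      have "cmod (poly (F n) z) \<le> cmod (poly P z / poly G z) + cmod (poly (F n) z - poly P z / poly G z)"
        by (rule norm_triangle_sub)
      also have "cmod (poly P z / poly G z) \<le> M"
        using bound[OF that] nz[OF that] by (simp add: norm_divide field_simps)
      finally show ?thesis using n[OF that] by simp
    qed
    have 2: "cmod (poly (P - F n * G) z) \<le> e * K" if "cmod z \<le> R" for z
    proof -
      have "poly (P - F n * G) z = - ((poly (F n) z - poly P z / poly G z) * poly G z)"
        using nz[OF that] by (simp add: field_simps)
      also have "cmod \<dots> \<le> e * K"
        unfolding norm_minus_cancel norm_mult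
        using n[OF that] K that e by (intro mult_mono) auto
      finally show ?thesis .
    qed
    have "P * Q = F n * (G * Q) + (P - F n * G) * Q" by (simp add: algebra_simps)
    then have "sqrt (E (P * Q)) \<le> sqrt (E (F n * (G * Q))) + sqrt (E ((P - F n * G) * Q))"
      using sqrt_E_add_le[of "F n * (G * Q)" "(P - F n * G) * Q"] by simp
    also have "\<dots> \<le> (M + e) * sqrt (E (G * Q)) + e * K * sqrt (E Q)"
      by (intro add_mono norm_le 1 2)
    finally show ?thesis .
  qed
  have "sqrt (E (P * Q)) \<le> (M + 0) * sqrt (E (G * Q)) + 0 * K * sqrt (E Q)"
  proof (rule tendsto_lowerbound)
    show "((\<lambda>e. (M + e) * sqrt (E (G * Q)) + e * K * sqrt (E Q)) \<longlongrightarrow> (M + 0) * sqrt (E (G * Q)) + 0 * K * sqrt (E Q)) (at_right 0)"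
      by (intro tendsto_intros)
    show "\<forall>\<^sub>F e in at_right 0. sqrt (E (P * Q)) \<le> (M + e) * sqrt (E (G * Q)) + e * K * sqrt (E Q)"
      using * by (auto simp: eventually_at_filter)
  qed simp
  then have "(sqrt (E (P * Q)))\<^sup>2 \<le> (M * sqrt (E (G * Q)))\<^sup>2"
    by (intro power_mono) (auto simp: E_nonneg)
  then show ?thesis by (simp add: power_mult_distrib E_nonneg)
qed

end

section \<open>Hilbert spaces\<close>

lemma ring_of_type_algebra_simps [simp]:
  "carrier ring_of_type_algebra = UNIV"
  "x \<oplus>\<^bsub>ring_of_type_algebra\<^esub> y = x + y"
  "x \<otimes>\<^bsub>ring_of_type_algebra\<^esub> y = x * y"
  "\<zero>\<^bsub>ring_of_type_algebra\<^esub> = 0"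
  "\<one>\<^bsub>ring_of_type_algebra\<^esub> = 1"
  by (simp_all add: ring_of_type_algebra_def)

context complex_hilbert_space
begin

abbreviation plus' (infixl "\<boxplus>" 65) where "x \<boxplus> y \<equiv> x \<oplus>\<^bsub>H\<^esub> y"
abbreviation minus' (infixl "\<boxminus>" 65) where "x \<boxminus> y \<equiv> x \<ominus>\<^bsub>H\<^esub> y"
abbreviation scale (infixr "\<bullet>\<^sub>H" 75) where "c \<bullet>\<^sub>H x \<equiv> c \<odot>\<^bsub>H\<^esub> x"
abbreviation ip where "ip \<equiv> cinner H"
abbreviation nrm where "nrm \<equiv> hnorm H"
abbreviation C where "C \<equiv> carrier H"

lemma scale_closed [simp]: "x \<in> C \<Longrightarrow> c \<bullet>\<^sub>H x \<in> C"
  using smult_closed by simp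

lemma scale_add_left: "x \<in> C \<Longrightarrow> (a + b) \<bullet>\<^sub>H x = a \<bullet>\<^sub>H x \<boxplus> b \<bullet>\<^sub>H x"
  using smult_l_distr[of a b x] by simp

lemma scale_add_right: "x \<in> C \<Longrightarrow> y \<in> C \<Longrightarrow> a \<bullet>\<^sub>H (x \<boxplus> y) = a \<bullet>\<^sub>H x \<boxplus> a \<bullet>\<^sub>H y"
  using smult_r_distr[of a x y] by simp

lemma scale_scale: "x \<in> C \<Longrightarrow> a \<bullet>\<^sub>H b \<bullet>\<^sub>H x = (a * b) \<bullet>\<^sub>H x"
  using smult_assoc1[of a b x] by simp

lemma scale_one [simp]: "x \<in> C \<Longrightarrow> 1 \<bullet>\<^sub>H x = x"
  using smult_one[of x] by simp

lemma scale_zero_left [simp]: "x \<in> C \<Longrightarrow> 0 \<bullet>\<^sub>H x = \<zero>"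
  using smult_l_null[of x] by simp

lemma scale_zero_right [simp]: "a \<bullet>\<^sub>H \<zero> = \<zero>"
  using smult_r_null[of a] by simp

lemma minus_eq_scale: "x \<in> C \<Longrightarrow> y \<in> C \<Longrightarrow> x \<boxminus> y = x \<boxplus> (-1) \<bullet>\<^sub>H y"
proof -
  assume "x \<in> C" "y \<in> C"
  have "y \<boxplus> (-1) \<bullet>\<^sub>H y = (1 + -1) \<bullet>\<^sub>H y"
    using \<open>y \<in> C\<close> by (simp only: scale_add_left scale_one)
  then have "y \<boxplus> (-1) \<bullet>\<^sub>H y = \<zero>" using \<open>y \<in> C\<close> by simp
  then have "(-1) \<bullet>\<^sub>H y = \<ominus>\<^bsub>H\<^esub> y"
    using \<open>y \<in> C\<close> by (metis M.minus_equality M.add.m_comm scale_closed)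
  then show ?thesis by (simp add: a_minus_def)
qed

lemma minus_closed' [simp]: "x \<in> C \<Longrightarrow> y \<in> C \<Longrightarrow> x \<boxminus> y \<in> C"
  by (simp add: minus_eq_scale)

lemma ip_add_right: "x \<in> C \<Longrightarrow> y \<in> C \<Longrightarrow> z \<in> C \<Longrightarrow> ip z (x \<boxplus> y) = ip z x + ip z y"
  by (metis M.a_closed cinner_add_left cinner_commute complex_cnj_add)

lemma ip_scale_right: "x \<in> C \<Longrightarrow> y \<in> C \<Longrightarrow> ip x (c \<bullet>\<^sub>H y) = cnj c * ip x y"
  by (metis scale_closed cinner_smult_left cinner_commute complex_cnj_mult)

lemma ip_zero_right [simp]: "x \<in> C \<Longrightarrow> ip x \<zero> = 0"
  using ip_scale_right[of x x 0] by simp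

lemma ip_minus_left: "x \<in> C \<Longrightarrow> y \<in> C \<Longrightarrow> z \<in> C \<Longrightarrow> ip (x \<boxminus> y) z = ip x z - ip y z"
  by (simp add: minus_eq_scale cinner_add_left cinner_smult_left)

lemma ip_minus_right: "x \<in> C \<Longrightarrow> y \<in> C \<Longrightarrow> z \<in> C \<Longrightarrow> ip z (x \<boxminus> y) = ip z x - ip z y"
  by (simp add: minus_eq_scale ip_add_right ip_scale_right)

lemmas ip_simps = cinner_add_left cinner_smult_left ip_add_right ip_scale_right
  ip_minus_left ip_minus_right

lemma ip_self_nonneg: "x \<in> C \<Longrightarrow> 0 \<le> Re (ip x x)"
  using cinner_pos[of x] by (cases "x = \<zero>") auto

lemma nrm_square: "x \<in> C \<Longrightarrow> (nrm x)\<^sup>2 = Re (ip x x)"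
  by (simp add: hnorm_def ip_self_nonneg)

lemma ip_self: "x \<in> C \<Longrightarrow> ip x x = complex_of_real ((nrm x)\<^sup>2)"
  using cinner_commute[of x x] by (simp add: nrm_square complex_eq_iff)

lemma nrm_nonneg [simp]: "x \<in> C \<Longrightarrow> 0 \<le> nrm x"
  by (simp add: hnorm_def ip_self_nonneg)

lemma nrm_zero [simp]: "nrm \<zero> = 0"
  by (simp add: hnorm_def)

lemma nrm_eq_zero: "x \<in> C \<Longrightarrow> nrm x = 0 \<longleftrightarrow> x = \<zero>"
  using cinner_pos[of x] by (cases "x = \<zero>") (auto simp: hnorm_def)

lemma nrm_scale: "x \<in> C \<Longrightarrow> nrm (c \<bullet>\<^sub>H x) = cmod c * nrm x"
proof -
  assume x: "x \<in> C"
  have "ip (c \<bullet>\<^sub>H x) (c \<bullet>\<^sub>H x) = (c * cnj c) * ip x x"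
    using x by (simp add: ip_simps)
  also have "\<dots> = complex_of_real ((cmod c)\<^sup>2 * (nrm x)\<^sup>2)"
    by (simp only: ip_self[OF x] complex_norm_square[symmetric] of_real_mult)
  finally have "Re (ip (c \<bullet>\<^sub>H x) (c \<bullet>\<^sub>H x)) = (cmod c * nrm x)\<^sup>2"
    by (simp add: power_mult_distrib)
  then show ?thesis using x by (simp add: hnorm_def ip_self_nonneg)
qed

lemma nrm_add_square: "x \<in> C \<Longrightarrow> y \<in> C \<Longrightarrow> (nrm (x \<boxplus> y))\<^sup>2 = (nrm x)\<^sup>2 + 2 * Re (ip x y) + (nrm y)\<^sup>2"
  using cinner_commute[of x y] by (simp add: nrm_square ip_simps)

lemma ip_cauchy_schwarz_square: "x \<in> C \<Longrightarrow> y \<in> C \<Longrightarrow> (cmod (ip x y))\<^sup>2 \<le> (nrm x)\<^sup>2 * (nrm y)\<^sup>2"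
proof (rule quadratic_cauchy_schwarz)
  fix c assume "x \<in> C" "y \<in> C"
  then show "0 \<le> (nrm x)\<^sup>2 + 2 * Re (c * ip x y) + (cmod c)\<^sup>2 * (nrm y)\<^sup>2"
    using nrm_add_square[of x "cnj c \<bullet>\<^sub>H y"] zero_le_power2[of "nrm (x \<boxplus> cnj c \<bullet>\<^sub>H y)"]
    by (simp add: nrm_scale ip_simps power_mult_distrib)
qed simp

lemma ip_cauchy_schwarz: "x \<in> C \<Longrightarrow> y \<in> C \<Longrightarrow> cmod (ip x y) \<le> nrm x * nrm y"
  using ip_cauchy_schwarz_square[of x y]
  by (simp add: power_mult_distrib[symmetric] power2_le_iff_abs_le)

lemma nrm_triangle: "x \<in> C \<Longrightarrow> y \<in> C \<Longrightarrow> nrm (x \<boxplus> y) \<le> nrm x + nrm y"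
  using quadratic_triangle[OF ip_cauchy_schwarz_square[of x y]] nrm_add_square[of x y]
  by (metis M.a_closed nrm_nonneg real_sqrt_abs abs_of_nonneg zero_le_power2)

lemma minus_eq_zero_iff: "x \<in> C \<Longrightarrow> y \<in> C \<Longrightarrow> x \<boxminus> y = \<zero> \<longleftrightarrow> x = y"
  by (metis M.a_inv_closed M.minus_equality M.minus_minus M.r_neg a_minus_def)

lemma nrm_minus_commute: "x \<in> C \<Longrightarrow> y \<in> C \<Longrightarrow> nrm (x \<boxminus> y) = nrm (y \<boxminus> x)"
  by (simp add: hnorm_def ip_simps algebra_simps)

lemma nrm_minus_triangle: "x \<in> C \<Longrightarrow> y \<in> C \<Longrightarrow> z \<in> C \<Longrightarrow> nrm (x \<boxminus> z) \<le> nrm (x \<boxminus> y) + nrm (y \<boxminus> z)"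
proof -
  assume x: "x \<in> C" "y \<in> C" "z \<in> C"
  then have "x \<boxminus> z = (x \<boxminus> y) \<boxplus> (y \<boxminus> z)"
    by (simp add: a_minus_def M.a_assoc M.l_neg flip: M.a_assoc[of "\<ominus>\<^bsub>H\<^esub> y"])
  then show ?thesis using x by (metis nrm_triangle minus_closed')
qed

theorem riesz_representation:
  assumes add: "\<And>x y. x \<in> C \<Longrightarrow> y \<in> C \<Longrightarrow> \<phi> (x \<boxplus> y) = \<phi> x + \<phi> y"
    and scale: "\<And>c x. x \<in> C \<Longrightarrow> \<phi> (c \<bullet>\<^sub>H x) = c * \<phi> x"
    and bound: "\<And>x. x \<in> C \<Longrightarrow> cmod (\<phi> x) \<le> K * nrm x"
  shows "\<exists>z\<in>C. \<forall>x\<in>C. \<phi> x = ip x z"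
proof -
  \<comment> \<open>The representing vector minimises \<open>J\<close>.\<close>
  define J where "J x = (nrm x)\<^sup>2 - 2 * Re (\<phi> x)" for x
  define m where "m = Inf (J ` C)"
  have "- K\<^sup>2 \<le> J x" if "x \<in> C" for x
  proof -
    have "Re (\<phi> x) \<le> K * nrm x" using bound[OF that] complex_Re_le_cmod[of "\<phi> x"] by linarith
    moreover have "0 \<le> (nrm x - K)\<^sup>2" by simp
    ultimately show ?thesis by (simp add: J_def power2_diff mult_ac)
  qed
  then have bdd: "bdd_below (J ` C)" by (rule bdd_belowI2)
  have m_le: "m \<le> J x" if "x \<in> C" for x
    unfolding m_def using bdd that by (simp add: cInf_lower)
  have "\<exists>x\<in>C. J x < m + 1 / (1 + real n)" for n
  proof -
    have "J ` C \<noteq> {}" using M.zero_closed by blast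
    then show ?thesis
      using cInf_less_iff[OF _ bdd, of "m + 1 / (1 + real n)"] by (auto simp: m_def)
  qed
  then obtain u where u: "\<And>n. u n \<in> C" "\<And>n. J (u n) < m + 1 / (1 + real n)"
    by metis
  \<comment> \<open>The parallelogram law: the midpoint w satisfies J w >= m, so two near-minimisers
    must be close to each other.\<close>
  have cauchy: "(nrm (u i \<boxminus> u j))\<^sup>2 \<le> 2 / (1 + real i) + 2 / (1 + real j)" for i j
  proof -
    define w where "w = (1/2) \<bullet>\<^sub>H (u i \<boxplus> u j)"
    have "J (u i) + J (u j) - 2 * J w = (nrm (u i \<boxminus> u j))\<^sup>2 / 2"
      using u(1) cinner_commute[of "u i" "u j"]
      by (simp add: J_def w_def nrm_square ip_simps add scale field_simps)
    moreover have "m \<le> J w" by (rule m_le) (simp add: w_def u)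
    moreover have "2 / (1 + real k) = 2 * (1 / (1 + real k))" for k by simp
    ultimately show ?thesis using u(2)[of i] u(2)[of j] by linarith
  qed
  have "\<exists>l\<in>C. (\<lambda>n. nrm (u n \<boxminus> l)) \<longlonglongrightarrow> 0"
  proof (rule complete)
    fix e :: real assume e: "0 < e"
    obtain N :: nat where N: "4 / e\<^sup>2 < real N" using reals_Archimedean2 by blast
    have "nrm (u i \<boxminus> u j) < e" if "N \<le> i" "N \<le> j" for i j
    proof -
      have *: "2 / (1 + real k) < e\<^sup>2 / 2" if "N \<le> k" for k
      proof -
        have "4 / e\<^sup>2 < 1 + real k" using N that by linarith
        then show ?thesis using e by (simp add: field_simps)
      qed
      have "(nrm (u i \<boxminus> u j))\<^sup>2 < e\<^sup>2" using cauchy[of i j] *[OF that(1)] *[OF that(2)] by linarith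
      then show ?thesis using e by (simp add: power2_less_imp_less)
    qed
    then show "\<exists>N. \<forall>m\<ge>N. \<forall>n\<ge>N. nrm (u m \<boxminus> u n) < e" by blast
  qed (rule u)
  then obtain z where z: "z \<in> C" "(\<lambda>n. nrm (u n \<boxminus> z)) \<longlonglongrightarrow> 0" by blast
  have "\<phi> x = ip x z" if x: "x \<in> C" for x
  proof -
    \<comment> \<open>Comparing J at \<open>u n\<close> with its values at \<open>u n\<close> - c x
      for all scalars c gives a quadratic function of c bounded below, and its discriminant measures
      how far \<open>u n\<close> is from representing the functional at x.\<close>
    have le: "(cmod (\<phi> x - ip x (u n)))\<^sup>2 \<le> 1 / (1 + real n) * (nrm x)\<^sup>2" for n
    proof (rule quadratic_cauchy_schwarz)
      fix c
      have "m \<le> J (u n \<boxplus> (- c) \<bullet>\<^sub>H x)" by (rule m_le) (simp add: x u)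
      also have "\<dots> = J (u n) + 2 * Re (c * (\<phi> x - ip x (u n))) + (cmod c)\<^sup>2 * (nrm x)\<^sup>2"
      proof -
        have "Re (cnj c * ip (u n) x) = Re (c * ip x (u n))"
          using cinner_commute[OF u(1)[of n] x] by simp
        then show ?thesis
          using u(1) x by (simp add: J_def nrm_add_square nrm_scale add scale ip_simps power_mult_distrib
              algebra_simps)
      qed
      finally show "0 \<le> 1 / (1 + real n) + 2 * Re (c * (\<phi> x - ip x (u n))) + (cmod c)\<^sup>2 * (nrm x)\<^sup>2"
        using u(2)[of n] by simp
    qed simp
    have "(\<lambda>n. (cmod (\<phi> x - ip x (u n)))\<^sup>2) \<longlonglongrightarrow> 0"
    proof (rule tendsto_sandwich[OF _ _ tendsto_const])
      have "(\<lambda>n. 1 / (1 + real n)) \<longlonglongrightarrow> 0" by real_asymp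
      from tendsto_mult_right[OF this, of "(nrm x)\<^sup>2"]
      show "(\<lambda>n. 1 / (1 + real n) * (nrm x)\<^sup>2) \<longlonglongrightarrow> 0" by simp
    qed (use le in auto)
    then have 1: "(\<lambda>n. cmod (\<phi> x - ip x (u n))) \<longlonglongrightarrow> 0" 
      by (auto dest: tendsto_real_sqrt)
    have 2: "(\<lambda>n. nrm x * nrm (u n \<boxminus> z)) \<longlonglongrightarrow> 0"
      using tendsto_mult_left[OF z(2), of "nrm x"] by simp
    have "cmod (\<phi> x - ip x z) \<le> cmod (\<phi> x - ip x (u n)) + nrm x * nrm (u n \<boxminus> z)" for n
    proof -
      have "\<phi> x - ip x z = (\<phi> x - ip x (u n)) + ip x (u n \<boxminus> z)"
        using x z u by (simp add: ip_simps)
      then have "cmod (\<phi> x - ip x z) \<le> cmod (\<phi> x - ip x (u n)) + cmod (ip x (u n \<boxminus> z))"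
        by (metis norm_triangle_ineq)
      also have "cmod (ip x (u n \<boxminus> z)) \<le> nrm x * nrm (u n \<boxminus> z)"
        using x z u by (simp add: ip_cauchy_schwarz)
      finally show ?thesis by simp
    qed
    then have "cmod (\<phi> x - ip x z) \<le> 0 + 0"
      by (intro LIMSEQ_le_const[OF tendsto_add[OF 1 2]]) auto
    then show ?thesis by simp
  qed
  then show ?thesis using z(1) by blast
qed

section \<open>Bounded operators and their adjoints\<close>

lemma bounded_opD:
  assumes "bounded_op H A"
  shows "x \<in> C \<Longrightarrow> A x \<in> C"
    and "x \<in> C \<Longrightarrow> y \<in> C \<Longrightarrow> A (x \<boxplus> y) = A x \<boxplus> A y"
    and "x \<in> C \<Longrightarrow> A (c \<bullet>\<^sub>H x) = c \<bullet>\<^sub>H A x"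
    and "\<exists>K. \<forall>x\<in>C. nrm (A x) \<le> K * nrm x"
  using assms by (auto simp: bounded_op_def)

text \<open>Riesz supplies a vector and definiteness makes it unique, so the definite description in
  \<open>op_adj\<close> denotes.\<close>

lemma op_adj:
  assumes "bounded_op H A" and y: "y \<in> C"
  shows "op_adj H A y \<in> C" and "x \<in> C \<Longrightarrow> ip (A x) y = ip x (op_adj H A y)"
proof -
  note A = bounded_opD[OF assms(1)]
  obtain K where K: "\<And>x. x \<in> C \<Longrightarrow> nrm (A x) \<le> K * nrm x" using A(4) by blast
  have "\<exists>z\<in>C. \<forall>x\<in>C. ip (A x) y = ip x z"
  proof (rule riesz_representation[where K = "K * nrm y"])
    fix x assume x: "x \<in> C"
    have "cmod (ip (A x) y) \<le> nrm (A x) * nrm y" using x y A by (simp add: ip_cauchy_schwarz)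
    also have "\<dots> \<le> K * nrm x * nrm y" using K[OF x] y by (simp add: mult_right_mono)
    finally show "cmod (ip (A x) y) \<le> K * nrm y * nrm x" by (simp add: mult_ac)
  qed (use y A in \<open>simp_all add: ip_simps\<close>)
  then obtain z where z: "z \<in> C" "\<forall>x\<in>C. ip (A x) y = ip x z" by blast
  have "op_adj H A y = z"
    unfolding op_adj_def
  proof (rule the_equality)
    fix z' assume z': "z' \<in> C \<and> (\<forall>x\<in>C. ip (A x) y = ip x z')"
    then have "ip (z' \<boxminus> z) (z' \<boxminus> z) = 0"
      using z by (simp add: ip_minus_right)
    then have "nrm (z' \<boxminus> z) = 0" by (simp add: hnorm_def)
    then show "z' = z" using z z' by (simp add: nrm_eq_zero minus_eq_zero_iff)
  qed (use z in auto)
  then show "op_adj H A y \<in> C" "x \<in> C \<Longrightarrow> ip (A x) y = ip x (op_adj H A y)"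
    using z by auto
qed

end

section \<open>Polynomials of an operator\<close>

text \<open>Horner's scheme, so that facts about polynomials of an operator follow by induction
  along \<open>pCons\<close>.\<close>

definition poly_apply :: "'a chilbert \<Rightarrow> ('a \<Rightarrow> 'a) \<Rightarrow> complex poly \<Rightarrow> 'a \<Rightarrow> 'a" where
  "poly_apply H A p x = fold_coeffs (\<lambda>c v. c \<odot>\<^bsub>H\<^esub> x \<oplus>\<^bsub>H\<^esub> A v) p \<zero>\<^bsub>H\<^esub>"

context complex_hilbert_space
begin

lemma bounded_op_zero: "bounded_op H A \<Longrightarrow> A \<zero> = \<zero>"
  using bounded_opD(3)[of A "\<zero>" 0] bounded_opD(1)[of A "\<zero>"] by simp

lemma bounded_op_minus: "bounded_op H A \<Longrightarrow> x \<in> C \<Longrightarrow> y \<in> C \<Longrightarrow> A (x \<boxminus> y) = A x \<boxminus> A y"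
  by (simp add: minus_eq_scale bounded_opD)

lemma bounded_op_nonneg_bound:
  assumes "bounded_op H A"
  obtains K where "0 < K" and "\<And>x. x \<in> C \<Longrightarrow> nrm (A x) \<le> K * nrm x"
proof -
  obtain K where K: "\<forall>x\<in>C. nrm (A x) \<le> K * nrm x" using bounded_opD(4)[OF assms] by blast
  have "nrm (A x) \<le> (\<bar>K\<bar> + 1) * nrm x" if "x \<in> C" for x
  proof -
    have "K * nrm x \<le> (\<bar>K\<bar> + 1) * nrm x" using that by (intro mult_right_mono) auto
    then show ?thesis using K that by fastforce
  qed
  then show thesis by (intro that[of "\<bar>K\<bar> + 1"]) auto
qed

lemma add_add_swap:
  "x \<in> C \<Longrightarrow> y \<in> C \<Longrightarrow> z \<in> C \<Longrightarrow> w \<in> C \<Longrightarrow> (x \<boxplus> y) \<boxplus> (z \<boxplus> w) = (x \<boxplus> z) \<boxplus> (y \<boxplus> w)"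
  by (metis M.a_assoc M.a_comm M.a_closed)

lemma bounded_opI:
  assumes "\<And>x. x \<in> C \<Longrightarrow> A x \<in> C"
    and "\<And>x y. x \<in> C \<Longrightarrow> y \<in> C \<Longrightarrow> A (x \<boxplus> y) = A x \<boxplus> A y"
    and "\<And>c x. x \<in> C \<Longrightarrow> A (c \<bullet>\<^sub>H x) = c \<bullet>\<^sub>H A x"
    and "\<And>x. x \<in> C \<Longrightarrow> nrm (A x) \<le> K * nrm x"
  shows "bounded_op H A"
  unfolding bounded_op_def by (intro conjI ballI allI exI[of _ K] Pi_I assms)

lemma bounded_op_comp:
  assumes A: "bounded_op H A" and B: "bounded_op H B"
  shows "bounded_op H (\<lambda>x. A (B x))"
proof -
  obtain K where K: "0 < K" "\<And>x. x \<in> C \<Longrightarrow> nrm (A x) \<le> K * nrm x"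
    using bounded_op_nonneg_bound[OF A] by blast
  obtain L where L: "0 < L" "\<And>x. x \<in> C \<Longrightarrow> nrm (B x) \<le> L * nrm x"
    using bounded_op_nonneg_bound[OF B] by blast
  show ?thesis
  proof (rule bounded_opI)
    fix x assume x: "x \<in> C"
    have "nrm (A (B x)) \<le> K * nrm (B x)" using x by (simp add: K bounded_opD[OF B])
    also have "\<dots> \<le> K * (L * nrm x)" using x K by (simp add: L mult_left_mono)
    finally show "nrm (A (B x)) \<le> (K * L) * nrm x" by (simp add: mult_ac)
  qed (simp_all add: bounded_opD[OF A] bounded_opD[OF B])
qed

lemma bounded_op_id: "bounded_op H (\<lambda>x. x)"
  by (rule bounded_opI[where K = 1]) auto

lemma bounded_op_funpow: "bounded_op H A \<Longrightarrow> bounded_op H (A ^^ n)"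
proof (induction n)
  case 0
  then show ?case using bounded_op_id by (simp add: id_def)
next
  case (Suc n)
  then show ?case using bounded_op_comp[of A "A ^^ n"] by (simp add: o_def)
qed

lemma bounded_op_scale: "bounded_op H A \<Longrightarrow> bounded_op H (\<lambda>x. c \<bullet>\<^sub>H A x)"
proof -
  assume A: "bounded_op H A"
  obtain K where K: "0 < K" "\<And>x. x \<in> C \<Longrightarrow> nrm (A x) \<le> K * nrm x"
    using bounded_op_nonneg_bound[OF A] by blast
  show ?thesis
  proof (rule bounded_opI)
    fix x assume x: "x \<in> C"
    have "cmod c * nrm (A x) \<le> cmod c * (K * nrm x)"
      using K(2)[OF x] by (rule mult_left_mono) simp
    then show "nrm (c \<bullet>\<^sub>H A x) \<le> (cmod c * K) * nrm x"
      using x by (simp add: nrm_scale bounded_opD[OF A] mult_ac)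
  qed (simp_all add: bounded_opD[OF A] scale_add_right scale_scale mult_ac)
qed

end

locale hilbert_operator = complex_hilbert_space H for H :: "'a chilbert" (structure) +
  fixes A :: "'a \<Rightarrow> 'a"
  assumes bounded_op: "bounded_op H A"
begin

abbreviation pa where "pa \<equiv> poly_apply H A"

lemmas op_closed [simp] = bounded_opD(1)[OF bounded_op]
  and op_add = bounded_opD(2)[OF bounded_op]
  and op_scale = bounded_opD(3)[OF bounded_op]
  and op_zero [simp] = bounded_op_zero[OF bounded_op]

lemma pa_0 [simp]: "pa 0 x = \<zero>"
  by (simp add: poly_apply_def)

lemma pa_pCons: "x \<in> C \<Longrightarrow> pa (pCons c p) x = c \<bullet>\<^sub>H x \<boxplus> A (pa p x)"
  by (cases "c = 0 \<and> p = 0") (auto simp: poly_apply_def)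

lemma pa_closed [simp]: "x \<in> C \<Longrightarrow> pa p x \<in> C"
  by (induction p) (simp_all add: pa_pCons)

lemma pa_1 [simp]: "x \<in> C \<Longrightarrow> pa 1 x = x"
  by (simp add: one_pCons pa_pCons)

lemma pa_add: "x \<in> C \<Longrightarrow> pa (p + q) x = pa p x \<boxplus> pa q x"
proof (induction p q rule: poly_induct2)
  case (pCons a p b q)
  have "(a \<bullet>\<^sub>H x \<boxplus> b \<bullet>\<^sub>H x) \<boxplus> (A (pa p x) \<boxplus> A (pa q x)) = (a \<bullet>\<^sub>H x \<boxplus> A (pa p x)) \<boxplus> (b \<bullet>\<^sub>H x \<boxplus> A (pa q x))"
    using pCons(2) by (intro add_add_swap) auto
  then show ?case using pCons by (simp add: pa_pCons scale_add_left op_add)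
qed simp

lemma pa_smult: "x \<in> C \<Longrightarrow> pa (smult c p) x = c \<bullet>\<^sub>H pa p x"
  by (induction p) (simp_all add: pa_pCons scale_add_right op_scale scale_scale)

lemma pa_diff: "x \<in> C \<Longrightarrow> pa (p - q) x = pa p x \<boxminus> pa q x"
proof -
  assume x: "x \<in> C"
  have "p - q = p + smult (-1) q" by simp
  then show ?thesis using x by (simp only: pa_add pa_smult minus_eq_scale pa_closed)
qed

lemma pa_mult: "x \<in> C \<Longrightarrow> pa (p * q) x = pa p (pa q x)"
  by (induction p) (simp_all add: pa_pCons pa_add pa_smult)

lemma pa_monom: "x \<in> C \<Longrightarrow> pa (Polynomial.monom c n) x = c \<bullet>\<^sub>H (A ^^ n) x"
proof (induction n)
  case (Suc n)
  moreover have "(A ^^ n) x \<in> C"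
    using Suc.prems by (rule bounded_opD(1)[OF bounded_op_funpow[OF bounded_op]])
  ultimately show ?case by (simp add: pa_pCons monom_Suc op_scale)
qed (simp add: pa_pCons monom_0)

lemma pa_sum: "finite I \<Longrightarrow> x \<in> C \<Longrightarrow> pa (\<Sum>i\<in>I. f i) x = finsum H (\<lambda>i. pa (f i) x) I"
proof (induction I rule: finite_induct)
  case (insert i I)
  then have "pa (\<Sum>i\<in>insert i I. f i) x = pa (f i) x \<boxplus> finsum H (\<lambda>i. pa (f i) x) I"
    by (simp add: pa_add)
  also have "\<dots> = finsum H (\<lambda>i. pa (f i) x) (insert i I)"
    using insert.hyps insert.prems by (intro M.finsum_insert[symmetric]) auto
  finally show ?case .
qed simp

lemma pa_bounded: "bounded_op H (pa p)"
proof (induction p)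
  case 0
  have "bounded_op H (\<lambda>x. \<zero>)" by (rule bounded_opI[where K = 0]) auto
  then show ?case by (simp add: bounded_op_def)
next
  case (pCons c p)
  have Ap: "bounded_op H (\<lambda>x. A (pa p x))" by (rule bounded_op_comp[OF bounded_op pCons(2)])
  obtain K where K: "0 < K" "\<And>x. x \<in> C \<Longrightarrow> nrm (A (pa p x)) \<le> K * nrm x"
    using bounded_op_nonneg_bound[OF Ap] by blast
  show ?case
  proof (rule bounded_opI)
    fix x assume x: "x \<in> C"
    have "nrm (pa (pCons c p) x) \<le> nrm (c \<bullet>\<^sub>H x) + nrm (A (pa p x))"
      using x by (simp only: pa_pCons) (rule nrm_triangle, auto)
    also have "\<dots> \<le> (cmod c + K) * nrm x" using x K(2)[OF x] by (simp add: nrm_scale distrib_right)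
    finally show "nrm (pa (pCons c p) x) \<le> (cmod c + K) * nrm x" .
  next
    fix x y assume x: "x \<in> C" "y \<in> C"
    then have "pa (pCons c p) (x \<boxplus> y) = (c \<bullet>\<^sub>H x \<boxplus> c \<bullet>\<^sub>H y) \<boxplus> (A (pa p x) \<boxplus> A (pa p y))"
      by (simp add: pa_pCons scale_add_right bounded_opD(2)[OF Ap])
    also have "\<dots> = (c \<bullet>\<^sub>H x \<boxplus> A (pa p x)) \<boxplus> (c \<bullet>\<^sub>H y \<boxplus> A (pa p y))"
      using x by (intro add_add_swap) auto
    finally show "pa (pCons c p) (x \<boxplus> y) = pa (pCons c p) x \<boxplus> pa (pCons c p) y"
      using x by (simp add: pa_pCons)
  next
    fix d x assume x: "x \<in> C"
    then show "pa (pCons c p) (d \<bullet>\<^sub>H x) = d \<bullet>\<^sub>H pa (pCons c p) x"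
      by (simp add: pa_pCons scale_add_right scale_scale bounded_opD(3)[OF Ap] mult.commute)
  qed simp
qed

text \<open>The bridge from operators to forms: under evaluation at x, multiplication by the
  variable becomes application of A. The form degenerates whenever some nonzero polynomial of A
  annihilates x.\<close>

lemma pa_form:
  assumes x: "x \<in> C"
  shows "poly_form (\<lambda>p q. ip (pa p x) (pa q x))"
proof (rule poly_form.intro)
  fix p q
  show "ip (pa q x) (pa p x) = cnj (ip (pa p x) (pa q x))"
    using x by (intro cinner_commute) auto
qed (use x in \<open>simp_all add: pa_add pa_smult ip_simps ip_self_nonneg\<close>)

lemma pa_form_E: "x \<in> C \<Longrightarrow> poly_form.E (\<lambda>p q. ip (pa p x) (pa q x)) p = (nrm (pa p x))\<^sup>2"
  using poly_form.E_def[OF pa_form] nrm_square pa_closed by metis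

end

section \<open>Von Neumann's inequality and inverses of polynomials of an operator\<close>

locale norm_bounded_operator = hilbert_operator +
  fixes R :: real
  assumes R_pos: "0 < R" and norm_le: "x \<in> carrier H \<Longrightarrow> hnorm H (A x) \<le> R * hnorm H x"
begin

text \<open>Stated as a comparison of two vectors, so that it can be used to prove that G(A) is
  invertible instead of presupposing it.\<close>

theorem von_neumann_inequality:
  assumes x: "x \<in> C"
    and nz: "\<And>z. cmod z \<le> R \<Longrightarrow> poly G z \<noteq> 0"
    and bound: "\<And>z. cmod z \<le> R \<Longrightarrow> cmod (poly P z) \<le> M * cmod (poly G z)"
  shows "nrm (pa P x) \<le> M * nrm (pa G x)"
proof -
  interpret poly_form "\<lambda>p q. ip (pa p x) (pa q x)" using x by (rule pa_form)
  have "0 \<le> M * cmod (poly G 0)"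
    using bound[of 0] R_pos order_trans[OF norm_ge_zero[of "poly P 0"]] by simp
  then have "0 \<le> M" using nz[of 0] R_pos by (simp add: zero_le_mult_iff)
  have "E (P * 1) \<le> M\<^sup>2 * E (G * 1)"
  proof (rule E_rational_le[OF R_pos _ nz bound])
    fix p
    have "nrm (A (pa p x)) \<le> R * nrm (pa p x)" using x by (simp add: norm_le)
    then have "(nrm (A (pa p x)))\<^sup>2 \<le> (R * nrm (pa p x))\<^sup>2" using x by (intro power_mono) auto
    then show "E (Polynomial.monom 1 1 * p) \<le> R\<^sup>2 * E p"
      using x by (simp add: pa_form_E monom_altdef pa_pCons power_mult_distrib)
  qed
  then have "(nrm (pa P x))\<^sup>2 \<le> (M * nrm (pa G x))\<^sup>2"
    using x by (simp add: pa_form_E power_mult_distrib)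
  then show ?thesis
    using x \<open>0 \<le> M\<close> by (simp add: power2_le_iff_abs_le)
qed

lemma pa_norm_le:
  assumes "x \<in> C" and "\<And>z. cmod z \<le> R \<Longrightarrow> cmod (poly P z) \<le> M"
  shows "nrm (pa P x) \<le> M * nrm x"
  using von_neumann_inequality[of x 1 P M] assms by simp

text \<open>The inequality with numerator 1: the constant is a bound of 1 / |G| on the compact
  disc.\<close>

lemma pa_norm_ge:
  assumes nz: "\<And>z. cmod z \<le> R \<Longrightarrow> poly G z \<noteq> 0"
  shows "\<exists>M>0. \<forall>x\<in>C. nrm x \<le> M * nrm (pa G x)"
proof -
  have "bounded ((\<lambda>z. inverse (poly G z)) ` cball 0 R)"
    using nz by (intro compact_imp_bounded compact_continuous_image continuous_intros) auto
  then obtain M where M: "M > 0" "\<forall>z\<in>cball 0 R. cmod (inverse (poly G z)) \<le> M"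
    unfolding bounded_pos by auto
  have "nrm (pa 1 x) \<le> M * nrm (pa G x)" if "x \<in> C" for x
  proof (rule von_neumann_inequality[OF that nz])
    fix z assume z: "cmod z \<le> R"
    then have "cmod (inverse (poly G z)) * cmod (poly G z) \<le> M * cmod (poly G z)"
      using M by (intro mult_right_mono) auto
    then show "cmod (poly 1 z) \<le> M * cmod (poly G z)" using nz[OF z] by (simp add: norm_inverse)
  qed
  then show ?thesis using M(1) by auto
qed

text \<open>Polynomials F n converging uniformly to 1 / G give vectors F n(A) x. The inequality
  makes them Cauchy, because F i - F j is uniformly small, and shows that their limit is a preimage
  of x, because G F n - 1 is uniformly small.\<close>

lemma pa_surj:
  assumes nz: "\<And>z. cmod z \<le> R \<Longrightarrow> poly G z \<noteq> 0" and x: "x \<in> C"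
  shows "\<exists>y\<in>C. pa G y = x"
proof -
  obtain F where F: "\<And>e. 0 < e \<Longrightarrow> \<forall>\<^sub>F n in sequentially. \<forall>z. cmod z \<le> R \<longrightarrow> cmod (poly (F n) z - poly 1 z / poly G z) < e"
    using rational_uniform_approx[OF R_pos nz, where P = 1] by blast
  define u where "u n = pa (F n) x" for n
  have u: "u n \<in> C" for n using x by (simp add: u_def)
  have "\<exists>l\<in>C. (\<lambda>n. nrm (u n \<boxminus> l)) \<longlonglongrightarrow> 0"
  proof (rule complete)
    fix e :: real assume e: "0 < e"
    define d where "d = e / (2 * (nrm x + 1))"
    have nx: "0 < nrm x + 1" using nrm_nonneg[OF x] by linarith
    have d: "0 < d" "2 * d * nrm x < e" using e nx by (auto simp: d_def field_simps)
    obtain N where N: "\<And>n z. N \<le> n \<Longrightarrow> cmod z \<le> R \<Longrightarrow> cmod (poly (F n) z - poly 1 z / poly G z) < d"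
      using F[OF d(1)] unfolding eventually_sequentially by blast
    have "nrm (u i \<boxminus> u j) < e" if "N \<le> i" "N \<le> j" for i j
    proof -
      have "nrm (pa (F i - F j) x) \<le> (2 * d) * nrm x"
      proof (rule pa_norm_le[OF x])
        fix z assume z: "cmod z \<le> R"
        have "poly (F i - F j) z = (poly (F i) z - poly 1 z / poly G z) - (poly (F j) z - poly 1 z / poly G z)"
          by simp
        also have "cmod \<dots> \<le> cmod (poly (F i) z - poly 1 z / poly G z) + cmod (poly (F j) z - poly 1 z / poly G z)"
          by (rule norm_triangle_ineq4)
        finally show "cmod (poly (F i - F j) z) \<le> 2 * d"
          using N[OF that(1) z] N[OF that(2) z] by linarith
      qed
      then show ?thesis using x d(2) by (simp add: u_def pa_diff)
    qed
    then show "\<exists>N. \<forall>m\<ge>N. \<forall>n\<ge>N. nrm (u m \<boxminus> u n) < e" by blast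
  qed (rule u)
  then obtain l where l: "l \<in> C" "(\<lambda>n. nrm (u n \<boxminus> l)) \<longlonglongrightarrow> 0" by blast
  obtain K where K: "0 < K" "\<And>y. y \<in> C \<Longrightarrow> nrm (pa G y) \<le> K * nrm y"
    using bounded_op_nonneg_bound[OF pa_bounded[of G]] by blast
  have "bounded (poly G ` cball 0 R)"
    by (intro compact_imp_bounded compact_continuous_image continuous_intros) auto
  then obtain L where L: "L > 0" "\<forall>z\<in>cball 0 R. cmod (poly G z) \<le> L"
    unfolding bounded_pos by auto
  have 1: "(\<lambda>n. nrm (pa G (u n) \<boxminus> pa G l)) \<longlonglongrightarrow> 0"
  proof (rule tendsto_sandwich[OF _ _ tendsto_const])
    show "(\<lambda>n. K * nrm (u n \<boxminus> l)) \<longlonglongrightarrow> 0" using tendsto_mult_left[OF l(2), of K] by simp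
    show "\<forall>\<^sub>F n in sequentially. nrm (pa G (u n) \<boxminus> pa G l) \<le> K * nrm (u n \<boxminus> l)"
    proof (intro always_eventually allI)
      fix n
      have "pa G (u n) \<boxminus> pa G l = pa G (u n \<boxminus> l)"
        using u l(1) by (simp only: bounded_op_minus[OF pa_bounded])
      then show "nrm (pa G (u n) \<boxminus> pa G l) \<le> K * nrm (u n \<boxminus> l)"
        using K(2)[of "u n \<boxminus> l"] u l(1) by simp
    qed
  qed (use u l in simp)
  have 2: "(\<lambda>n. nrm (pa G (u n) \<boxminus> x)) \<longlonglongrightarrow> 0"
  proof (rule LIMSEQ_I)
    fix e :: real assume e: "0 < e"
    define d where "d = e / (nrm x + 1)"
    have nx: "0 < nrm x + 1" using nrm_nonneg[OF x] by linarith
    have d: "0 < d" "d * nrm x < e" using e nx by (auto simp: d_def field_simps)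
    obtain N where N: "\<And>n z. N \<le> n \<Longrightarrow> cmod z \<le> R \<Longrightarrow> cmod (poly (F n) z - poly 1 z / poly G z) < d / L"
      using F[OF divide_pos_pos[OF d(1) L(1)]] unfolding eventually_sequentially by blast
    have "nrm (pa G (u n) \<boxminus> x) < e" if "N \<le> n" for n
    proof -
      have "nrm (pa (G * F n - 1) x) \<le> d * nrm x"
      proof (rule pa_norm_le[OF x])
        fix z assume z: "cmod z \<le> R"
        have "poly (G * F n - 1) z = poly G z * (poly (F n) z - poly 1 z / poly G z)"
          using nz[OF z] by (simp add: field_simps)
        also have "cmod \<dots> \<le> L * (d / L)"
          unfolding norm_mult using L z N[OF that z] by (intro mult_mono) auto
        finally show "cmod (poly (G * F n - 1) z) \<le> d" using L(1) by simp
      qed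
      then show ?thesis using x d(2) by (simp add: u_def pa_diff pa_mult)
    qed
    then show "\<exists>no. \<forall>n\<ge>no. norm (nrm (pa G (u n) \<boxminus> x) - 0) < e"
      using u x by auto
  qed
  have "nrm (pa G l \<boxminus> x) \<le> nrm (pa G (u n) \<boxminus> pa G l) + nrm (pa G (u n) \<boxminus> x)" for n
    using nrm_minus_triangle[of "pa G l" "pa G (u n)" x] nrm_minus_commute[of "pa G l" "pa G (u n)"] u l x
    by simp
  then have "nrm (pa G l \<boxminus> x) \<le> 0 + 0"
    by (intro LIMSEQ_le_const[OF tendsto_add[OF 1 2]]) auto
  then have "pa G l = x"
    using l x nrm_nonneg[of "pa G l \<boxminus> x"] by (simp add: nrm_eq_zero minus_eq_zero_iff del: nrm_nonneg)
  then show ?thesis using l(1) by blast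
qed

lemma pa_bij:
  assumes nz: "\<And>z. cmod z \<le> R \<Longrightarrow> poly G z \<noteq> 0"
  shows "bij_betw (pa G) C C"
proof -
  obtain M where M: "\<forall>x\<in>C. nrm x \<le> M * nrm (pa G x)" using pa_norm_ge[OF nz] by blast
  have "inj_on (pa G) C"
  proof (rule inj_onI)
    fix x y assume xy: "x \<in> C" "y \<in> C" "pa G x = pa G y"
    then have "pa G (x \<boxminus> y) = \<zero>"
      by (simp add: bounded_op_minus[OF pa_bounded] minus_eq_zero_iff)
    then have "nrm (x \<boxminus> y) \<le> 0" using M xy by (metis minus_closed' mult_zero_right nrm_zero)
    then show "x = y" using xy nrm_nonneg[of "x \<boxminus> y"]
      by (simp add: nrm_eq_zero minus_eq_zero_iff del: nrm_nonneg)
  qed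
  then show ?thesis
    unfolding bij_betw_def using pa_surj[OF nz] pa_closed by blast
qed

end

section \<open>The Taylor spectrum of a pair\<close>

lemma two_set_cases: "S = {} \<or> S = {1} \<or> S = {2} \<or> S = (UNIV :: 2 set)"
proof -
  have "S \<subseteq> {1, 2}" using UNIV_2 by auto
  then show ?thesis unfolding UNIV_2 by blast
qed

text \<open>Which of the two indices comes first in the order of the type \<open>2\<close> is left
  open; the factors of a monomial commute, so both cases give the same operator.\<close>

lemma sorted_list_of_two: "sorted_list_of_set (UNIV :: 2 set) = [1, 2] \<or> sorted_list_of_set (UNIV :: 2 set) = [2, 1]"
proof -
  have "sorted_list_of_set (UNIV :: 2 set) \<in> {xs. set xs = {1, 2} \<and> distinct xs \<and> length xs = 2}"
    using UNIV_2 by (simp add: distinct_sorted_list_of_set)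
  then obtain x y where "sorted_list_of_set (UNIV :: 2 set) = [x, y]" "set [x, y] = {1, 2}"
    by (auto simp: length_Suc_conv numeral_2_eq_2 simp del: set_sorted_list_of_set)
  then show ?thesis by (auto simp: doubleton_eq_iff)
qed

context complex_hilbert_space
begin

text \<open>The order of the indices affects only the sign s in the top degree. Exactness needs
  nothing about s beyond s * s = 1.\<close>

lemma koszul_diff_two:
  fixes T :: "('a \<Rightarrow> 'a) ^ 2"
  assumes "bounded_op H (T $ 1)" and "bounded_op H (T $ 2)"
  shows "\<exists>s :: complex. s * s = 1 \<and> (\<forall>\<omega>\<in>koszul_space H.
    koszul_diff H T \<omega> {} = \<zero> \<and>
    koszul_diff H T \<omega> {1} = (T $ 1) (\<omega> {}) \<and>
    koszul_diff H T \<omega> {2} = (T $ 2) (\<omega> {}) \<and>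
    koszul_diff H T \<omega> UNIV = s \<bullet>\<^sub>H ((T $ 1) (\<omega> {2}) \<boxminus> (T $ 2) (\<omega> {1})))"
proof -
  define s :: "2 \<Rightarrow> complex" where "s i = (-1) ^ card {j. j < i}" for i
  have ne: "(1::2) \<noteq> 2" by simp
  have s: "s 2 = - s 1" "s 1 * s 1 = 1"
  proof -
    have *: "{j. j < (1::2)} = (if (2::2) < 1 then {2} else {})"
      "{j. j < (2::2)} = (if (2::2) < 1 then {} else {1})"
      using ne by (auto dest: order.strict_trans simp: not_less_iff_gr_or_eq) (metis exhaust_2 less_irrefl order.asym neqE)+
    show "s 2 = - s 1" "s 1 * s 1 = 1" unfolding s_def * by simp_all
  qed
  have C1: "\<omega> \<in> koszul_space H \<Longrightarrow> (T $ 1) (\<omega> S) \<in> C" for \<omega> S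
    using bounded_opD(1)[OF assms(1)] by (auto simp: koszul_space_def)
  have C2: "\<omega> \<in> koszul_space H \<Longrightarrow> (T $ 2) (\<omega> S) \<in> C" for \<omega> S
    using bounded_opD(1)[OF assms(2)] by (auto simp: koszul_space_def)
  show ?thesis
  proof (intro exI[of _ "s 1"] conjI ballI)
    fix \<omega> :: "2 set \<Rightarrow> 'a"
    show "koszul_diff H T \<omega> {} = \<zero>" by (simp add: koszul_diff_def)
    assume \<omega>: "\<omega> \<in> koszul_space H"
    have one: "finsum H f {i} = f i" if "f i \<in> C" for i :: 2 and f
      using M.finsum_insert[of "{}" i f] that by simp
    have e: "{j. j = i \<and> j < i} = {}" for i :: 2 by auto
    show "koszul_diff H T \<omega> {1} = (T $ 1) (\<omega> {})"
      unfolding koszul_diff_def using C1[OF \<omega>] by (subst one) (auto simp: e)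
    show "koszul_diff H T \<omega> {2} = (T $ 2) (\<omega> {})"
      unfolding koszul_diff_def using C2[OF \<omega>] by (subst one) (auto simp: e)
    have "UNIV - {1::2} = {2}" "UNIV - {2::2} = {1}" using ne by (auto simp: UNIV_2)
    then have "koszul_diff H T \<omega> UNIV = s 1 \<bullet>\<^sub>H (T $ 1) (\<omega> {2}) \<boxplus> s 2 \<bullet>\<^sub>H (T $ 2) (\<omega> {1})"
      unfolding koszul_diff_def UNIV_2 using C1[OF \<omega>, of "{2}"] C2[OF \<omega>, of "{1}"] ne
      by (subst M.finsum_insert) (auto simp: one s_def UNIV_2[symmetric])
    then show "koszul_diff H T \<omega> UNIV = s 1 \<bullet>\<^sub>H ((T $ 1) (\<omega> {2}) \<boxminus> (T $ 2) (\<omega> {1}))"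
      using C1[OF \<omega>] C2[OF \<omega>] s(1) by (simp add: minus_eq_scale scale_add_right scale_scale)
  qed (rule s)
qed

text \<open>A Bezout identity with coefficients that commute with the pair provides a contracting
  homotopy of the Koszul complex.\<close>

lemma koszul_exact_two:
  fixes T :: "('a \<Rightarrow> 'a) ^ 2"
  assumes A1: "bounded_op H (T $ 1)" and A2: "bounded_op H (T $ 2)"
    and S1: "bounded_op H S1" and S2: "bounded_op H S2"
    and comm: "\<And>x. x \<in> C \<Longrightarrow> (T $ 1) ((T $ 2) x) = (T $ 2) ((T $ 1) x)"
      "\<And>x. x \<in> C \<Longrightarrow> (T $ 1) (S1 x) = S1 ((T $ 1) x)"
      "\<And>x. x \<in> C \<Longrightarrow> (T $ 1) (S2 x) = S2 ((T $ 1) x)"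
      "\<And>x. x \<in> C \<Longrightarrow> (T $ 2) (S1 x) = S1 ((T $ 2) x)"
      "\<And>x. x \<in> C \<Longrightarrow> (T $ 2) (S2 x) = S2 ((T $ 2) x)"
    and bezout: "\<And>x. x \<in> C \<Longrightarrow> S1 ((T $ 1) x) \<boxplus> S2 ((T $ 2) x) = x"
  shows "koszul_exact H T"
proof -
  obtain s :: complex where s: "s * s = 1"
    and d: "\<forall>\<omega>\<in>koszul_space H. koszul_diff H T \<omega> {} = \<zero> \<and>
      koszul_diff H T \<omega> {1} = (T $ 1) (\<omega> {}) \<and>
      koszul_diff H T \<omega> {2} = (T $ 2) (\<omega> {}) \<and>
      koszul_diff H T \<omega> UNIV = s \<bullet>\<^sub>H ((T $ 1) (\<omega> {2}) \<boxminus> (T $ 2) (\<omega> {1}))"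
    using koszul_diff_two[OF A1 A2] by blast
  have d0: "\<omega> \<in> koszul_space H \<Longrightarrow> koszul_diff H T \<omega> {} = \<zero>"
    and d1: "\<omega> \<in> koszul_space H \<Longrightarrow> koszul_diff H T \<omega> {1} = (T $ 1) (\<omega> {})"
    and d2: "\<omega> \<in> koszul_space H \<Longrightarrow> koszul_diff H T \<omega> {2} = (T $ 2) (\<omega> {})"
    and d12: "\<omega> \<in> koszul_space H \<Longrightarrow>
      koszul_diff H T \<omega> UNIV = s \<bullet>\<^sub>H ((T $ 1) (\<omega> {2}) \<boxminus> (T $ 2) (\<omega> {1}))" for \<omega>
    using d by blast+
  note cl = bounded_opD(1)[OF A1] bounded_opD(1)[OF A2] bounded_opD(1)[OF S1] bounded_opD(1)[OF S2]
  note z = bounded_op_zero[OF A1] bounded_op_zero[OF A2] bounded_op_zero[OF S1] bounded_op_zero[OF S2]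
  have sp: "\<omega> S \<in> C" if "\<omega> \<in> koszul_space H" for \<omega> :: "2 set \<Rightarrow> 'a" and S
    using that by (auto simp: koszul_space_def)
  have "\<exists>\<eta>\<in>koszul_space H. \<omega> = koszul_diff H T \<eta>"
    if \<omega>: "\<omega> \<in> koszul_space H" and ker: "\<forall>S. koszul_diff H T \<omega> S = \<zero>" for \<omega>
  proof -
    have k1: "(T $ 1) (\<omega> {}) = \<zero>" using ker d1[OF \<omega>] by metis
    have k2: "(T $ 2) (\<omega> {}) = \<zero>" using ker d2[OF \<omega>] by metis
    have \<omega>0: "\<omega> {} = \<zero>"
      using bezout[OF sp[OF \<omega>], of "{}"] k1 k2 z by simp
    have "s \<bullet>\<^sub>H s \<bullet>\<^sub>H ((T $ 1) (\<omega> {2}) \<boxminus> (T $ 2) (\<omega> {1})) = \<zero>"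
      using ker d12[OF \<omega>] by (metis scale_zero_right)
    then have k12: "(T $ 1) (\<omega> {2}) = (T $ 2) (\<omega> {1})"
      using sp[OF \<omega>] cl by (simp add: scale_scale s minus_eq_zero_iff)
    \<comment> \<open>The homotopy applied to the cocycle: contraction by (S1, S2), which lowers the
      degree by one. The signs compensate those of the differential in the top degree.\<close>
    define \<eta> where "\<eta> S = (if S = {} then S1 (\<omega> {1}) \<boxplus> S2 (\<omega> {2})
      else if S = {2} then s \<bullet>\<^sub>H S1 (\<omega> UNIV)
      else if S = {1} then (- s) \<bullet>\<^sub>H S2 (\<omega> UNIV) else \<zero>)" for S :: "2 set"
    have \<eta>: "\<eta> \<in> koszul_space H"
      using sp[OF \<omega>] cl by (auto simp: koszul_space_def \<eta>_def)
    have "koszul_diff H T \<eta> S = \<omega> S" for S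
    proof -
      consider "S = {}" | "S = {1}" | "S = {2}" | "S = UNIV" using two_set_cases[of S] by blast
      then show ?thesis
      proof cases
        case 1
        then show ?thesis by (simp add: d0[OF \<eta>] \<omega>0)
      next
        case 2
        have "(T $ 1) (\<eta> {}) = S1 ((T $ 1) (\<omega> {1})) \<boxplus> S2 ((T $ 1) (\<omega> {2}))"
          using sp[OF \<omega>] cl by (simp add: \<eta>_def bounded_opD(2)[OF A1] comm)
        then show ?thesis using 2 bezout[OF sp[OF \<omega>]] by (simp add: d1[OF \<eta>] k12)
      next
        case 3
        have "(T $ 2) (\<eta> {}) = S1 ((T $ 2) (\<omega> {1})) \<boxplus> S2 ((T $ 2) (\<omega> {2}))"
          using sp[OF \<omega>] cl by (simp add: \<eta>_def bounded_opD(2)[OF A2] comm)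
        then show ?thesis using 3 bezout[OF sp[OF \<omega>]] by (simp add: d2[OF \<eta>] flip: k12)
      next
        case 4
        have "(T $ 1) (\<eta> {2}) \<boxminus> (T $ 2) (\<eta> {1}) = s \<bullet>\<^sub>H (S1 ((T $ 1) (\<omega> UNIV)) \<boxplus> S2 ((T $ 2) (\<omega> UNIV)))"
          using sp[OF \<omega>] cl
          by (simp add: \<eta>_def bounded_opD(3)[OF A1] bounded_opD(3)[OF A2] comm minus_eq_scale
              scale_scale scale_add_right)
        also have "\<dots> = s \<bullet>\<^sub>H \<omega> UNIV" using bezout[OF sp[OF \<omega>]] by simp
        finally show ?thesis
          using 4 sp[OF \<omega>] by (simp add: d12[OF \<eta>] scale_scale s)
      qed
    qed
    then show ?thesis using \<eta> by (intro bexI[of _ \<eta>]) auto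
  qed
  moreover have "koszul_diff H T \<eta> \<in> koszul_space H \<and> (\<forall>S. koszul_diff H T (koszul_diff H T \<eta>) S = \<zero>)"
    if \<eta>: "\<eta> \<in> koszul_space H" for \<eta>
  proof -
    have "koszul_diff H T \<eta> S \<in> C" for S
      using two_set_cases[of S] sp[OF \<eta>] cl by (auto simp: d0[OF \<eta>] d1[OF \<eta>] d2[OF \<eta>] d12[OF \<eta>])
    then have D: "koszul_diff H T \<eta> \<in> koszul_space H" by (auto simp: koszul_space_def)
    have "koszul_diff H T (koszul_diff H T \<eta>) S = \<zero>" for S
      using two_set_cases[of S] sp[OF \<eta>] cl
      by (auto simp: d0[OF D] d1[OF D] d2[OF D] d12[OF D] d0[OF \<eta>] d1[OF \<eta>] d2[OF \<eta>] z comm(1) minus_eq_zero_iff[THEN iffD2, OF _ _ refl])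
    then show ?thesis using D by blast
  qed
  ultimately show ?thesis unfolding koszul_exact_def by blast
qed

lemma bounded_op_cong: "bounded_op H A \<Longrightarrow> (\<And>x. x \<in> C \<Longrightarrow> B x = A x) \<Longrightarrow> bounded_op H B"
  by (auto simp: bounded_op_def Pi_iff)

lemma op_inv:
  assumes "invertible_op H A"
  shows "bounded_op H A" and "bounded_op H (op_inv H A)"
    and "x \<in> C \<Longrightarrow> A (op_inv H A x) = x" and "x \<in> C \<Longrightarrow> op_inv H A (A x) = x"
proof -
  obtain B where A: "bounded_op H A" and B: "bounded_op H B" "\<And>x. x \<in> C \<Longrightarrow> B (A x) = x" "\<And>x. x \<in> C \<Longrightarrow> A (B x) = x"
    using assms by (auto simp: invertible_op_def)
  have inj: "inj_on A C" using B(2) by (metis inj_onI)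
  have eq: "op_inv H A x = B x" if "x \<in> C" for x
    unfolding op_inv_def using that B bounded_opD(1)[OF B(1)] inj by (intro inv_into_f_eq) auto
  show "bounded_op H A" "bounded_op H (op_inv H A)"
    using A bounded_op_cong[OF B(1) eq] by auto
  show "x \<in> C \<Longrightarrow> A (op_inv H A x) = x" "x \<in> C \<Longrightarrow> op_inv H A (A x) = x"
    using eq B bounded_opD(1)[OF A] by auto
qed

lemma op_inv_commute:
  assumes A: "invertible_op H A" and S: "bounded_op H S"
    and comm: "\<And>x. x \<in> C \<Longrightarrow> S (A x) = A (S x)" and x: "x \<in> C"
  shows "S (op_inv H A x) = op_inv H A (S x)"
proof -
  note i = op_inv[OF A]
  have y: "op_inv H A x \<in> C" using x by (rule bounded_opD(1)[OF i(2)])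
  then have "A (S (op_inv H A x)) = S x" using comm i(3)[OF x] by metis
  then show ?thesis using i(4) bounded_opD(1)[OF S y] by metis
qed

text \<open>The lower bound is exactly the boundedness of the inverse.\<close>

lemma invertible_opI:
  assumes A: "bounded_op H A" and bij: "bij_betw A C C"
    and bound: "\<And>x. x \<in> C \<Longrightarrow> nrm x \<le> M * nrm (A x)"
  shows "invertible_op H A"
proof -
  define B where "B = inv_into C A"
  have B: "x \<in> C \<Longrightarrow> B x \<in> C" "x \<in> C \<Longrightarrow> A (B x) = x" "x \<in> C \<Longrightarrow> B (A x) = x" for x
    using bij bij_betw_inv_into_left[OF bij] bij_betw_inv_into_right[OF bij] bij_betw_apply[OF bij_betw_inv_into[OF bij]]
    by (auto simp: B_def)
  have "bounded_op H B"
  proof (rule bounded_opI)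
    fix x y assume xy: "x \<in> C" "y \<in> C"
    then have "A (B x \<boxplus> B y) = x \<boxplus> y" by (simp add: bounded_opD(2)[OF A] B)
    then show "B (x \<boxplus> y) = B x \<boxplus> B y" using B xy by (metis M.a_closed)
  next
    fix c x assume x: "x \<in> C"
    then have "A (c \<bullet>\<^sub>H B x) = c \<bullet>\<^sub>H x" by (simp add: bounded_opD(3)[OF A] B)
    then show "B (c \<bullet>\<^sub>H x) = c \<bullet>\<^sub>H B x" using B x by (metis scale_closed)
  next
    fix x assume "x \<in> C"
    then show "nrm (B x) \<le> M * nrm x" using bound[of "B x"] B by simp
  qed (rule B)
  then show ?thesis using A B by (auto simp: invertible_op_def)
qed

end

context norm_bounded_operator
begin

lemma pa_invertible:
  assumes nz: "\<And>z. cmod z \<le> R \<Longrightarrow> poly G z \<noteq> 0"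
  shows "invertible_op H (pa G)"
proof -
  obtain M where "\<forall>x\<in>C. nrm x \<le> M * nrm (pa G x)" using pa_norm_ge[OF nz] by blast
  then show ?thesis by (intro invertible_opI[OF pa_bounded pa_bij[OF nz], where M = M]) auto
qed

end

section \<open>Laurent polynomials obtained by composing with \<open>kappa0\<close>\<close>

abbreviation keys where "keys \<equiv> Poly_Mapping.keys"

abbreviation lookup where "lookup \<equiv> Poly_Mapping.lookup"

abbreviation kappa_scale :: "real \<Rightarrow> complex" where
  "kappa_scale r \<equiv> complex_of_real (1 / sqrt (1 / r\<^sup>2 + r\<^sup>2))"

text \<open>With a = \<open>kappa_scale r\<close> this is z^K p(a z, a / z). When K bounds the
  exponents of the second variable, the factor z^K clears all denominators and the subtraction of
  naturals does not truncate.\<close>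

definition laurent_numerator :: "complex \<Rightarrow> nat \<Rightarrow> 2 cpoly \<Rightarrow> complex poly" where
  "laurent_numerator a K p = (\<Sum>m\<in>keys p.
     monom (lookup p m * a ^ (lookup m 1 + lookup m 2))
       (K + lookup m 1 - lookup m 2))"

lemma kappa0_eq:
  assumes "a = kappa_scale r"
  shows "kappa0 r z $ 1 = a * z" and "kappa0 r z $ 2 = a * inverse z"
  by (simp_all add: kappa0_def assms)

lemma poly_laurent_numerator:
  assumes K: "\<And>m. m \<in> keys p \<Longrightarrow> lookup m 2 \<le> K" and z: "z \<noteq> 0"
  shows "poly (laurent_numerator (kappa_scale r) K p) z = z ^ K * poly_at p (kappa0 r z)"
proof -
  define a where "a = kappa_scale r"
  have *: "lookup p m * a ^ (lookup m 1 + lookup m 2) * z ^ (K + lookup m 1 - lookup m 2)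
     = z ^ K * (lookup p m * (\<Prod>i\<in>UNIV. (kappa0 r z $ i) ^ lookup m i))"
    if "m \<in> keys p" for m
  proof -
    have "z ^ (K + lookup m 1 - lookup m 2) * z ^ lookup m 2 = z ^ K * z ^ lookup m 1"
      using K[OF that] by (simp flip: power_add)
    then have "z ^ (K + lookup m 1 - lookup m 2) = z ^ K * z ^ lookup m 1 * inverse z ^ lookup m 2"
      using z by (simp add: field_simps)
    then show ?thesis
      by (simp add: UNIV_2 kappa0_eq[OF a_def]) (simp add: power_add power_mult_distrib mult_ac)
  qed
  then show ?thesis
    unfolding laurent_numerator_def poly_at_def a_def[symmetric]
    by (simp only: poly_sum poly_monom sum_distrib_left) (rule sum.cong[OF refl *])
qed

context complex_hilbert_space
begin

text \<open>The two entries multiply to a^2. A point off the curve z1 z2 = a^2 is excluded by a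
  Bezout identity; a point on it has the form \<open>kappa0 r w\<close>, and for |w| > 1/r the first
  entry minus its coordinate is already invertible.\<close>

lemma taylor_spectrum_kappa0_op:
  assumes T: "invertible_op H T" and "0 < r"
    and bound: "\<And>x. x \<in> C \<Longrightarrow> nrm (T x) \<le> 1 / r * nrm x"
  shows "taylor_spectrum H (kappa0_op r H T) \<subseteq> kappa0 r ` (cball 0 (1 / r) - {0})"
proof
  fix z :: "complex ^ 2" assume "z \<in> taylor_spectrum H (kappa0_op r H T)"
  then have ne: "\<not> koszul_exact H (\<chi> i. (\<lambda>x. (kappa0_op r H T $ i) x \<boxminus> (z $ i) \<bullet>\<^sub>H x))"
    by (simp add: taylor_spectrum_def)
  define a where "a = kappa_scale r"
  have "0 < 1 / r\<^sup>2 + r\<^sup>2" using assms(2) by (intro add_pos_pos) auto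
  then have a: "a \<noteq> 0" by (auto simp: a_def)
  define D where "D = (\<chi> i. (\<lambda>x. (kappa0_op r H T $ i) x \<boxminus> (z $ i) \<bullet>\<^sub>H x))"
  define U where "U = op_inv H T"
  note i = op_inv[OF T, folded U_def]
  note cl = bounded_opD(1)[OF i(1)] bounded_opD(1)[OF i(2)]
  have D1: "(D $ 1) x = a \<bullet>\<^sub>H T x \<boxminus> z $ 1 \<bullet>\<^sub>H x" and D2: "(D $ 2) x = a \<bullet>\<^sub>H U x \<boxminus> z $ 2 \<bullet>\<^sub>H x" for x
    by (simp_all add: D_def kappa0_op_def a_def U_def)
  have bd: "bounded_op H (\<lambda>x. c \<bullet>\<^sub>H V x \<boxminus> d \<bullet>\<^sub>H x)" if V: "bounded_op H V" for c d V
  proof -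
    interpret V: hilbert_operator H V by unfold_locales (rule V)
    show ?thesis
      by (rule bounded_op_cong[OF V.pa_bounded[of "[:-d, c:]"]])
        (simp add: V.pa_pCons minus_eq_scale scale_scale V.op_scale M.a_comm)
  qed
  have bD1: "bounded_op H (D $ 1)" by (rule bounded_op_cong[OF bd[OF i(1)] D1])
  have bD2: "bounded_op H (D $ 2)" by (rule bounded_op_cong[OF bd[OF i(2)] D2])
  note bs = bounded_opD(2,3)[OF i(1)] bounded_opD(2,3)[OF i(2)]
  have D12: "(D $ 1) ((D $ 2) x) = (D $ 2) ((D $ 1) x)" if "x \<in> C" for x
  proof -
    have "(D $ 1) ((D $ 2) x) = (a * a) \<bullet>\<^sub>H x \<boxplus> (- (a * z $ 2)) \<bullet>\<^sub>H T x \<boxplus> ((- (a * z $ 1)) \<bullet>\<^sub>H U x \<boxplus> (z $ 1 * z $ 2) \<bullet>\<^sub>H x)"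
      using that cl by (simp add: D1 D2 minus_eq_scale bs i scale_add_right scale_scale mult_ac)
    moreover have "(D $ 2) ((D $ 1) x) = (a * a) \<bullet>\<^sub>H x \<boxplus> (- (a * z $ 1)) \<bullet>\<^sub>H U x \<boxplus> ((- (a * z $ 2)) \<bullet>\<^sub>H T x \<boxplus> (z $ 1 * z $ 2) \<bullet>\<^sub>H x)"
      using that cl by (simp add: D1 D2 minus_eq_scale bs i scale_add_right scale_scale mult_ac)
    ultimately show ?thesis using that cl by (simp add: add_add_swap)
  qed
  show "z \<in> kappa0 r ` (cball 0 (1 / r) - {0})"
  proof (rule ccontr)
    assume z: "z \<notin> kappa0 r ` (cball 0 (1 / r) - {0})"
    have "koszul_exact H D"
    proof (cases "z $ 1 * z $ 2 = a * a")
      case False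
      \<comment> \<open>The coefficients below come from a U (a T - z1) + z1 (a U - z2) = a^2 - z1
        z2, where U is the inverse of T.\<close>
      define d where "d = a * a - z $ 1 * z $ 2"
      have d: "d \<noteq> 0" using False by (simp add: d_def)
      have DU: "(D $ 1) (U x) = U ((D $ 1) x)" "(D $ 2) (U x) = U ((D $ 2) x)" if "x \<in> C" for x
        using that cl by (simp_all add: D1 D2 minus_eq_scale bs i)
      show ?thesis
      proof (rule koszul_exact_two[where ?S1.0 = "\<lambda>x. (a / d) \<bullet>\<^sub>H U x" and ?S2.0 = "\<lambda>x. (z $ 1 / d) \<bullet>\<^sub>H x", OF bD1 bD2])
        fix x assume x: "x \<in> C"
        have "(a / d) \<bullet>\<^sub>H U ((D $ 1) x) \<boxplus> (z $ 1 / d) \<bullet>\<^sub>H (D $ 2) x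
          = ((a * a / d) \<bullet>\<^sub>H x \<boxplus> (- (a * z $ 1 / d)) \<bullet>\<^sub>H U x) \<boxplus> ((a * z $ 1 / d) \<bullet>\<^sub>H U x \<boxplus> (- (z $ 1 * z $ 2 / d)) \<bullet>\<^sub>H x)"
          using x cl by (simp add: D1 D2 minus_eq_scale bs i scale_add_right scale_scale mult_ac)
        also have "\<dots> = ((a * a / d) \<bullet>\<^sub>H x \<boxplus> (- (a * z $ 1 / d)) \<bullet>\<^sub>H U x) \<boxplus> ((- (z $ 1 * z $ 2 / d)) \<bullet>\<^sub>H x \<boxplus> (a * z $ 1 / d) \<bullet>\<^sub>H U x)"
          using x cl by (simp add: M.a_comm)
        also have "\<dots> = ((a * a / d) \<bullet>\<^sub>H x \<boxplus> (- (z $ 1 * z $ 2 / d)) \<bullet>\<^sub>H x) \<boxplus> ((- (a * z $ 1 / d)) \<bullet>\<^sub>H U x \<boxplus> (a * z $ 1 / d) \<bullet>\<^sub>H U x)"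
          using x cl by (intro add_add_swap) auto
        also have "\<dots> = (a * a / d - z $ 1 * z $ 2 / d) \<bullet>\<^sub>H x"
          using x cl by (simp flip: scale_add_left)
        also have "a * a / d - z $ 1 * z $ 2 / d = 1"
          using d by (simp add: d_def flip: diff_divide_distrib)
        finally show "(a / d) \<bullet>\<^sub>H U ((D $ 1) x) \<boxplus> (z $ 1 / d) \<bullet>\<^sub>H (D $ 2) x = x" using x by simp
      qed (use bounded_op_scale[OF i(2)] bounded_op_scale[OF bounded_op_id] D12 DU cl bounded_opD(3)[OF bD1]
            bounded_opD(3)[OF bD2] in auto)
    next
      case True
      define w where "w = z $ 1 / a"
      have "z $ 1 \<noteq> 0" using True a by auto
      then have w: "w \<noteq> 0" using a by (simp add: w_def)
      have "z = kappa0 r w"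
      proof -
        have "z $ 2 = a * inverse w" using True a \<open>z $ 1 \<noteq> 0\<close> by (simp add: w_def field_simps)
        moreover have "z $ 1 = a * w" using a by (simp add: w_def)
        ultimately show ?thesis by (simp add: vec_eq_iff forall_2 kappa0_eq[OF a_def])
      qed
      then have "\<not> cmod w \<le> 1 / r" using z w by auto
      interpret norm_bounded_operator H T "1 / r"
        by unfold_locales (use i(1) assms(2) bound in auto)
      define G where "G = [:- z $ 1, a:]"
      have "invertible_op H (pa G)"
      proof (rule pa_invertible)
        fix y assume "cmod y \<le> 1 / r"
        then have "y \<noteq> w" using \<open>\<not> cmod w \<le> 1 / r\<close> by auto
        then show "poly G y \<noteq> 0" using a by (auto simp: G_def w_def field_simps)
      qed
      moreover have G: "pa G x = (D $ 1) x" if "x \<in> C" for x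
        using that by (simp add: G_def D1 pa_pCons minus_eq_scale scale_scale op_scale M.a_comm)
      ultimately have inv: "invertible_op H (D $ 1)"
        using bD1 unfolding invertible_op_def by (metis (no_types, lifting) pa_closed bounded_opD(1))
      note j = op_inv[OF inv]
      show ?thesis
      proof (rule koszul_exact_two[where ?S1.0 = "op_inv H (D $ 1)" and ?S2.0 = "\<lambda>x. \<zero>", OF bD1 bD2 j(2)])
        show "bounded_op H (\<lambda>x. \<zero>)" by (rule bounded_opI[where K = 0]) auto
        show "(D $ 2) (op_inv H (D $ 1) x) = op_inv H (D $ 1) ((D $ 2) x)" if "x \<in> C" for x
          by (rule op_inv_commute[OF inv bD2 D12[symmetric] that])
      qed (use D12 j bounded_op_zero[OF bD1] bounded_op_zero[OF bD2] in auto)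
    qed
    then show False using ne by (simp add: D_def)
  qed
qed

end

section \<open>Rational functions of $\kappa_0(T)$\<close>

text \<open>Riemann's removable singularity for quotients of polynomials: boundedness of P / G near
  0 means that P vanishes there at least to the order of G, so the power of z can be
  cancelled.\<close>

lemma removable_common_zero:
  fixes P G :: "complex poly"
  assumes R: "0 < R" and nz: "\<And>z. z \<noteq> 0 \<Longrightarrow> cmod z \<le> R \<Longrightarrow> poly G z \<noteq> 0"
    and bound: "\<And>z. z \<noteq> 0 \<Longrightarrow> cmod z \<le> R \<Longrightarrow> cmod (poly P z) \<le> M * cmod (poly G z)"
  obtains j P' G' where "P = monom 1 j * P'" and "G = monom 1 j * G'"
    and "\<And>z. cmod z \<le> R \<Longrightarrow> poly G' z \<noteq> 0"
    and "\<And>z. cmod z \<le> R \<Longrightarrow> cmod (poly P' z) \<le> M * cmod (poly G' z)"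
proof -
  have ev: "\<forall>\<^sub>F z in at 0. z \<noteq> 0 \<and> cmod z \<le> R"
    unfolding eventually_at using R by (intro exI[of _ R]) auto
  have split: "\<exists>i Q'. Q = monom 1 i * Q' \<and> poly Q' 0 \<noteq> 0" if Q: "Q \<noteq> 0" for Q :: "complex poly"
  proof -
    obtain Q' where "Q = [:- 0, 1:] ^ Polynomial.order 0 Q * Q'" "\<not> [:- 0, 1:] dvd Q'"
      using order_decomp[OF Q, of 0] by blast
    then show ?thesis
      by (intro exI[of _ "Polynomial.order 0 Q"] exI[of _ Q']) (simp add: monom_altdef dvd_iff_poly_eq_0)
  qed
  have "poly G (of_real R) \<noteq> 0" using R by (intro nz) auto
  then have "G \<noteq> 0" by auto
  then obtain j G' where G: "G = monom 1 j * G'" "poly G' 0 \<noteq> 0" using split by blast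
  have nz': "poly G' z \<noteq> 0" if "cmod z \<le> R" for z
    using that nz[of z] G by (cases "z = 0") (auto simp: poly_monom)
  have "\<exists>P'. P = monom 1 j * P'"
  proof (cases "P = 0")
    case False
    then obtain i P'' where P: "P = monom 1 i * P''" "poly P'' 0 \<noteq> 0" using split by blast
    have "j \<le> i"
    proof (rule ccontr)
      assume "\<not> j \<le> i"
      \<comment> \<open>If G had the zero of higher order, cancelling z^i would leave a positive
        power of |z| on the right, and letting z tend to 0 would force the cofactor of P to vanish
        at 0.\<close>
      then obtain k where k: "j = i + Suc k" using less_imp_Suc_add[of i j] by auto
      have le: "cmod (poly P'' z) \<le> M * (cmod z ^ Suc k * cmod (poly G' z))" if "z \<noteq> 0 \<and> cmod z \<le> R" for z
      proof -
        have "cmod z ^ i * cmod (poly P'' z) \<le> cmod z ^ i * (M * (cmod z ^ Suc k * cmod (poly G' z)))"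
          using bound[of z] that
          by (simp add: P(1) G(1) k poly_monom norm_mult norm_power power_add mult_ac)
        then show ?thesis using that by simp
      qed
      have "cmod (poly P'' 0) \<le> M * (cmod 0 ^ Suc k * cmod (poly G' 0))"
      proof (rule tendsto_le[where F = "at 0"])
        show "((\<lambda>z. M * (cmod z ^ Suc k * cmod (poly G' z))) \<longlongrightarrow> M * (cmod 0 ^ Suc k * cmod (poly G' 0))) (at 0)"
          by (intro tendsto_intros poly_isCont[unfolded isCont_def])
        show "((\<lambda>z. cmod (poly P'' z)) \<longlongrightarrow> cmod (poly P'' 0)) (at 0)"
          by (intro tendsto_intros poly_isCont[unfolded isCont_def])
        show "\<forall>\<^sub>F z in at 0. cmod (poly P'' z) \<le> M * (cmod z ^ Suc k * cmod (poly G' z))"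
          using ev by eventually_elim (rule le)
      qed simp
      then show False using P(2) by simp
    qed
    then have "P = monom 1 j * (monom 1 (i - j) * P'')"
      by (simp add: P(1) mult_monom flip: mult.assoc)
    then show ?thesis by blast
  qed (auto intro: exI[of _ 0])
  then obtain P' where P: "P = monom 1 j * P'" by blast
  have le: "cmod (poly P' z) \<le> M * cmod (poly G' z)" if "z \<noteq> 0 \<and> cmod z \<le> R" for z
  proof -
    have "cmod z ^ j * cmod (poly P' z) \<le> cmod z ^ j * (M * cmod (poly G' z))"
      using bound[of z] that by (simp add: P G(1) poly_monom norm_mult norm_power mult_ac)
    then show ?thesis using that by simp
  qed
  have "cmod (poly P' 0) \<le> M * cmod (poly G' 0)"
  proof (rule tendsto_le[where F = "at 0"])
    show "((\<lambda>z. M * cmod (poly G' z)) \<longlongrightarrow> M * cmod (poly G' 0)) (at 0)"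
      by (intro tendsto_intros poly_isCont[unfolded isCont_def])
    show "((\<lambda>z. cmod (poly P' z)) \<longlongrightarrow> cmod (poly P' 0)) (at 0)"
      by (intro tendsto_intros poly_isCont[unfolded isCont_def])
    show "\<forall>\<^sub>F z in at 0. cmod (poly P' z) \<le> M * cmod (poly G' z)"
      using ev by eventually_elim (rule le)
  qed simp
  then have "cmod (poly P' z) \<le> M * cmod (poly G' z)" if "cmod z \<le> R" for z
    using le that by (cases "z = 0") auto
  then show thesis using that[OF P G(1)] nz' by blast
qed

context complex_hilbert_space
begin

lemma kappa0_op_bounded:
  assumes "invertible_op H T"
  shows "bounded_op H (kappa0_op r H T $ i)"
  using bounded_op_scale[OF op_inv(1)[OF assms]] bounded_op_scale[OF op_inv(2)[OF assms]]
  by (cases "i = 1") (simp_all add: kappa0_op_def)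

lemma commuting_tuple_kappa0_op:
  assumes "invertible_op H T"
  shows "commuting_tuple H (kappa0_op r H T)"
proof -
  note i = op_inv[OF assms]
  note cl = bounded_opD(1)[OF i(1)] bounded_opD(1)[OF i(2)]
  have "(kappa0_op r H T $ i) ((kappa0_op r H T $ j) x) = (kappa0_op r H T $ j) ((kappa0_op r H T $ i) x)"
    if "x \<in> C" for i j x
    using that cl by (simp add: kappa0_op_def bounded_opD(3)[OF i(1)] bounded_opD(3)[OF i(2)] i)
  then show ?thesis using kappa0_op_bounded[OF assms] by (simp add: commuting_tuple_def)
qed

lemma funpow_scale:
  assumes A: "bounded_op H A" and x: "x \<in> C"
  shows "((\<lambda>x. c \<bullet>\<^sub>H A x) ^^ n) x = c ^ n \<bullet>\<^sub>H (A ^^ n) x"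
proof (induction n)
  case (Suc n)
  have "(A ^^ n) x \<in> C" using bounded_opD(1)[OF bounded_op_funpow[OF A] x] .
  then show ?case using Suc by (simp add: bounded_opD[OF A] scale_scale)
qed (simp add: x)

lemma op_inv_funpow:
  assumes T: "invertible_op H T" and x: "x \<in> C"
  shows "(op_inv H T ^^ (j + k)) ((T ^^ k) x) = (op_inv H T ^^ j) x"
    and "k \<le> n \<Longrightarrow> (op_inv H T ^^ k) ((T ^^ n) x) = (T ^^ (n - k)) x"
    and "(T ^^ k) ((op_inv H T ^^ k) x) = x"
proof -
  note i = op_inv[OF T]
  have cl: "(T ^^ m) x \<in> C" "(op_inv H T ^^ m) x \<in> C" for m
    using bounded_opD(1)[OF bounded_op_funpow[OF i(1)] x] bounded_opD(1)[OF bounded_op_funpow[OF i(2)] x] by auto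
  show "(op_inv H T ^^ (j + k)) ((T ^^ k) x) = (op_inv H T ^^ j) x"
    by (induction k) (simp_all add: funpow_swap1[of "op_inv H T"] i cl)
  show "(op_inv H T ^^ k) ((T ^^ n) x) = (T ^^ (n - k)) x" if "k \<le> n"
    using that
  proof (induction k)
    case (Suc k)
    then have "(T ^^ (n - k)) x = T ((T ^^ (n - Suc k)) x)"
      by (metis Suc_diff_Suc Suc_le_lessD comp_apply funpow.simps(2))
    then show ?case using Suc by (simp add: i cl)
  qed simp
  show "(T ^^ k) ((op_inv H T ^^ k) x) = x"
    by (induction k) (simp_all add: funpow_swap1[of T] i cl)
qed

text \<open>Evaluating at T^K x and not at x is the operator version of multiplying by z^K: every
  power of the inverse is absorbed and a polynomial of T remains. As T is invertible, vectors of
  this shape exhaust the space.\<close>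

lemma poly_op_kappa0_op:
  assumes T: "invertible_op H T" and x: "x \<in> C"
    and K: "\<And>m. m \<in> keys p \<Longrightarrow> lookup m 2 \<le> K"
  shows "poly_op H p (kappa0_op r H T) ((T ^^ K) x)
    = poly_apply H T (laurent_numerator (kappa_scale r) K p) x"
proof -
  note i = op_inv[OF T]
  interpret hilbert_operator H T by unfold_locales (rule i(1))
  define a where "a = kappa_scale r"
  have mono: "monom_op (kappa0_op r H T) m ((T ^^ K) x)
      = a ^ (lookup m 1 + lookup m 2) \<bullet>\<^sub>H (T ^^ (K + lookup m 1 - lookup m 2)) x"
    if "m \<in> keys p" for m
  proof -
    define k1 k2 where "k1 = lookup m 1" and "k2 = lookup m 2"
    have k2: "k2 \<le> K" using K[OF that] by (simp add: k2_def)
    have cl: "(T ^^ n) x \<in> C" for n using bounded_opD(1)[OF bounded_op_funpow[OF i(1)] x] .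
    have T1: "((kappa0_op r H T $ 1) ^^ n) y = a ^ n \<bullet>\<^sub>H (T ^^ n) y" if "y \<in> C" for n y
      using funpow_scale[OF i(1) that, where c = a and n = n] by (simp add: kappa0_op_def a_def)
    have T2: "((kappa0_op r H T $ 2) ^^ n) y = a ^ n \<bullet>\<^sub>H (op_inv H T ^^ n) y" if "y \<in> C" for n y
      using funpow_scale[OF i(2) that, where c = a and n = n] by (simp add: kappa0_op_def a_def)
    have sc1: "(T ^^ n) (c \<bullet>\<^sub>H y) = c \<bullet>\<^sub>H (T ^^ n) y" if "y \<in> C" for c n y
      using bounded_opD(3)[OF bounded_op_funpow[OF i(1)] that] .
    have sc2: "(op_inv H T ^^ n) (c \<bullet>\<^sub>H y) = c \<bullet>\<^sub>H (op_inv H T ^^ n) y" if "y \<in> C" for c n y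
      using bounded_opD(3)[OF bounded_op_funpow[OF i(2)] that] .
    have e1: "(T ^^ k1) ((T ^^ (K - k2)) x) = (T ^^ (K + k1 - k2)) x"
      using k2 by (metis Nat.add_diff_assoc2 add.commute comp_apply funpow_add)
    have e2: "(T ^^ k1) ((T ^^ K) x) = (T ^^ (K + k1)) x"
      by (metis add.commute comp_apply funpow_add)
    show ?thesis
      unfolding k1_def[symmetric] k2_def[symmetric] monom_op_def
      using sorted_list_of_two
    proof
      assume "sorted_list_of_set (UNIV :: 2 set) = [1, 2]"
      then show "foldr (\<lambda>i A. (kappa0_op r H T $ i ^^ lookup m i) \<circ> A) (sorted_list_of_set UNIV) id ((T ^^ K) x)
        = a ^ (k1 + k2) \<bullet>\<^sub>H (T ^^ (K + k1 - k2)) x"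
        using cl k2 x by (simp add: T1 T2 sc1 op_inv_funpow[OF T] scale_scale power_add e1 flip: k1_def k2_def)
    next
      assume "sorted_list_of_set (UNIV :: 2 set) = [2, 1]"
      then show "foldr (\<lambda>i A. (kappa0_op r H T $ i ^^ lookup m i) \<circ> A) (sorted_list_of_set UNIV) id ((T ^^ K) x)
        = a ^ (k1 + k2) \<bullet>\<^sub>H (T ^^ (K + k1 - k2)) x"
        using cl k2 x by (simp add: T1 T2 sc2 op_inv_funpow[OF T] scale_scale power_add e2 mult.commute flip: k1_def k2_def)
    qed
  qed
  have cl: "(T ^^ n) x \<in> C" for n using bounded_opD(1)[OF bounded_op_funpow[OF i(1)] x] .
  show ?thesis
    unfolding poly_op_def laurent_numerator_def a_def[symmetric]
    by (subst pa_sum) (use x cl in \<open>auto simp: pa_monom mono scale_scale intro!: M.finsum_cong'\<close>)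
qed

lemma nrm_le_op_norm:
  assumes A: "bounded_op H A" and x: "x \<in> C"
  shows "nrm (A x) \<le> op_norm H A * nrm x"
proof (cases "nrm x = 0")
  case True
  then have "x = \<zero>" using x by (simp add: nrm_eq_zero)
  then show ?thesis by (simp add: bounded_op_zero[OF A])
next
  case False
  then have pos: "0 < nrm x" using nrm_nonneg[OF x] by linarith
  obtain K where K: "0 < K" "\<And>x. x \<in> C \<Longrightarrow> nrm (A x) \<le> K * nrm x"
    using bounded_op_nonneg_bound[OF A] by blast
  have "bdd_above {nrm (A x) |x. x \<in> C \<and> nrm x \<le> 1}"
  proof (rule bdd_aboveI)
    fix t assume "t \<in> {nrm (A x) |x. x \<in> C \<and> nrm x \<le> 1}"
    then obtain y where y: "t = nrm (A y)" "y \<in> C" "nrm y \<le> 1" by blast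
    have "K * nrm y \<le> K * 1" using y K by (intro mult_left_mono) auto
    then show "t \<le> K" using K(2)[OF y(2)] y(1) by simp
  qed
  moreover define y where "y = complex_of_real (1 / nrm x) \<bullet>\<^sub>H x"
  have "y \<in> C" "nrm y = 1" using x pos by (auto simp: y_def nrm_scale norm_divide)
  ultimately have "nrm (A y) \<le> op_norm H A"
    unfolding op_norm_def by (intro cSup_upper) auto
  moreover have "nrm (A y) = nrm (A x) / nrm x"
    using x pos by (simp add: y_def bounded_opD[OF A] nrm_scale norm_divide del: of_real_divide)
  ultimately show ?thesis using pos by (simp add: divide_le_eq)
qed

lemma op_norm_le:
  assumes "\<And>x. x \<in> C \<Longrightarrow> nrm x \<le> 1 \<Longrightarrow> nrm (A x) \<le> M"
  shows "op_norm H A \<le> M"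
proof -
  have "{nrm (A x) |x. x \<in> C \<and> nrm x \<le> 1} \<noteq> {}"
    using M.zero_closed nrm_zero by (auto intro!: exI[of _ "\<zero>"])
  then show ?thesis unfolding op_norm_def using assms by (intro cSup_least) auto
qed

text \<open>A finite supremum M says |P| <= M |G| on the punctured disc for the cleared numerators P
  and G. After the common power of z is cancelled, the inequality holds on the full disc with a
  denominator free of zeros, as von Neumann's inequality requires.\<close>

theorem von_neumann_set_kappa0_op:
  assumes T: "invertible_op H T" and r: "0 < r"
    and bound: "\<And>x. x \<in> C \<Longrightarrow> nrm (T x) \<le> 1 / r * nrm x"
  shows "von_neumann_set (kappa0 r ` (cball 0 (1 / r) - {0})) H (kappa0_op r H T)"
  unfolding von_neumann_set_def
proof (intro conjI allI impI)
  define Y where "Y = kappa0 r ` (cball 0 (1 / r) - {0})"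
  note i = op_inv[OF T]
  interpret norm_bounded_operator H T "1 / r"
    by unfold_locales (use i(1) r bound in auto)
  fix p g :: "2 cpoly"
  assume g: "g \<noteq> 0 \<and> (\<forall>\<xi>\<in>Y. poly_at g \<xi> \<noteq> 0)"
  define S where "S = (SUP \<xi>\<in>Y. ennreal (cmod (poly_at p \<xi> / poly_at g \<xi>)))"
  show "ennreal (op_norm H (rational_op H p g (kappa0_op r H T))) \<le> S"
  proof (cases "S = \<infinity>")
    case False
    define M where "M = enn2real S"
    have S: "S = ennreal M" "0 \<le> M" using False by (auto simp: M_def less_top)
    define a where "a = kappa_scale r"
    \<comment> \<open>One exponent for numerator and denominator, so that z^K drops out of the
      quotient; the inserted 0 covers polynomials without monomials.\<close>
    define K where "K = Max (insert 0 ((\<lambda>m. lookup m 2) ` (keys p \<union> keys g)))"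
    have Kp: "lookup m 2 \<le> K" if "m \<in> keys p" for m
      unfolding K_def using that by (intro Max_ge) auto
    have Kg: "lookup m 2 \<le> K" if "m \<in> keys g" for m
      unfolding K_def using that by (intro Max_ge) auto
    define P where "P = laurent_numerator a K p"
    define G where "G = laurent_numerator a K g"
    have P: "poly P z = z ^ K * poly_at p (kappa0 r z)" if "z \<noteq> 0" for z
      unfolding P_def a_def by (rule poly_laurent_numerator[OF Kp that])
    have G: "poly G z = z ^ K * poly_at g (kappa0 r z)" if "z \<noteq> 0" for z
      unfolding G_def a_def by (rule poly_laurent_numerator[OF Kg that])
    have nz: "poly G z \<noteq> 0" if "z \<noteq> 0" "cmod z \<le> 1 / r" for z
      using that g by (auto simp: G Y_def)
    have le: "cmod (poly P z) \<le> M * cmod (poly G z)" if z: "z \<noteq> 0" "cmod z \<le> 1 / r" for z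
    proof -
      have Y: "kappa0 r z \<in> Y" using z by (auto simp: Y_def)
      then have "ennreal (cmod (poly_at p (kappa0 r z) / poly_at g (kappa0 r z))) \<le> ennreal M"
        unfolding S(1)[symmetric] S_def by (rule SUP_upper)
      then have "cmod (poly_at p (kappa0 r z)) \<le> M * cmod (poly_at g (kappa0 r z))"
        using g Y S(2) by (simp add: norm_divide divide_le_eq)
      then have "cmod z ^ K * cmod (poly_at p (kappa0 r z)) \<le> cmod z ^ K * (M * cmod (poly_at g (kappa0 r z)))"
        by (rule mult_left_mono) simp
      then show ?thesis using z by (simp add: P G norm_mult norm_power mult_ac)
    qed
    obtain j P' G' where PG: "P = Polynomial.monom 1 j * P'" "G = Polynomial.monom 1 j * G'"
      and nz': "\<And>z. cmod z \<le> 1 / r \<Longrightarrow> poly G' z \<noteq> 0"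
      and le': "\<And>z. cmod z \<le> 1 / r \<Longrightarrow> cmod (poly P' z) \<le> M * cmod (poly G' z)"
      using removable_common_zero[OF R_pos nz le] by blast
    have PG_le: "nrm (pa P x) \<le> M * nrm (pa G x)" if x: "x \<in> C" for x
    proof -
      have *: "pa (Polynomial.monom 1 j * Q) x = pa Q (pa (Polynomial.monom 1 j) x)" for Q
        using pa_mult[OF x, of Q "Polynomial.monom 1 j"] by (simp add: mult.commute)
      show ?thesis unfolding PG * using x by (intro von_neumann_inequality nz' le') auto
    qed
    \<comment> \<open>G may vanish at 0, but its factor z^j becomes a power of T, which is
      invertible.\<close>
    have surj: "\<exists>x\<in>C. pa G x = h" if h: "h \<in> C" for h
    proof -
      have Uh: "(op_inv H T ^^ j) h \<in> C" using bounded_opD(1)[OF bounded_op_funpow[OF i(2)] h] .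
      then obtain x where x: "x \<in> C" "pa G' x = (op_inv H T ^^ j) h" using pa_surj[OF nz'] by blast
      then have "pa G x = h"
        using h Uh by (simp add: PG(2) pa_mult pa_monom op_inv_funpow[OF T] bounded_opD(1)[OF bounded_op_funpow[OF i(1)]])
      then show ?thesis using x(1) by blast
    qed
    have "op_norm H (rational_op H p g (kappa0_op r H T)) \<le> M"
    proof (rule op_norm_le)
      fix h assume h: "h \<in> C" "nrm h \<le> 1"
      define y where "y = op_inv H (poly_op H g (kappa0_op r H T)) h"
      have gT: "poly_op H g (kappa0_op r H T) ((T ^^ K) x) = pa G x" if "x \<in> C" for x
        unfolding G_def a_def by (rule poly_op_kappa0_op[OF T that Kg])
      have pT: "poly_op H p (kappa0_op r H T) ((T ^^ K) x) = pa P x" if "x \<in> C" for x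
        unfolding P_def a_def by (rule poly_op_kappa0_op[OF T that Kp])
      obtain x0 where "x0 \<in> C" "pa G x0 = h" using surj[OF h(1)] by blast
      \<comment> \<open>\<open>op_inv\<close> is an \<open>inv_into\<close>, so membership in the
        image suffices: the estimate holds for whichever preimage y is selected.\<close>
      then have "h \<in> poly_op H g (kappa0_op r H T) ` C"
        using gT[of x0] bounded_opD(1)[OF bounded_op_funpow[OF i(1)], of x0 K] by (metis imageI)
      then have y: "y \<in> C" "poly_op H g (kappa0_op r H T) y = h"
        unfolding y_def op_inv_def by (auto intro: inv_into_into f_inv_into_f)
      define x where "x = (op_inv H T ^^ K) y"
      have x: "x \<in> C" "(T ^^ K) x = y"
        using y(1) bounded_opD(1)[OF bounded_op_funpow[OF i(2)]] by (auto simp: x_def op_inv_funpow[OF T])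
      have "nrm (pa P x) \<le> M * nrm (pa G x)" by (rule PG_le[OF x(1)])
      also have "pa P x = rational_op H p g (kappa0_op r H T) h"
        using pT[OF x(1)] x(2) by (simp add: rational_op_def y_def)
      also have "pa G x = h" using gT[OF x(1)] x(2) y(2) by simp
      also have "M * nrm h \<le> M * 1" using h S(2) by (intro mult_left_mono) auto
      finally show "nrm (rational_op H p g (kappa0_op r H T) h) \<le> M" by simp
    qed
    then show ?thesis by (simp add: S ennreal_leI)
  qed simp
qed (use commuting_tuple_kappa0_op[OF T] taylor_spectrum_kappa0_op[OF T r bound] in auto)

end

section \<open>The classes $PA_r$ and $QA_r$\<close>

lemma blaschke_identity:
  "(cmod (1 - cnj a * z))\<^sup>2 - (cmod (z - a))\<^sup>2 = (1 - (cmod a)\<^sup>2) * (1 - (cmod z)\<^sup>2)"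
  by (simp add: cmod_power2) (simp add: power2_eq_square algebra_simps)

text \<open>In terms of v = (z - b) / (1 - cnj b z) the claim is |(v - tau) / (1 - tau v)|^2 <= |v|,
  multiplied through by powers of 1 - cnj b z. The square is essential: for v in (-1, 0) the
  unsquared factor has modulus greater than |v|. A lower bound on |v| is also needed, as the claim
  fails at v = 0; it comes from the distance between z and b.\<close>

lemma blaschke_product_le:
  assumes b: "cmod b < 1" and z: "cmod z \<le> 1" and \<delta>: "\<delta> \<le> cmod (z - b)"
    and \<tau>: "0 < \<tau>" "\<tau> \<le> 1 / 4" "\<tau> \<le> \<delta> / 12"
  shows "(cmod ((1 + of_real \<tau> * cnj b) * z - (b + of_real \<tau>)))\<^sup>2 * cmod (1 - cnj b * z)
    \<le> (cmod ((1 + of_real \<tau> * b) - (cnj b + of_real \<tau>) * z))\<^sup>2 * cmod (z - b)"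
proof -
  define q where "q = 1 - cnj b * z"
  define v where "v = (z - b) / q"
  define x where "x = cmod v"
  have "cmod b * cmod z \<le> cmod b" using z by (intro mult_left_le) auto
  then have "cmod (cnj b * z) < 1" using b by (simp add: norm_mult)
  then have q: "q \<noteq> 0" "cmod q \<le> 2"
    using norm_triangle_ineq4[of 1 "cnj b * z"] by (auto simp: q_def)
  have vq: "z - b = v * q" using q by (simp add: v_def)
  have 1: "(1 + of_real \<tau> * cnj b) * z - (b + of_real \<tau>) = (v - of_real \<tau>) * q"
  proof -
    have "(1 + of_real \<tau> * cnj b) * z - (b + of_real \<tau>) = (z - b) - of_real \<tau> * q"
      by (simp add: q_def algebra_simps)
    then show ?thesis by (simp add: vq left_diff_distrib)
  qed
  have 2: "(1 + of_real \<tau> * b) - (cnj b + of_real \<tau>) * z = (1 - of_real \<tau> * v) * q"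
  proof -
    have "(1 + of_real \<tau> * b) - (cnj b + of_real \<tau>) * z = q - of_real \<tau> * (z - b)"
      by (simp add: q_def algebra_simps)
    then show ?thesis by (simp add: vq left_diff_distrib)
  qed
  have "(cmod (z - b))\<^sup>2 \<le> (cmod q)\<^sup>2"
  proof -
    have "0 \<le> (1 - (cmod b)\<^sup>2) * (1 - (cmod z)\<^sup>2)"
      using b z by (intro mult_nonneg_nonneg) (simp_all add: power_le_one)
    then show ?thesis unfolding q_def using blaschke_identity[of b z] by linarith
  qed
  then have x: "x \<le> 1" using q by (simp add: x_def v_def norm_divide divide_le_eq power2_le_iff_abs_le)
  have "\<delta> / 2 \<le> x"
  proof -
    have "cmod (z - b) \<le> x * 2" using vq q by (simp add: norm_mult x_def mult_left_mono)
    then show ?thesis using \<delta> by simp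
  qed
  \<comment> \<open>Since |q| <= 2, |v| is at least half the distance; this is where the 12 in the
    bound on tau comes from.\<close>
  then have x\<tau>: "6 * \<tau> \<le> x" using \<tau> by simp
  have key: "(cmod (v - of_real \<tau>))\<^sup>2 \<le> x * (cmod (1 - of_real \<tau> * v))\<^sup>2"
  proof -
    have id: "(cmod (1 - of_real \<tau> * v))\<^sup>2 - (cmod (v - of_real \<tau>))\<^sup>2 = (1 - \<tau>\<^sup>2) * (1 - x\<^sup>2)"
      using blaschke_identity[of "of_real \<tau>" v] \<tau> by (simp add: x_def)
    have "cmod (1 - of_real \<tau> * v) \<le> 1 + \<tau> * x"
      using norm_triangle_ineq4[of 1 "of_real \<tau> * v"] \<tau> by (simp add: norm_mult x_def)
    then have sq: "(cmod (1 - of_real \<tau> * v))\<^sup>2 \<le> (1 + \<tau> * x)\<^sup>2" by (rule power_mono) simp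
    have x0: "0 \<le> x" by (simp add: x_def)
    have "\<tau> * \<tau> \<le> 1/4 * \<tau>" using \<tau> by (intro mult_right_mono) auto
    moreover have "\<tau> * x \<le> 1/4 * x" using \<tau> x0 by (intro mult_right_mono) auto
    moreover have "\<tau> * \<tau> * x \<le> \<tau> * \<tau> * 1" using x by (intro mult_left_mono) auto
    moreover have "\<tau> * \<tau> * (x * x) \<le> \<tau> * \<tau> * 1" using x x0 by (intro mult_left_mono) (auto simp: mult_le_one)
    moreover have "(1 - \<tau>\<^sup>2) * (1 + x) - (1 + \<tau> * x)\<^sup>2 = x - \<tau> * \<tau> - \<tau> * \<tau> * x - 2 * (\<tau> * x) - \<tau> * \<tau> * (x * x)"
      by (simp add: power2_eq_square algebra_simps)
    ultimately have "(1 + \<tau> * x)\<^sup>2 \<le> (1 - \<tau>\<^sup>2) * (1 + x)" using x\<tau> x0 by linarith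
    \<comment> \<open>Both sides agree when |v| = 1, so the difference carries the factor 1 - x. The
      cofactor is nonnegative because tau <= 1/4 and 6 tau <= x leave at least x / 2 - 3 tau /
      4.\<close>
    with sq have "0 \<le> (1 - x) * ((1 - \<tau>\<^sup>2) * (1 + x) - (cmod (1 - of_real \<tau> * v))\<^sup>2)"
      using x by (intro mult_nonneg_nonneg) auto
    also have "\<dots> = x * (cmod (1 - of_real \<tau> * v))\<^sup>2 - (cmod (v - of_real \<tau>))\<^sup>2"
    proof -
      have "(cmod (v - of_real \<tau>))\<^sup>2 = (cmod (1 - of_real \<tau> * v))\<^sup>2 - (1 - \<tau>\<^sup>2) * (1 - x\<^sup>2)"
        using id by simp
      then show ?thesis by (simp only:) (simp add: power2_eq_square algebra_simps)
    qed
    finally show ?thesis by simp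
  qed
  have "(cmod (v - of_real \<tau>))\<^sup>2 * (cmod q)\<^sup>2 * cmod q \<le> x * (cmod (1 - of_real \<tau> * v))\<^sup>2 * (cmod q)\<^sup>2 * cmod q"
    using key by (intro mult_right_mono) auto
  then show ?thesis
    unfolding 1 2 vq q_def[symmetric] norm_mult power_mult_distrib x_def by (simp add: mult_ac)
qed

text \<open>The puncture is sent to infinity by the second coordinate, so the image is cut out by
  closed conditions: a fixed product of the coordinates and a bound on the first.\<close>

lemma closed_kappa0_image:
  assumes "0 < r"
  shows "closed (kappa0 r ` (cball 0 (1 / r) - {0}))"
proof -
  define a where "a = kappa_scale r"
  have "0 < 1 / r\<^sup>2 + r\<^sup>2" using assms by (intro add_pos_pos) auto
  then have a: "a \<noteq> 0" by (auto simp: a_def)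
  have "kappa0 r ` (cball 0 (1 / r) - {0}) = {\<xi> :: complex ^ 2. \<xi> $ 1 * \<xi> $ 2 = a * a} \<inter> {\<xi>. cmod (\<xi> $ 1) \<le> cmod a / r}"
  proof (intro equalityI subsetI)
    fix \<xi> :: "complex ^ 2" assume "\<xi> \<in> {\<xi>. \<xi> $ 1 * \<xi> $ 2 = a * a} \<inter> {\<xi>. cmod (\<xi> $ 1) \<le> cmod a / r}"
    then have \<xi>: "\<xi> $ 1 * \<xi> $ 2 = a * a" "cmod (\<xi> $ 1) \<le> cmod a / r" by auto
    then have "\<xi> $ 1 \<noteq> 0" using a by auto
    then have "\<xi> = kappa0 r (\<xi> $ 1 / a)"
      using \<xi>(1) a by (simp add: vec_eq_iff forall_2 kappa0_eq[OF a_def] field_simps)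
    moreover have "\<xi> $ 1 / a \<in> cball 0 (1 / r) - {0}"
      using \<xi>(2) \<open>\<xi> $ 1 \<noteq> 0\<close> a by (simp add: norm_divide divide_le_eq)
    ultimately show "\<xi> \<in> kappa0 r ` (cball 0 (1 / r) - {0})" by blast
  next
    fix \<xi> assume "\<xi> \<in> kappa0 r ` (cball 0 (1 / r) - {0})"
    then obtain z where "\<xi> = kappa0 r z" "z \<in> cball 0 (1 / r) - {0}" by blast
    then have z: "\<xi> = kappa0 r z" "z \<noteq> 0" "cmod z \<le> 1 / r" by auto
    have "cmod a * cmod z \<le> cmod a * (1 / r)" using z(3) by (intro mult_left_mono) auto
    then show "\<xi> \<in> {\<xi>. \<xi> $ 1 * \<xi> $ 2 = a * a} \<inter> {\<xi>. cmod (\<xi> $ 1) \<le> cmod a / r}"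
      using z by (simp add: kappa0_eq[OF a_def] norm_mult)
  qed
  then show ?thesis
    by (simp only:) (intro closed_Int closed_Collect_eq closed_Collect_le continuous_intros)
qed

lemma isCont_kappa0: "z \<noteq> 0 \<Longrightarrow> isCont (kappa0 r) z"
  unfolding isCont_def
proof (rule vec_tendstoI)
  fix i :: 2 assume "z \<noteq> 0"
  then show "((\<lambda>z. kappa0 r z $ i) \<longlongrightarrow> kappa0 r z $ i) (at z)"
    unfolding kappa0_def by (cases "i = 1") (auto intro!: tendsto_intros simp: divide_inverse)
qed

text \<open>Conversely to clearing denominators, a one-variable polynomial is realised by the first
  coordinate alone; dividing its i-th coefficient by a^i undoes the scaling in
  \<open>kappa0\<close>.\<close>

lemma univariate_cpoly:
  assumes "a \<noteq> 0"
  shows "\<exists>p. laurent_numerator a 0 p = Q \<and> (\<forall>m\<in>keys p. lookup m 2 \<le> 0)"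
proof -
  define \<mu> :: "nat \<Rightarrow> (2 \<Rightarrow>\<^sub>0 nat)" where "\<mu> i = Poly_Mapping.single 1 i" for i
  have \<mu>1: "lookup (\<mu> i) 1 = i" and \<mu>2: "lookup (\<mu> i) 2 = 0" for i
    by (simp_all add: \<mu>_def lookup_single)
  have inj: "inj \<mu>" by (rule injI) (metis \<mu>1)
  define p where "p = (\<Sum>i\<le>degree Q. Poly_Mapping.single (\<mu> i) (coeff Q i / a ^ i))"
  have lookup: "lookup p m = (\<Sum>i\<le>degree Q. if \<mu> i = m then coeff Q i / a ^ i else 0)" for m
    by (simp add: p_def lookup_sum lookup_single when_def)
  have lookup_\<mu>: "lookup p (\<mu> i) = coeff Q i / a ^ i" if "i \<le> degree Q" for i
    unfolding lookup using that inj by (simp add: inj_eq)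
  have keys: "keys p \<subseteq> \<mu> ` {..degree Q}"
  proof
    fix m assume "m \<in> keys p"
    then have "lookup p m \<noteq> 0" by (simp add: in_keys_iff)
    moreover have "lookup p m = 0" if "m \<notin> \<mu> ` {..degree Q}"
      unfolding lookup using that by (intro sum.neutral) auto
    ultimately show "m \<in> \<mu> ` {..degree Q}" by blast
  qed
  have "laurent_numerator a 0 p = (\<Sum>m\<in>\<mu> ` {..degree Q}.
     monom (lookup p m * a ^ (lookup m 1 + lookup m 2))
       (0 + lookup m 1 - lookup m 2))"
    unfolding laurent_numerator_def
  proof (rule sum.mono_neutral_left[OF _ keys])
    have "lookup p m = 0" if "m \<notin> keys p" for m
      using that by (simp only: in_keys_iff not_not)
    then show "\<forall>m\<in>\<mu> ` {..degree Q} - keys p.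
      monom (lookup p m * a ^ (lookup m 1 + lookup m 2))
       (0 + lookup m 1 - lookup m 2) = 0"
      by simp
  qed simp
  also have "\<dots> = (\<Sum>i\<le>degree Q. monom (coeff Q i) i)"
    unfolding sum.reindex[OF inj_on_subset[OF inj subset_UNIV]] o_def \<mu>1 \<mu>2
  proof (rule sum.cong[OF refl])
    fix i assume "i \<in> {..degree Q}"
    then show "monom (lookup p (\<mu> i) * a ^ (i + 0)) (0 + i - 0) = monom (coeff Q i) i"
      using assms by (simp add: lookup_\<mu>)
  qed
  also have "\<dots> = Q" by (rule poly_as_sum_of_monoms)
  finally have "laurent_numerator a 0 p = Q" .
  moreover have "\<forall>m\<in>keys p. lookup m 2 \<le> 0"
  proof
    fix m assume "m \<in> keys p"
    then obtain i where "m = \<mu> i" using keys by blast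
    then show "lookup m 2 \<le> 0" by (simp only: \<mu>2)
  qed
  ultimately show ?thesis by blast
qed

context poly_form
begin

text \<open>For a form on which multiplication by z scales norms by R, the value at (alpha + beta z)
  Q depends only on |alpha|^2 + |beta|^2 R^2 and alpha * cnj beta. Both are invariant under the
  swap, which expresses that a Blaschke factor is unimodular on the circle of radius R.\<close>

lemma E_linear_factor_swap:
  assumes iso: "\<And>p q. B (monom 1 1 * p) (monom 1 1 * q) = of_real (R\<^sup>2) * B p q" and "R * r = 1"
  shows "E ([:- d, c * of_real r:] * Q) = E ([:cnj c, - cnj d * of_real r:] * Q)"
proof -
  have lin: "E ([:\<alpha>, \<beta>:] * Q) = ((cmod \<alpha>)\<^sup>2 + (cmod \<beta>)\<^sup>2 * R\<^sup>2) * E Q + 2 * Re (\<alpha> * cnj \<beta> * B Q (monom 1 1 * Q))" for \<alpha> \<beta>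
  proof -
    have "[:\<alpha>, \<beta>:] * Q = smult \<alpha> Q + smult \<beta> (monom 1 1 * Q)"
      by (simp add: monom_altdef)
    moreover have "E (monom 1 1 * Q) = R\<^sup>2 * E Q"
    proof -
      have "B (monom 1 1 * Q) (monom 1 1 * Q) = of_real (R\<^sup>2 * E Q)"
        using iso[of Q Q] by (simp only: B_self[of Q] of_real_mult)
      then show ?thesis by (simp only: E_def[of "monom 1 1 * Q"] Re_complex_of_real)
    qed
    ultimately show ?thesis
      by (simp add: E_add E_smult smult_left smult_right algebra_simps)
  qed
  have "r * (r * (R * R)) = 1" using assms(2) by (metis mult.assoc mult.commute mult_1)
  then have R: "(cmod (x * of_real r))\<^sup>2 * R\<^sup>2 = (cmod x)\<^sup>2" for x
    by (simp add: norm_mult power_mult_distrib) (simp add: power2_eq_square mult_ac)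
  have "(cmod (- cnj d * of_real r))\<^sup>2 * R\<^sup>2 = (cmod d)\<^sup>2" using R[of "- cnj d"] by simp
  then show ?thesis
    unfolding lin R by (simp add: algebra_simps)
qed

end

context complex_hilbert_space
begin

text \<open>An eigenvector in degree zero is a cocycle, and it is no coboundary because every
  coboundary vanishes in degree zero.\<close>

lemma joint_eigenvalue_in_taylor_spectrum:
  fixes T :: "('a \<Rightarrow> 'a) ^ 2"
  assumes T: "\<And>i. bounded_op H (T $ i)" and x: "x \<in> C" "x \<noteq> \<zero>"
    and eigen: "\<And>i. (T $ i) x = z $ i \<bullet>\<^sub>H x"
  shows "z \<in> taylor_spectrum H T"
proof -
  define D where "D = (\<chi> i. (\<lambda>x. (T $ i) x \<boxminus> (z $ i) \<bullet>\<^sub>H x))"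
  have bD: "bounded_op H (D $ i)" for i
  proof -
    interpret hilbert_operator H "T $ i" by unfold_locales (rule T)
    show ?thesis
      by (rule bounded_op_cong[OF pa_bounded[of "[:- (z $ i), 1:]"]])
        (simp add: D_def pa_pCons minus_eq_scale scale_scale op_scale M.a_comm)
  qed
  obtain s :: complex where
    d: "\<forall>\<omega>\<in>koszul_space H. koszul_diff H D \<omega> {} = \<zero> \<and>
      koszul_diff H D \<omega> {1} = (D $ 1) (\<omega> {}) \<and>
      koszul_diff H D \<omega> {2} = (D $ 2) (\<omega> {}) \<and>
      koszul_diff H D \<omega> UNIV = s \<bullet>\<^sub>H ((D $ 1) (\<omega> {2}) \<boxminus> (D $ 2) (\<omega> {1}))"
    using koszul_diff_two[OF bD bD] by blast
  define \<omega> where "\<omega> S = (if S = {} then x else \<zero>)" for S :: "2 set"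
  have \<omega>: "\<omega> \<in> koszul_space H" using x by (auto simp: koszul_space_def \<omega>_def)
  have Dx: "(D $ i) x = \<zero>" for i
    using x by (simp add: D_def eigen minus_eq_zero_iff)
  have "koszul_diff H D \<omega> S = \<zero>" for S
    using two_set_cases[of S] bspec[OF d \<omega>]
    by (auto simp: \<omega>_def Dx bounded_op_zero[OF bD] minus_eq_zero_iff[THEN iffD2, OF _ _ refl])
  moreover have "\<omega> \<notin> koszul_diff H D ` koszul_space H"
  proof
    assume "\<omega> \<in> koszul_diff H D ` koszul_space H"
    then obtain \<eta> where "\<eta> \<in> koszul_space H" "\<omega> = koszul_diff H D \<eta>" by blast
    then have "\<omega> {} = \<zero>" using d by simp
    then show False using x by (simp add: \<omega>_def)
  qed
  ultimately have "\<not> koszul_exact H D" using \<omega> unfolding koszul_exact_def by blast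
  then show ?thesis by (simp add: taylor_spectrum_def D_def)
qed

section \<open>Norm bounds in the two classes\<close>

lemma positive_op_PA_iff:
  assumes T: "invertible_op H T"
  shows "positive_op H (\<lambda>x. complex_of_real \<kappa> \<bullet>\<^sub>H x \<boxminus> op_adj H T (T x) \<boxminus> op_adj H (op_inv H T) (op_inv H T x))
    \<longleftrightarrow> (\<forall>x\<in>C. (nrm (T x))\<^sup>2 + (nrm (op_inv H T x))\<^sup>2 \<le> \<kappa> * (nrm x)\<^sup>2)"
proof -
  note i = op_inv[OF T]
  have *: "ip (op_adj H A (A x)) x = of_real ((nrm (A x))\<^sup>2)" if A: "bounded_op H A" and x: "x \<in> C" for A x
  proof -
    have Ax: "A x \<in> C" using bounded_opD(1)[OF A x] .
    have "ip (op_adj H A (A x)) x = cnj (ip x (op_adj H A (A x)))"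
      by (rule cinner_commute[OF x op_adj(1)[OF A Ax]])
    also have "\<dots> = cnj (ip (A x) (A x))" by (simp add: op_adj(2)[OF A Ax x])
    finally show ?thesis by (simp add: ip_self[OF Ax])
  qed
  have "ip (complex_of_real \<kappa> \<bullet>\<^sub>H x \<boxminus> op_adj H T (T x) \<boxminus> op_adj H (op_inv H T) (op_inv H T x)) x
      = of_real (\<kappa> * (nrm x)\<^sup>2 - (nrm (T x))\<^sup>2 - (nrm (op_inv H T x))\<^sup>2)" if x: "x \<in> C" for x
    using x op_adj(1)[OF i(1) bounded_opD(1)[OF i(1) x]] op_adj(1)[OF i(2) bounded_opD(1)[OF i(2) x]]
    by (simp add: ip_minus_left cinner_smult_left *[OF i(1)] *[OF i(2)] ip_self)
  then show ?thesis
    unfolding positive_op_def by (auto simp: nonneg_Reals_of_real_iff simp del: of_real_diff of_real_mult of_real_power)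
qed

text \<open>With t the norm of A, AB = 1 gives |Bx| >= |x| / t. Inserted into the hypothesis this
  yields t^2 + 1/t^2 <= r^2 + 1/r^2, that is (t^2 - r^2)(t^2 - 1/r^2) <= 0. The roles of A and B
  stay open so that the bound applies to T and to its inverse.\<close>

lemma PA_op_norm_le:
  assumes r: "0 < r" "r < 1" and A: "bounded_op H A" and B: "bounded_op H B"
    and AB: "\<And>x. x \<in> C \<Longrightarrow> A (B x) = x"
    and bound: "\<And>x. x \<in> C \<Longrightarrow> (nrm (A x))\<^sup>2 + (nrm (B x))\<^sup>2 \<le> (r\<^sup>2 + 1 / r\<^sup>2) * (nrm x)\<^sup>2"
  shows "op_norm H A \<le> 1 / r"
proof (cases "op_norm H A \<le> 0")
  case True
  moreover have "0 < 1 / r" using r by simp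
  ultimately show ?thesis by linarith
next
  case False
  define t where "t = op_norm H A"
  define \<kappa> where "\<kappa> = r\<^sup>2 + 1 / r\<^sup>2"
  have t: "0 < t" using False by (simp add: t_def)
  \<comment> \<open>The sign of the difference is not known yet, hence the \<open>max\<close>; it
    turns out positive because t is.\<close>
  define s where "s = max 0 (\<kappa> - 1 / t\<^sup>2)"
  have "t \<le> sqrt s"
    unfolding t_def
  proof (rule op_norm_le)
    fix x assume x: "x \<in> C" "nrm x \<le> 1"
    have "nrm x \<le> t * nrm (B x)"
      using nrm_le_op_norm[OF A bounded_opD(1)[OF B x(1)]] AB[OF x(1)] by (simp add: t_def)
    then have "(nrm x)\<^sup>2 \<le> (t * nrm (B x))\<^sup>2" using x by (intro power_mono) auto
    then have "(nrm x)\<^sup>2 / t\<^sup>2 \<le> (nrm (B x))\<^sup>2" using t by (simp add: divide_le_eq power_mult_distrib mult.commute)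
    then have "(nrm (A x))\<^sup>2 \<le> (\<kappa> - 1 / t\<^sup>2) * (nrm x)\<^sup>2"
      using bound[OF x(1)] by (simp add: \<kappa>_def algebra_simps)
    also have "\<dots> \<le> s * (nrm x)\<^sup>2" by (intro mult_right_mono) (auto simp: s_def)
    also have "\<dots> \<le> s * 1" using x by (intro mult_left_mono) (auto simp: s_def power_le_one)
    finally show "nrm (A x) \<le> sqrt s" using x by (simp add: real_le_rsqrt)
  qed
  moreover from this have "0 < sqrt s" using t by linarith
  then have "0 < s" by simp
  then have s: "s = \<kappa> - 1 / t\<^sup>2" by (auto simp: s_def max_def split: if_splits)
  ultimately have "t\<^sup>2 \<le> (sqrt s)\<^sup>2" using t by (intro power_mono) auto
  then have "t\<^sup>2 \<le> \<kappa> - 1 / t\<^sup>2" using s \<open>0 < s\<close> by simp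
  then have "t\<^sup>2 * t\<^sup>2 \<le> (\<kappa> - 1 / t\<^sup>2) * t\<^sup>2" by (rule mult_right_mono) simp
  then have le: "(t\<^sup>2 - r\<^sup>2) * (t\<^sup>2 - 1 / r\<^sup>2) \<le> 0"
    using t r by (simp add: \<kappa>_def algebra_simps)
  show ?thesis
  proof (rule ccontr)
    assume "\<not> op_norm H A \<le> 1 / r"
    then have "1 / r < t" by (simp add: t_def)
    then have 1: "(1 / r)\<^sup>2 < t\<^sup>2" using r by (intro power_strict_mono) auto
    have "r < 1 / r" using r mult_strict_mono[of r 1 r 1] by (simp add: less_divide_eq)
    then have "r\<^sup>2 < (1 / r)\<^sup>2" using r by (intro power_strict_mono) auto
    then have "0 < (t\<^sup>2 - r\<^sup>2) * (t\<^sup>2 - 1 / r\<^sup>2)"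
      using 1 by (intro mult_pos_pos) (auto simp: power_divide)
    then show False using le by simp
  qed
qed

end

lemma PA_class_iff:
  "(H, T) \<in> PA_class r \<longleftrightarrow> complex_hilbert_space H \<and> invertible_op H T \<and>
    (\<forall>x\<in>carrier H. (hnorm H (T x))\<^sup>2 + (hnorm H (op_inv H T x))\<^sup>2 \<le> (r\<^sup>2 + 1 / r\<^sup>2) * (hnorm H x)\<^sup>2)"
proof (cases "complex_hilbert_space H \<and> invertible_op H T")
  case True
  then interpret complex_hilbert_space H by simp
  from True show ?thesis using positive_op_PA_iff[of T "r\<^sup>2 + 1 / r\<^sup>2"] by (simp add: PA_class_def)
qed (auto simp: PA_class_def)

lemma PA_class_subset_QA_class:
  assumes "0 < r" "r < 1"
  shows "PA_class r \<subseteq> QA_class r"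
proof
  fix HT :: "'a chilbert \<times> ('a \<Rightarrow> 'a)" assume "HT \<in> PA_class r"
  then obtain H T where HT: "HT = (H, T)" "(H, T) \<in> PA_class r" by (cases HT) simp
  then interpret complex_hilbert_space H by (simp add: PA_class_iff)
  have T: "invertible_op H T" and bound: "\<forall>x\<in>C. (nrm (T x))\<^sup>2 + (nrm (op_inv H T x))\<^sup>2 \<le> (r\<^sup>2 + 1 / r\<^sup>2) * (nrm x)\<^sup>2"
    using HT(2) by (auto simp: PA_class_iff)
  note i = op_inv[OF T]
  have "op_norm H T \<le> 1 / r" "op_norm H (op_inv H T) \<le> 1 / r"
    using bound by (intro PA_op_norm_le[OF assms] i; auto simp: add.commute)+
  then show "HT \<in> QA_class r"
    using T complex_hilbert_space_axioms by (simp add: QA_class_def HT(1))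
qed

lemma QA_class_von_neumann_set:
  assumes "0 < r" and "(H, T) \<in> QA_class r"
  shows "von_neumann_set (kappa0 r ` (cball 0 (1 / r) - {0})) H (kappa0_op r H T)"
proof -
  interpret complex_hilbert_space H using assms(2) by (simp add: QA_class_def)
  have T: "invertible_op H T" "op_norm H T \<le> 1 / r" using assms(2) by (auto simp: QA_class_def)
  show ?thesis
  proof (rule von_neumann_set_kappa0_op[OF T(1) assms(1)])
    fix x assume x: "x \<in> C"
    have "nrm (T x) \<le> op_norm H T * nrm x" by (rule nrm_le_op_norm[OF op_inv(1)[OF T(1)] x])
    also have "\<dots> \<le> 1 / r * nrm x" using T(2) x by (intro mult_right_mono) auto
    finally show "nrm (T x) \<le> 1 / r * nrm x" .
  qed
qed

section \<open>Square-summable sequences\<close>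

definition ell2 :: "('i \<Rightarrow> complex) set" where
  "ell2 = {s. (\<lambda>n. (cmod (s n))\<^sup>2) summable_on UNIV}"

text \<open>The weights are a parameter because the same sequences are measured twice: by the norm
  of the model space, with all weights 1, and by the norm in which a multiple of the shift is
  isometric.\<close>

definition weighted_ip :: "('i \<Rightarrow> real) \<Rightarrow> ('i \<Rightarrow> complex) \<Rightarrow> ('i \<Rightarrow> complex) \<Rightarrow> complex" where
  "weighted_ip \<rho> s t = infsum (\<lambda>n. of_real (\<rho> n) * (s n * cnj (t n))) UNIV"

text \<open>The carrier has to live in the given type, so sequences are stored through an injection
  e and every operation decodes, computes and encodes again.\<close>

definition ell2_space :: "(('i \<Rightarrow> complex) \<Rightarrow> 'a) \<Rightarrow> 'a chilbert" where
  "ell2_space e = \<lparr>carrier = e ` ell2, mult = (\<lambda>x y. x), one = e (\<lambda>_. 0), zero = e (\<lambda>_. 0),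
     add = (\<lambda>x y. e (\<lambda>n. inv_into UNIV e x n + inv_into UNIV e y n)), module.smult = (\<lambda>c x. e (\<lambda>n. c * inv_into UNIV e x n)),
     cinner = (\<lambda>x y. weighted_ip (\<lambda>_. 1) (inv_into UNIV e x) (inv_into UNIV e y))\<rparr>"

lemma ell2_add: "s \<in> ell2 \<Longrightarrow> t \<in> ell2 \<Longrightarrow> (\<lambda>n. s n + t n) \<in> ell2"
proof -
  assume "s \<in> ell2" "t \<in> ell2"
  then have "(\<lambda>n. 2 * (cmod (s n))\<^sup>2 + 2 * (cmod (t n))\<^sup>2) summable_on UNIV"
    by (intro summable_on_add summable_on_cmult_right) (auto simp: ell2_def)
  then have "(\<lambda>n. (cmod (s n + t n))\<^sup>2) summable_on UNIV"
  proof (rule summable_on_comparison_test)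
    fix n
    have "(cmod (s n + t n))\<^sup>2 \<le> (cmod (s n) + cmod (t n))\<^sup>2"
      by (intro power_mono norm_triangle_ineq) auto
    also have "\<dots> \<le> 2 * (cmod (s n))\<^sup>2 + 2 * (cmod (t n))\<^sup>2"
      using zero_le_power2[of "cmod (s n) - cmod (t n)"] by (simp add: power2_eq_square algebra_simps)
    finally show "(cmod (s n + t n))\<^sup>2 \<le> 2 * (cmod (s n))\<^sup>2 + 2 * (cmod (t n))\<^sup>2" .
  qed auto
  then show ?thesis by (simp add: ell2_def)
qed

lemma ell2_mult_bounded:
  assumes "s \<in> ell2" and "\<And>n. cmod (c n) \<le> K"
  shows "(\<lambda>n. c n * s n) \<in> ell2"
proof -
  have "(\<lambda>n. K\<^sup>2 * (cmod (s n))\<^sup>2) summable_on UNIV"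
    using assms(1) by (intro summable_on_cmult_right) (auto simp: ell2_def)
  then have "(\<lambda>n. (cmod (c n * s n))\<^sup>2) summable_on UNIV"
  proof (rule summable_on_comparison_test)
    fix n
    show "(cmod (c n * s n))\<^sup>2 \<le> K\<^sup>2 * (cmod (s n))\<^sup>2"
      unfolding norm_mult power_mult_distrib using assms(2) by (intro mult_right_mono power_mono) auto
  qed auto
  then show ?thesis by (simp add: ell2_def)
qed

lemma ell2_scale: "s \<in> ell2 \<Longrightarrow> (\<lambda>n. c * s n) \<in> ell2"
  by (rule ell2_mult_bounded[where K = "cmod c"]) auto

lemma ell2_zero: "(\<lambda>_. 0) \<in> ell2"
  by (simp add: ell2_def)

lemma ell2_minus: "s \<in> ell2 \<Longrightarrow> t \<in> ell2 \<Longrightarrow> (\<lambda>n. s n - t n) \<in> ell2"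
  using ell2_add[of s "\<lambda>n. -1 * t n"] ell2_scale[of t "-1"] by simp

lemma bij_shift: "bij_betw (\<lambda>n. n + k) UNIV (UNIV :: int set)"
  by (rule bij_betwI[where g = "\<lambda>n. n - k"]) auto

lemma ell2_shift: "s \<in> ell2 \<Longrightarrow> (\<lambda>n :: int. s (n + k)) \<in> ell2"
  using summable_on_reindex_bij_betw[OF bij_shift, of "\<lambda>n. (cmod (s n))\<^sup>2" k] by (simp add: ell2_def)

lemma weighted_ip_summable:
  assumes "s \<in> ell2" "t \<in> ell2" and "\<And>n. \<bar>\<rho> n\<bar> \<le> 1"
  shows "(\<lambda>n. of_real (\<rho> n) * (s n * cnj (t n))) summable_on UNIV"
proof -
  have "(\<lambda>n. (cmod (s n))\<^sup>2 + (cmod (t n))\<^sup>2) summable_on UNIV"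
    using assms by (intro summable_on_add) (auto simp: ell2_def)
  then have "(\<lambda>n. cmod (of_real (\<rho> n) * (s n * cnj (t n)))) summable_on UNIV"
  proof (rule summable_on_comparison_test)
    fix n
    have "cmod (of_real (\<rho> n) * (s n * cnj (t n))) \<le> 1 * (cmod (s n) * cmod (t n))"
      unfolding norm_mult norm_of_real complex_mod_cnj by (intro mult_right_mono assms) auto
    also have "\<dots> \<le> (cmod (s n))\<^sup>2 + (cmod (t n))\<^sup>2"
    proof -
      have "0 \<le> cmod (s n) * cmod (t n)" by simp
      moreover have "0 \<le> (cmod (s n) - cmod (t n))\<^sup>2" by simp
      ultimately show ?thesis unfolding power2_diff by linarith
    qed
    finally show "cmod (of_real (\<rho> n) * (s n * cnj (t n))) \<le> (cmod (s n))\<^sup>2 + (cmod (t n))\<^sup>2" .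
  qed auto
  then show ?thesis by (rule abs_summable_summable)
qed

lemma weighted_ip_add_left:
  assumes "s \<in> ell2" "s' \<in> ell2" "t \<in> ell2" and "\<And>n. \<bar>\<rho> n\<bar> \<le> 1"
  shows "weighted_ip \<rho> (\<lambda>n. s n + s' n) t = weighted_ip \<rho> s t + weighted_ip \<rho> s' t"
  unfolding weighted_ip_def
proof -
  have "infsum (\<lambda>n. of_real (\<rho> n) * ((s n + s' n) * cnj (t n))) UNIV
    = infsum (\<lambda>n. of_real (\<rho> n) * (s n * cnj (t n)) + of_real (\<rho> n) * (s' n * cnj (t n))) UNIV"
    by (simp add: algebra_simps)
  also have "\<dots> = infsum (\<lambda>n. of_real (\<rho> n) * (s n * cnj (t n))) UNIV + infsum (\<lambda>n. of_real (\<rho> n) * (s' n * cnj (t n))) UNIV"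
    by (intro infsum_add weighted_ip_summable assms)
  finally show "infsum (\<lambda>n. of_real (\<rho> n) * ((s n + s' n) * cnj (t n))) UNIV
    = infsum (\<lambda>n. of_real (\<rho> n) * (s n * cnj (t n))) UNIV + infsum (\<lambda>n. of_real (\<rho> n) * (s' n * cnj (t n))) UNIV" .
qed

lemma weighted_ip_scale_left: "weighted_ip \<rho> (\<lambda>n. c * s n) t = c * weighted_ip \<rho> s t"
  unfolding weighted_ip_def infsum_cmult_right'[symmetric] by (simp add: mult_ac)

lemma weighted_ip_commute: "weighted_ip \<rho> t s = cnj (weighted_ip \<rho> s t)"
  unfolding weighted_ip_def infsum_cnj[symmetric] by (simp add: mult_ac)

lemma weighted_ip_self:
  assumes "s \<in> ell2" and "\<And>n. \<bar>\<rho> n\<bar> \<le> 1"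
  shows "(\<lambda>n. \<rho> n * (cmod (s n))\<^sup>2) summable_on UNIV"
    and "weighted_ip \<rho> s s = of_real (infsum (\<lambda>n. \<rho> n * (cmod (s n))\<^sup>2) UNIV)"
proof -
  have *: "of_real (\<rho> n) * (s n * cnj (s n)) = complex_of_real (\<rho> n * (cmod (s n))\<^sup>2)" for n
    by (simp add: complex_norm_square del: of_real_power)
  have S: "(\<lambda>n. complex_of_real (\<rho> n * (cmod (s n))\<^sup>2)) summable_on UNIV"
    using weighted_ip_summable[OF assms(1) assms(1), where \<rho> = \<rho>] assms(2) unfolding * .
  show "(\<lambda>n. \<rho> n * (cmod (s n))\<^sup>2) summable_on UNIV"
    using summable_on_Re[OF S] by (simp only: Re_complex_of_real)
  have "Re (weighted_ip \<rho> s s) = infsum (\<lambda>n. \<rho> n * (cmod (s n))\<^sup>2) UNIV"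
    unfolding weighted_ip_def * infsum_Re[OF S, symmetric] by (simp only: Re_complex_of_real)
  moreover have "Im (weighted_ip \<rho> s s) = 0"
    unfolding weighted_ip_def * infsum_Im[OF S, symmetric] by (simp only: Im_complex_of_real infsum_0_simp)
  ultimately show "weighted_ip \<rho> s s = of_real (infsum (\<lambda>n. \<rho> n * (cmod (s n))\<^sup>2) UNIV)"
    by (simp add: complex_eq_iff)
qed

definition ell2_norm :: "('i \<Rightarrow> complex) \<Rightarrow> real" where
  "ell2_norm s = sqrt (infsum (\<lambda>n. (cmod (s n))\<^sup>2) UNIV)"

lemma cmod_le_ell2_norm:
  assumes "s \<in> ell2"
  shows "cmod (s i) \<le> ell2_norm s"
proof -
  have "(\<Sum>n\<in>{i}. (cmod (s n))\<^sup>2) \<le> infsum (\<lambda>n. (cmod (s n))\<^sup>2) UNIV"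
    using assms by (intro finite_sum_le_infsum) (auto simp: ell2_def)
  then show ?thesis by (simp add: ell2_norm_def real_le_rsqrt)
qed

text \<open>Limits are taken coordinatewise. Finite partial sums of the squared differences keep
  their uniform bound in the limit, which gives both membership of the limit and convergence in
  norm.\<close>

lemma ell2_complete:
  assumes u: "\<And>n :: nat. u n \<in> ell2"
    and cauchy: "\<And>\<epsilon> :: real. 0 < \<epsilon> \<Longrightarrow> \<exists>N. \<forall>m\<ge>N. \<forall>n\<ge>N. ell2_norm (\<lambda>i. u m i - u n i) < \<epsilon>"
  shows "\<exists>l\<in>ell2. (\<lambda>n. ell2_norm (\<lambda>i. u n i - l i)) \<longlonglongrightarrow> 0"
proof -
  have "Cauchy (\<lambda>m. u m i)" for i
  proof (rule metric_CauchyI)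
    fix \<epsilon> :: real assume "0 < \<epsilon>"
    then obtain N where N: "\<forall>m\<ge>N. \<forall>n\<ge>N. ell2_norm (\<lambda>i. u m i - u n i) < \<epsilon>" using cauchy by blast
    have "dist (u m i) (u n i) < \<epsilon>" if "m \<ge> N" "n \<ge> N" for m n
    proof -
      have "cmod (u m i - u n i) \<le> ell2_norm (\<lambda>i. u m i - u n i)"
        by (rule cmod_le_ell2_norm[OF ell2_minus[OF u u]])
      also have "\<dots> < \<epsilon>" using N that by blast
      finally show ?thesis by (simp add: dist_norm)
    qed
    then show "\<exists>N. \<forall>m\<ge>N. \<forall>n\<ge>N. dist (u m i) (u n i) < \<epsilon>" by blast
  qed
  then have "(\<lambda>m. u m i) \<longlonglongrightarrow> lim (\<lambda>m. u m i)" for i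
    by (simp add: Cauchy_convergent_iff convergent_LIMSEQ_iff)
  then obtain l where l: "\<And>i. (\<lambda>m. u m i) \<longlonglongrightarrow> l i"
    by (rule that)
  have step: "\<exists>N. \<forall>m\<ge>N. (\<lambda>i. u m i - l i) \<in> ell2 \<and> ell2_norm (\<lambda>i. u m i - l i) \<le> \<epsilon>" if \<epsilon>: "0 < \<epsilon>" for \<epsilon>
  proof -
    obtain N where N: "\<forall>m\<ge>N. \<forall>n\<ge>N. ell2_norm (\<lambda>i. u m i - u n i) < \<epsilon>" using cauchy \<epsilon> by blast
    have "(\<lambda>i. u m i - l i) \<in> ell2 \<and> ell2_norm (\<lambda>i. u m i - l i) \<le> \<epsilon>" if m: "m \<ge> N" for m
    proof -
      have fin: "(\<Sum>i\<in>F. (cmod (u m i - l i))\<^sup>2) \<le> \<epsilon>\<^sup>2" if F: "finite F" for F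
      proof (rule LIMSEQ_le_const2)
        show "(\<lambda>n. \<Sum>i\<in>F. (cmod (u m i - u n i))\<^sup>2) \<longlonglongrightarrow> (\<Sum>i\<in>F. (cmod (u m i - l i))\<^sup>2)"
          by (intro tendsto_intros l)
        have "(\<Sum>i\<in>F. (cmod (u m i - u n i))\<^sup>2) \<le> \<epsilon>\<^sup>2" if "n \<ge> N" for n
        proof -
          have "(\<Sum>i\<in>F. (cmod (u m i - u n i))\<^sup>2) \<le> infsum (\<lambda>i. (cmod (u m i - u n i))\<^sup>2) UNIV"
            using ell2_minus[OF u u, of m n] F by (intro finite_sum_le_infsum) (auto simp: ell2_def)
          also have "\<dots> = (ell2_norm (\<lambda>i. u m i - u n i))\<^sup>2"
            by (simp add: ell2_norm_def infsum_nonneg)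
          also have "\<dots> \<le> \<epsilon>\<^sup>2"
            using N m that by (intro power_mono) (auto simp: less_imp_le ell2_norm_def infsum_nonneg)
          finally show ?thesis .
        qed
        then show "\<exists>N. \<forall>n\<ge>N. (\<Sum>i\<in>F. (cmod (u m i - u n i))\<^sup>2) \<le> \<epsilon>\<^sup>2" by blast
      qed
      then have sm: "(\<lambda>i. (cmod (u m i - l i))\<^sup>2) summable_on UNIV"
        by (intro nonneg_bdd_above_summable_on bdd_aboveI2[where M = "\<epsilon>\<^sup>2"]) auto
      have "infsum (\<lambda>i. (cmod (u m i - l i))\<^sup>2) UNIV \<le> \<epsilon>\<^sup>2"
        using fin by (intro infsum_le_finite_sums sm) auto
      then show ?thesis using sm \<epsilon> by (simp add: ell2_def ell2_norm_def real_le_lsqrt)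
    qed
    then show ?thesis by blast
  qed
  have "l \<in> ell2"
  proof -
    obtain m where "(\<lambda>i. u m i - l i) \<in> ell2" using step[of 1] by auto
    from ell2_minus[OF u this, of m] show ?thesis by simp
  qed
  moreover have "(\<lambda>n. ell2_norm (\<lambda>i. u n i - l i)) \<longlonglongrightarrow> 0"
  proof (rule LIMSEQ_I)
    fix \<epsilon> :: real assume "0 < \<epsilon>"
    then obtain N where N: "\<forall>m\<ge>N. ell2_norm (\<lambda>i. u m i - l i) \<le> \<epsilon> / 2" using step[of "\<epsilon> / 2"] by auto
    have "norm (ell2_norm (\<lambda>i. u n i - l i) - 0) < \<epsilon>" if "N \<le> n" for n
    proof -
      have "0 \<le> ell2_norm (\<lambda>i. u n i - l i)" by (simp add: ell2_norm_def infsum_nonneg)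
      then show ?thesis using N that \<open>0 < \<epsilon>\<close> by fastforce
    qed
    then show "\<exists>no. \<forall>n\<ge>no. norm (ell2_norm (\<lambda>i. u n i - l i) - 0) < \<epsilon>" by blast
  qed
  ultimately show ?thesis by blast
qed

section \<open>The Hilbert space of square-summable sequences\<close>

lemma ell2_space_simps [simp]:
  assumes "inj e"
  shows "carrier (ell2_space e) = e ` ell2"
    and "e s \<oplus>\<^bsub>ell2_space e\<^esub> e t = e (\<lambda>n. s n + t n)"
    and "c \<odot>\<^bsub>ell2_space e\<^esub> e s = e (\<lambda>n. c * s n)"
    and "\<zero>\<^bsub>ell2_space e\<^esub> = e (\<lambda>_. 0)"
    and "cinner (ell2_space e) (e s) (e t) = weighted_ip (\<lambda>_. 1) s t"
  by (simp_all add: ell2_space_def assms)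

lemma ell2_hnorm:
  assumes "inj e" and "s \<in> ell2"
  shows "hnorm (ell2_space e) (e s) = ell2_norm s"
  by (simp add: hnorm_def assms weighted_ip_self ell2_norm_def)

lemma ell2_module:
  assumes e: "inj e"
  shows "module ring_of_type_algebra (ell2_space e)"
proof (rule moduleI)
  note [simp] = ell2_space_simps[OF e]
  show "cring (ring_of_type_algebra :: complex ring)" by (rule cring_from_type_algebra)
  show "abelian_group (ell2_space e)"
  proof (rule abelian_groupI)
    fix x assume "x \<in> carrier (ell2_space e)"
    then obtain s where s: "x = e s" "s \<in> ell2" by auto
    have "e (\<lambda>n. -1 * s n) \<in> carrier (ell2_space e)" using ell2_scale[OF s(2), of "-1"] by simp
    moreover have "e (\<lambda>n. -1 * s n) \<oplus>\<^bsub>ell2_space e\<^esub> x = \<zero>\<^bsub>ell2_space e\<^esub>" by (simp add: s)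
    ultimately show "\<exists>y\<in>carrier (ell2_space e). y \<oplus>\<^bsub>ell2_space e\<^esub> x = \<zero>\<^bsub>ell2_space e\<^esub>" by blast
  qed (auto simp: ell2_add ell2_zero add_ac)
qed (auto simp: ell2_space_simps[OF e] ell2_scale algebra_simps)

lemma ell2_complex_hilbert_space:
  fixes e :: "('i \<Rightarrow> complex) \<Rightarrow> 'a"
  assumes e: "inj e"
  shows "complex_hilbert_space (ell2_space e)"
proof -
  note [simp] = ell2_space_simps[OF e]
  interpret module ring_of_type_algebra "ell2_space e" by (rule ell2_module[OF e])
  have minus: "e s \<ominus>\<^bsub>ell2_space e\<^esub> e t = e (\<lambda>n. s n - t n)" if "s \<in> ell2" "t \<in> ell2" for s t
  proof -
    have "\<ominus>\<^bsub>ell2_space e\<^esub> e t = e (\<lambda>n. -1 * t n)"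
      using that ell2_scale[OF that(2), of "-1"] by (intro M.minus_equality) auto
    then show ?thesis by (simp add: a_minus_def)
  qed
  show ?thesis
  proof
    fix x assume x: "x \<in> carrier (ell2_space e)" "x \<noteq> \<zero>\<^bsub>ell2_space e\<^esub>"
    then obtain s where s: "x = e s" "s \<in> ell2" by auto
    have "\<exists>i. s i \<noteq> 0"
    proof (rule ccontr)
      assume "\<nexists>i. s i \<noteq> 0"
      then have "s = (\<lambda>_. 0)" by auto
      then show False using x(2) s(1) by simp
    qed
    then obtain i where "s i \<noteq> 0" by blast
    have "0 < ell2_norm s" using cmod_le_ell2_norm[OF s(2), of i] \<open>s i \<noteq> 0\<close>
      by (metis less_le_trans zero_less_norm_iff)
    then show "0 < Re (cinner (ell2_space e) x x)" by (simp add: s weighted_ip_self ell2_norm_def)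
  next
    fix u :: "nat \<Rightarrow> 'a"
    assume u: "\<And>n. u n \<in> carrier (ell2_space e)"
      and cauchy: "\<And>\<epsilon>. 0 < \<epsilon> \<Longrightarrow> \<exists>N. \<forall>m\<ge>N. \<forall>n\<ge>N. hnorm (ell2_space e) (u m \<ominus>\<^bsub>ell2_space e\<^esub> u n) < \<epsilon>"
    have "\<forall>n. \<exists>s\<in>ell2. u n = e s" using u by auto
    then obtain s where s: "\<And>n. s n \<in> ell2" "\<And>n. u n = e (s n)" by metis
    have "\<exists>l\<in>ell2. (\<lambda>n. ell2_norm (\<lambda>i. s n i - l i)) \<longlonglongrightarrow> 0"
      using cauchy by (intro ell2_complete s) (simp add: s minus ell2_minus ell2_hnorm[OF e])
    then obtain l where "l \<in> ell2" "(\<lambda>n. ell2_norm (\<lambda>i. s n i - l i)) \<longlonglongrightarrow> 0" by blast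
    then show "\<exists>l\<in>carrier (ell2_space e). (\<lambda>n. hnorm (ell2_space e) (u n \<ominus>\<^bsub>ell2_space e\<^esub> l)) \<longlonglongrightarrow> 0"
      by (intro bexI[of _ "e l"]) (simp_all add: s minus ell2_minus ell2_hnorm[OF e])
  qed (auto simp: weighted_ip_add_left weighted_ip_scale_left intro: weighted_ip_commute)
qed

text \<open>A sequence of complex numbers is coded by one set of naturals: each real or imaginary
  part is such a set, and pairing tags its elements with the index and with 0 or 1. Sets of naturals
  embed into the reals.\<close>

lemma ex_inj_int_functions_complex:
  "\<exists>e :: (int \<Rightarrow> complex) \<Rightarrow> complex. inj e"
proof -
  obtain k :: "real \<Rightarrow> nat set" where k: "inj k"
    using nat_sets_eqpoll_reals eqpoll_sym eqpoll_imp_lepoll unfolding lepoll_def by blast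
  obtain k' :: "nat set \<Rightarrow> real" where k': "inj k'"
    using nat_sets_eqpoll_reals eqpoll_imp_lepoll unfolding lepoll_def by blast
  define E where "E s = {prod_encode (int_encode n, prod_encode (0, j)) |n j. j \<in> k (Re (s n))} \<union>
    {prod_encode (int_encode n, prod_encode (1, j)) |n j. j \<in> k (Im (s n))}" for s :: "int \<Rightarrow> complex"
  have "inj E"
  proof (rule injI, rule ext)
    fix s t n assume E: "E s = E t"
    have inj: "int_encode a = int_encode b \<longleftrightarrow> a = b" for a b
      using inj_int_encode by (simp add: inj_eq)
    have "k (Re (u n)) = {j. prod_encode (int_encode n, prod_encode (0, j)) \<in> E u}"
      and "k (Im (u n)) = {j. prod_encode (int_encode n, prod_encode (1, j)) \<in> E u}" for u
      unfolding E_def by (auto simp: inj)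
    then have "k (Re (s n)) = k (Re (t n))" "k (Im (s n)) = k (Im (t n))" using E by auto
    then show "s n = t n" using k by (simp add: inj_eq complex_eq_iff)
  qed
  then have "inj (\<lambda>s. complex_of_real (k' (E s)))"
    using k' by (simp add: inj_def)
  then show ?thesis by blast
qed

section \<open>Adjoints and weighted shifts\<close>

context complex_hilbert_space
begin

lemma invertible_op_comp:
  assumes A: "invertible_op H A" and B: "invertible_op H B"
  shows "invertible_op H (\<lambda>x. A (B x))"
proof -
  note i = op_inv[OF A] and j = op_inv[OF B]
  have "bounded_op H (\<lambda>x. op_inv H B (op_inv H A x))" by (rule bounded_op_comp[OF j(2) i(2)])
  moreover have "op_inv H B (op_inv H A (A (B x))) = x \<and> A (B (op_inv H B (op_inv H A x))) = x" if "x \<in> C" for x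
    using that i j bounded_opD(1)[OF j(1)] bounded_opD(1)[OF i(2)] by simp
  ultimately show ?thesis
    using bounded_op_comp[OF i(1) j(1)] unfolding invertible_op_def by blast
qed

lemma invertible_op_cong:
  assumes A: "invertible_op H A" and eq: "\<And>x. x \<in> C \<Longrightarrow> B x = A x"
  shows "invertible_op H B"
proof -
  note i = op_inv[OF A]
  have "op_inv H A (B x) = x \<and> B (op_inv H A x) = x" if "x \<in> C" for x
    using that i eq bounded_opD(1)[OF i(2)] by simp
  then show ?thesis
    using bounded_op_cong[OF i(1) eq] i(2) unfolding invertible_op_def by blast
qed

lemma op_inv_eqI:
  assumes A: "invertible_op H A" and "x \<in> C" "A x = y"
  shows "op_inv H A y = x"
  using op_inv(4)[OF A assms(2)] assms(3) by simp

text \<open>States that P'(A') is the adjoint of P(A). As a relation it is closed under products, so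
  explicitly factored polynomials can be treated factor by factor.\<close>

definition adjoint_polys :: "('a \<Rightarrow> 'a) \<Rightarrow> ('a \<Rightarrow> 'a) \<Rightarrow> complex poly \<Rightarrow> complex poly \<Rightarrow> bool" where
  "adjoint_polys A A' P P' \<longleftrightarrow>
     (\<forall>x\<in>C. \<forall>y\<in>C. ip (poly_apply H A P x) y = ip x (poly_apply H A' P' y))"

lemma adjoint_polys_linear:
  assumes A: "bounded_op H A" and A': "bounded_op H A'"
    and adj: "\<And>x y. x \<in> C \<Longrightarrow> y \<in> C \<Longrightarrow> ip (A x) y = ip x (A' y)"
  shows "adjoint_polys A A' [:\<alpha>, \<beta>:] [:cnj \<alpha>, cnj \<beta>:]"
proof -
  interpret A: hilbert_operator H A by unfold_locales (rule A)
  interpret A': hilbert_operator H A' by unfold_locales (rule A')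
  show ?thesis
    by (simp add: adjoint_polys_def A.pa_pCons A'.pa_pCons ip_simps adj A.op_scale A'.op_scale)
qed

lemma adjoint_polys_mult:
  assumes A: "bounded_op H A" and A': "bounded_op H A'"
    and "adjoint_polys A A' P P'" "adjoint_polys A A' Q Q'"
  shows "adjoint_polys A A' (P * Q) (P' * Q')"
proof -
  interpret A: hilbert_operator H A by unfold_locales (rule A)
  interpret A': hilbert_operator H A' by unfold_locales (rule A')
  have "ip (A.pa (P * Q) x) y = ip x (A'.pa (Q' * P') y)" if "x \<in> C" "y \<in> C" for x y
    using that assms(3,4) by (simp add: adjoint_polys_def A.pa_mult A'.pa_mult)
  then show ?thesis by (simp add: adjoint_polys_def mult.commute)
qed

text \<open>Dual form of the contractivity of P(A) G(A)^-1, without inverting G'(A'). With v =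
  P'(A') y, h = G'(A') y and G(A) x = v one finds |v|^2 = <P(A) x, h> <= |v| |h|.\<close>

lemma adjoint_polys_norm_le:
  assumes A: "bounded_op H A" and A': "bounded_op H A'"
    and P: "adjoint_polys A A' P P'" and G: "adjoint_polys A A' G G'"
    and le: "\<And>x. x \<in> C \<Longrightarrow> nrm (poly_apply H A P x) \<le> nrm (poly_apply H A G x)"
    and surj: "invertible_op H (poly_apply H A G)" and y: "y \<in> C"
  shows "nrm (poly_apply H A' P' y) \<le> nrm (poly_apply H A' G' y)"
proof -
  interpret A: hilbert_operator H A by unfold_locales (rule A)
  interpret A': hilbert_operator H A' by unfold_locales (rule A')
  define v where "v = A'.pa P' y"
  define h where "h = A'.pa G' y"
  have v: "v \<in> C" and h: "h \<in> C" using y by (simp_all add: v_def h_def)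
  define x where "x = op_inv H (A.pa G) v"
  have x: "x \<in> C" "A.pa G x = v"
    using op_inv[OF surj] bounded_opD(1)[OF op_inv(2)[OF surj] v] v by (auto simp: x_def)
  have "ip v v = ip (A.pa G x) (A'.pa P' y)" by (simp add: x v_def)
  also have "\<dots> = ip x (A'.pa G' (A'.pa P' y))" using G x(1) y by (simp add: adjoint_polys_def)
  also have "A'.pa G' (A'.pa P' y) = A'.pa P' h"
    using y by (simp add: h_def mult.commute flip: A'.pa_mult)
  also have "ip x (A'.pa P' h) = ip (A.pa P x) h" using P x(1) h by (simp add: adjoint_polys_def)
  finally have "ip v v = ip (A.pa P x) h" .
  then have "(nrm v)\<^sup>2 = cmod (ip (A.pa P x) h)" using ip_self[OF v] by (metis norm_of_real abs_of_nonneg zero_le_power2)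
  also have "\<dots> \<le> nrm (A.pa P x) * nrm h" using x h by (intro ip_cauchy_schwarz) auto
  also have "\<dots> \<le> nrm v * nrm h" using le[OF x(1)] x(2) h by (intro mult_right_mono) auto
  finally have "nrm v * nrm v \<le> nrm v * nrm h" by (simp add: power2_eq_square)
  then have "nrm v \<le> nrm h"
    using nrm_nonneg[OF v] nrm_nonneg[OF h] by (cases "nrm v = 0") (auto simp: mult_le_cancel_left)
  then show ?thesis by (simp add: v_def h_def)
qed

text \<open>Turns the von Neumann property on Y into a comparison for a one-variable quotient that
  is bounded by 1 on Y.\<close>

lemma von_neumann_set_poly_le:
  assumes T: "invertible_op H T" and r: "0 < r"
    and Y: "Y \<subseteq> kappa0 r ` (- {0})" and vN: "von_neumann_set Y H (kappa0_op r H T)"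
    and G: "invertible_op H (poly_apply H T G)" "G \<noteq> 0"
    and bound: "\<And>z. z \<noteq> 0 \<Longrightarrow> kappa0 r z \<in> Y \<Longrightarrow> poly G z \<noteq> 0 \<and> cmod (poly P z) \<le> cmod (poly G z)"
    and x: "x \<in> C"
  shows "nrm (poly_apply H T P x) \<le> nrm (poly_apply H T G x)"
proof -
  interpret hilbert_operator H T by unfold_locales (rule op_inv(1)[OF T])
  define a where "a = kappa_scale r"
  have "0 < 1 / r\<^sup>2 + r\<^sup>2" using r by (intro add_pos_pos) auto
  then have a: "a \<noteq> 0" by (auto simp: a_def)
  obtain p where p: "laurent_numerator a 0 p = P" "\<forall>m\<in>keys p. lookup m 2 \<le> 0"
    using univariate_cpoly[OF a] by blast
  obtain g where g: "laurent_numerator a 0 g = G" "\<forall>m\<in>keys g. lookup m 2 \<le> 0"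
    using univariate_cpoly[OF a] by blast
  have at: "poly_at q (kappa0 r z) = poly (laurent_numerator a 0 q) z"
    if "z \<noteq> 0" "\<forall>m\<in>keys q. lookup m 2 \<le> 0" for z q
  proof -
    have "poly (laurent_numerator a 0 q) z = z ^ 0 * poly_at q (kappa0 r z)"
      unfolding a_def by (rule poly_laurent_numerator) (use that in auto)
    then show ?thesis by simp
  qed
  have p_at: "poly_at p (kappa0 r z) = poly P z" and g_at: "poly_at g (kappa0 r z) = poly G z" if "z \<noteq> 0" for z
    using at[OF that p(2)] at[OF that g(2)] p(1) g(1) by simp_all
  have p_op: "poly_op H p (kappa0_op r H T) y = pa P y" if "y \<in> C" for y
    using poly_op_kappa0_op[OF T that, of p 0 r] p by (simp add: a_def)
  have g_op: "poly_op H g (kappa0_op r H T) y = pa G y" if "y \<in> C" for y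
    using poly_op_kappa0_op[OF T that, of g 0 r] g by (simp add: a_def)
  have g_inv: "invertible_op H (poly_op H g (kappa0_op r H T))"
    by (rule invertible_op_cong[OF G(1) g_op])
  note gi = op_inv[OF g_inv]
  define F where "F = rational_op H p g (kappa0_op r H T)"
  have F: "F y = pa P (op_inv H (poly_op H g (kappa0_op r H T)) y)" if "y \<in> C" for y
    using bounded_opD(1)[OF gi(2) that] by (simp add: F_def rational_op_def p_op)
  have F_bounded: "bounded_op H F"
    by (rule bounded_op_cong[OF bounded_op_comp[OF pa_bounded gi(2)] F])
  have "g \<noteq> 0" using g(1) G(2) by (auto simp: laurent_numerator_def)
  moreover have gz: "poly_at g \<xi> \<noteq> 0 \<and> cmod (poly_at p \<xi> / poly_at g \<xi>) \<le> 1" if \<xi>: "\<xi> \<in> Y" for \<xi>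
  proof -
    obtain z where "\<xi> = kappa0 r z" "z \<noteq> 0" using Y \<xi> by auto
    then show ?thesis using bound[of z] \<xi> by (simp add: p_at g_at norm_divide)
  qed
  ultimately have "ennreal (op_norm H F) \<le> (SUP \<xi>\<in>Y. ennreal (cmod (poly_at p \<xi> / poly_at g \<xi>)))"
    using vN unfolding von_neumann_set_def F_def by blast
  also have "\<dots> \<le> 1"
  proof (rule SUP_least)
    fix \<xi> assume "\<xi> \<in> Y"
    then show "ennreal (cmod (poly_at p \<xi> / poly_at g \<xi>)) \<le> 1"
      using gz[of \<xi>] ennreal_leI[of "cmod (poly_at p \<xi> / poly_at g \<xi>)" 1] by simp
  qed
  finally have "op_norm H F \<le> 1" by (simp add: ennreal_le_1)
  have Gx: "pa G x \<in> C" using x by simp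
  have "op_inv H (poly_op H g (kappa0_op r H T)) (pa G x) = x"
    by (rule op_inv_eqI[OF g_inv x]) (simp add: g_op x)
  then have "nrm (pa P x) = nrm (F (pa G x))" using F[OF Gx] by simp
  also have "\<dots> \<le> op_norm H F * nrm (pa G x)" by (rule nrm_le_op_norm[OF F_bounded Gx])
  also have "\<dots> \<le> 1 * nrm (pa G x)" using \<open>op_norm H F \<le> 1\<close> Gx by (intro mult_right_mono) auto
  finally show ?thesis by simp
qed

end

text \<open>A positive k moves sequences to the left: k = 1 gives a backward shift and k = -1 a
  forward one.\<close>

definition weighted_shift :: "(int \<Rightarrow> complex) \<Rightarrow> int \<Rightarrow> (int \<Rightarrow> complex) \<Rightarrow> int \<Rightarrow> complex" where
  "weighted_shift c k s n = c n * s (n + k)"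

section \<open>Weighted shifts on the sequence space\<close>

locale ell2_model =
  fixes e :: "(int \<Rightarrow> complex) \<Rightarrow> 'a"
  assumes inj: "inj e"

sublocale ell2_model \<subseteq> complex_hilbert_space "ell2_space e"
  by (rule ell2_complex_hilbert_space[OF inj])

context ell2_model
begin

abbreviation L where "L \<equiv> ell2_space e"
abbreviation coord where "coord \<equiv> inv_into UNIV e"

definition shift_op :: "(int \<Rightarrow> complex) \<Rightarrow> int \<Rightarrow> 'a \<Rightarrow> 'a" where
  "shift_op c k x = e (weighted_shift c k (coord x))"

lemma coord_e [simp]: "coord (e s) = s"
  by (rule inv_f_f[OF inj])

lemma e_coord [simp]: "x \<in> C \<Longrightarrow> e (coord x) = x"
  by (auto simp: ell2_space_simps[OF inj])

lemma coord_ell2 [simp]: "x \<in> C \<Longrightarrow> coord x \<in> ell2"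
  by (auto simp: ell2_space_simps[OF inj])

lemma e_closed [simp]: "e s \<in> C \<longleftrightarrow> s \<in> ell2"
  using inj by (auto simp: ell2_space_simps[OF inj] inj_eq)

lemma coord_add [simp]: "x \<in> C \<Longrightarrow> y \<in> C \<Longrightarrow> coord (x \<oplus>\<^bsub>L\<^esub> y) = (\<lambda>n. coord x n + coord y n)"
  using ell2_space_simps(2)[OF inj, of "coord x" "coord y"] by simp

lemma coord_scale [simp]: "x \<in> C \<Longrightarrow> coord (c \<odot>\<^bsub>L\<^esub> x) = (\<lambda>n. c * coord x n)"
  using ell2_space_simps(3)[OF inj, of c "coord x"] by simp

lemma coord_zero [simp]: "coord \<zero>\<^bsub>L\<^esub> = (\<lambda>_. 0)"
  by (simp add: ell2_space_simps[OF inj])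

lemma coord_shift [simp]: "coord (shift_op c k x) = weighted_shift c k (coord x)"
  by (simp add: shift_op_def)

lemma eqI: "x \<in> C \<Longrightarrow> y \<in> C \<Longrightarrow> coord x = coord y \<Longrightarrow> x = y"
  by (metis e_coord)

lemma ip_coord: "x \<in> C \<Longrightarrow> y \<in> C \<Longrightarrow> ip x y = weighted_ip (\<lambda>_. 1) (coord x) (coord y)"
  using ell2_space_simps(5)[OF inj, of "coord x" "coord y"] by simp

lemma nrm_coord: "x \<in> C \<Longrightarrow> (nrm x)\<^sup>2 = infsum (\<lambda>n. (cmod (coord x n))\<^sup>2) UNIV"
  using ell2_hnorm[OF inj, of "coord x"] by (simp add: ell2_norm_def infsum_nonneg)

lemma shift_ell2:
  assumes "\<And>n. cmod (c n) \<le> K" and "s \<in> ell2"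
  shows "weighted_shift c k s \<in> ell2"
  unfolding weighted_shift_def using ell2_mult_bounded[OF ell2_shift[OF assms(2)] assms(1)] .

lemma shift_infsum: "infsum (\<lambda>n :: int. f (n + k)) UNIV = infsum f UNIV"
  by (rule infsum_reindex_bij_betw[OF bij_shift])

lemma shift_norm:
  assumes "x \<in> C" and "\<And>n. cmod (c n) \<le> K"
  shows "(nrm (shift_op c k x))\<^sup>2 = infsum (\<lambda>n. (cmod (c (n - k)))\<^sup>2 * (cmod (coord x n))\<^sup>2) UNIV"
proof -
  have "shift_op c k x \<in> C" using shift_ell2[OF assms(2)] assms(1) by (simp add: shift_op_def)
  then have "(nrm (shift_op c k x))\<^sup>2 = infsum (\<lambda>n. (cmod (c (n + k - k)))\<^sup>2 * (cmod (coord x (n + k)))\<^sup>2) UNIV"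
    by (simp add: nrm_coord weighted_shift_def norm_mult power_mult_distrib)
  then show ?thesis
    using shift_infsum[of "\<lambda>n. (cmod (c (n - k)))\<^sup>2 * (cmod (coord x n))\<^sup>2" k] by simp
qed

lemma shift_bounded:
  assumes c: "\<And>n. cmod (c n) \<le> K"
  shows "bounded_op L (shift_op c k)"
proof -
  have cl: "shift_op c k x \<in> C" if "x \<in> C" for x
    using shift_ell2[OF c] that by (simp add: shift_op_def)
  show ?thesis
  proof (rule bounded_opI)
    fix x assume x: "x \<in> C"
    show "shift_op c k x \<in> C" by (rule cl[OF x])
    have "0 \<le> K" using c[of 0] norm_ge_zero order_trans by blast
    have S: "(\<lambda>n. (cmod (coord x n))\<^sup>2) summable_on UNIV"
      using coord_ell2[OF x] by (simp add: ell2_def)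
    have "(nrm (shift_op c k x))\<^sup>2 \<le> infsum (\<lambda>n. K\<^sup>2 * (cmod (coord x n))\<^sup>2) UNIV"
      unfolding shift_norm[OF x c]
    proof (rule infsum_mono)
      show le: "(cmod (c (n - k)))\<^sup>2 * (cmod (coord x n))\<^sup>2 \<le> K\<^sup>2 * (cmod (coord x n))\<^sup>2" for n
        by (intro mult_right_mono power_mono c) auto
      show S': "(\<lambda>n. K\<^sup>2 * (cmod (coord x n))\<^sup>2) summable_on UNIV" by (rule summable_on_cmult_right[OF S])
      show "(\<lambda>n. (cmod (c (n - k)))\<^sup>2 * (cmod (coord x n))\<^sup>2) summable_on UNIV"
        by (rule summable_on_comparison_test[OF S']) (use le in auto)
    qed
    also have "\<dots> = (K * nrm x)\<^sup>2"
      by (simp add: infsum_cmult_right' nrm_coord[OF x] power_mult_distrib)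
    finally show "nrm (shift_op c k x) \<le> K * nrm x"
      using \<open>0 \<le> K\<close> x by (auto intro: power2_le_imp_le)
  next
    fix x y assume "x \<in> C" "y \<in> C"
    then show "shift_op c k (x \<oplus>\<^bsub>L\<^esub> y) = shift_op c k x \<oplus>\<^bsub>L\<^esub> shift_op c k y"
      by (intro eqI) (auto simp: cl weighted_shift_def algebra_simps)
  next
    fix d x assume "x \<in> C"
    then show "shift_op c k (d \<odot>\<^bsub>L\<^esub> x) = d \<odot>\<^bsub>L\<^esub> shift_op c k x"
      by (intro eqI) (auto simp: cl weighted_shift_def algebra_simps)
  qed
qed

lemma shift_adjoint:
  assumes c: "\<And>n. cmod (c n) \<le> K" and x: "x \<in> C" and y: "y \<in> C"
  shows "ip (shift_op c k x) y = ip x (shift_op (\<lambda>n. cnj (c (n - k))) (- k) y)"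
proof -
  have "bounded_op L (shift_op (\<lambda>n. cnj (c (n - k))) (- k))"
    by (rule shift_bounded[where K = K]) (simp add: c)
  then have cl: "shift_op c k x \<in> C" "shift_op (\<lambda>n. cnj (c (n - k))) (- k) y \<in> C"
    using bounded_opD(1)[OF shift_bounded[OF c] x] bounded_opD(1) y by auto
  have "ip (shift_op c k x) y = infsum (\<lambda>n. coord x (n + k) * cnj (cnj (c (n + k - k)) * coord y (n + k - k))) UNIV"
    using cl x y by (simp add: ip_coord weighted_ip_def weighted_shift_def mult_ac)
  also have "\<dots> = infsum (\<lambda>n. coord x n * cnj (cnj (c (n - k)) * coord y (n - k))) UNIV"
    by (rule shift_infsum[of "\<lambda>n. coord x n * cnj (cnj (c (n - k)) * coord y (n - k))" k])
  also have "\<dots> = ip x (shift_op (\<lambda>n. cnj (c (n - k))) (- k) y)"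
    using cl x y by (simp add: ip_coord weighted_ip_def weighted_shift_def)
  finally show ?thesis .
qed

text \<open>For a weighted shift both T* T and T^-* T^-1 are diagonal, so the operator inequality
  holds as soon as it holds entry by entry.\<close>

lemma shift_op_PA:
  assumes nz: "\<And>n. c n \<noteq> 0"
    and le: "\<And>n. (cmod (c (n - k)))\<^sup>2 + 1 / (cmod (c n))\<^sup>2 \<le> r\<^sup>2 + 1 / r\<^sup>2"
  shows "(L, shift_op c k) \<in> PA_class r"
proof -
  define \<kappa> where "\<kappa> = r\<^sup>2 + 1 / r\<^sup>2"
  have c2: "(cmod (c n))\<^sup>2 \<le> \<kappa>" for n
  proof -
    have "(cmod (c n))\<^sup>2 + 1 / (cmod (c (n + k)))\<^sup>2 \<le> \<kappa>" using le[of "n + k"] by (simp only: \<kappa>_def add_diff_cancel_right')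
    moreover have "0 \<le> 1 / (cmod (c (n + k)))\<^sup>2" by simp
    ultimately show ?thesis by linarith
  qed
  then have c: "cmod (c n) \<le> sqrt \<kappa>" for n by (simp add: real_le_rsqrt)
  \<comment> \<open>Solving (T s)(n) = c n * s (n + k) for s shows that the inverse is the shift by
    -k with these weights.\<close>
  define d where "d n = 1 / c (n - k)" for n
  have d2: "1 / (cmod (c n))\<^sup>2 \<le> \<kappa>" for n
    using le[of n] zero_le_power2[of "cmod (c (n - k))"] unfolding \<kappa>_def by linarith
  have "(cmod (d n))\<^sup>2 \<le> \<kappa>" for n
    using d2[of "n - k"] by (simp add: d_def norm_divide power_divide)
  then have d: "cmod (d n) \<le> sqrt \<kappa>" for n by (simp add: real_le_rsqrt)
  note b = shift_bounded[of c, OF c] shift_bounded[of d, OF d]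
  have inv: "shift_op d (- k) (shift_op c k x) = x" "shift_op c k (shift_op d (- k) x) = x" if "x \<in> C" for x
    using that bounded_opD(1)[OF b(1)] bounded_opD(1)[OF b(2)] nz
    by (auto intro!: eqI simp: weighted_shift_def d_def)
  then have T: "invertible_op L (shift_op c k)"
    using b unfolding invertible_op_def by blast
  have "(nrm (shift_op c k x))\<^sup>2 + (nrm (op_inv L (shift_op c k) x))\<^sup>2 \<le> (r\<^sup>2 + 1 / r\<^sup>2) * (nrm x)\<^sup>2"
    if x: "x \<in> C" for x
  proof -
    have S: "(\<lambda>n. (cmod (coord x n))\<^sup>2) summable_on UNIV"
      using coord_ell2[OF x] by (simp add: ell2_def)
    have sm: "(\<lambda>n. u n * (cmod (coord x n))\<^sup>2) summable_on UNIV" if "\<And>n. 0 \<le> u n \<and> u n \<le> \<kappa>" for u :: "int \<Rightarrow> real"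
    proof (rule summable_on_comparison_test[OF summable_on_cmult_right[OF S, of \<kappa>]])
      fix n
      show "u n * (cmod (coord x n))\<^sup>2 \<le> \<kappa> * (cmod (coord x n))\<^sup>2" "0 \<le> u n * (cmod (coord x n))\<^sup>2"
        using that[of n] by (simp_all add: mult_right_mono)
    qed
    have "op_inv L (shift_op c k) x = shift_op d (- k) x"
      using bounded_opD(1)[OF b(2) x] inv(2)[OF x] by (rule op_inv_eqI[OF T])
    then have "(nrm (op_inv L (shift_op c k) x))\<^sup>2 = infsum (\<lambda>n. 1 / (cmod (c n))\<^sup>2 * (cmod (coord x n))\<^sup>2) UNIV"
      using shift_norm[of x d "sqrt \<kappa>" "- k", OF x d] by (simp add: d_def norm_divide power_divide)
    then have "(nrm (shift_op c k x))\<^sup>2 + (nrm (op_inv L (shift_op c k) x))\<^sup>2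
      = infsum (\<lambda>n. (cmod (c (n - k)))\<^sup>2 * (cmod (coord x n))\<^sup>2) UNIV + infsum (\<lambda>n. 1 / (cmod (c n))\<^sup>2 * (cmod (coord x n))\<^sup>2) UNIV"
      using shift_norm[of x c "sqrt \<kappa>" k, OF x c] by simp
    also have "\<dots> = infsum (\<lambda>n. (cmod (c (n - k)))\<^sup>2 * (cmod (coord x n))\<^sup>2 + 1 / (cmod (c n))\<^sup>2 * (cmod (coord x n))\<^sup>2) UNIV"
      by (rule infsum_add[symmetric]; rule sm) (use c2 d2 in auto)
    also have "\<dots> = infsum (\<lambda>n. ((cmod (c (n - k)))\<^sup>2 + 1 / (cmod (c n))\<^sup>2) * (cmod (coord x n))\<^sup>2) UNIV"
      by (simp only: distrib_right)
    also have "\<dots> \<le> infsum (\<lambda>n. \<kappa> * (cmod (coord x n))\<^sup>2) UNIV"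
    proof (rule infsum_mono)
      show "(\<lambda>n. ((cmod (c (n - k)))\<^sup>2 + 1 / (cmod (c n))\<^sup>2) * (cmod (coord x n))\<^sup>2) summable_on UNIV"
        by (rule sm) (use le in \<open>auto simp: \<kappa>_def\<close>)
      show "(\<lambda>n. \<kappa> * (cmod (coord x n))\<^sup>2) summable_on UNIV" by (rule summable_on_cmult_right[OF S])
      fix n
      show "((cmod (c (n - k)))\<^sup>2 + 1 / (cmod (c n))\<^sup>2) * (cmod (coord x n))\<^sup>2 \<le> \<kappa> * (cmod (coord x n))\<^sup>2"
        using le[of n] unfolding \<kappa>_def by (rule mult_right_mono) simp
    qed
    also have "\<dots> = (r\<^sup>2 + 1 / r\<^sup>2) * (nrm x)\<^sup>2"
      by (simp only: infsum_cmult_right' nrm_coord[OF x] \<kappa>_def)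
    finally show ?thesis .
  qed
  then show ?thesis using T complex_hilbert_space_axioms by (simp add: PA_class_iff)
qed

end

section \<open>Minimality\<close>

text \<open>
  With \<open>v = (\<zeta> - b) / (1 - cnj b * \<zeta>)\<close> and \<open>\<zeta> = r z\<close>, the quotient of these polynomials is
  \<open>((v - \<tau>) / (1 - \<tau> v))\<^sup>2 / v\<close>. It is unimodular for \<open>\<bar>\<zeta>\<bar> = 1\<close>, and its pole at \<open>\<zeta> = b\<close> is genuine
  because \<open>\<tau> \<noteq> 0\<close>.
\<close>

definition blaschke_num :: "real \<Rightarrow> real \<Rightarrow> complex \<Rightarrow> complex poly" where
  "blaschke_num r \<tau> b = [:- (b + of_real \<tau>), (1 + of_real \<tau> * cnj b) * of_real r:] *
     ([:- (b + of_real \<tau>), (1 + of_real \<tau> * cnj b) * of_real r:] * [:1, - cnj b * of_real r:])"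

definition blaschke_den :: "real \<Rightarrow> real \<Rightarrow> complex \<Rightarrow> complex poly" where
  "blaschke_den r \<tau> b = [:1 + of_real \<tau> * b, - (cnj b + of_real \<tau>) * of_real r:] *
     ([:1 + of_real \<tau> * b, - (cnj b + of_real \<tau>) * of_real r:] * [:- b, of_real r:])"

text \<open>The two values are the positive solutions t of t^2 + 1/t^2 = r^2 + 1/r^2, so on either
  side of the jump the bound of \<open>PA_class\<close> is attained.\<close>

definition two_sided_weight :: "real \<Rightarrow> int \<Rightarrow> complex" where
  "two_sided_weight r n = of_real (if 0 \<le> n then 1 / r else r)"

text \<open>A zero of modulus at most 1 would give |1 + tau b| <= |b + tau|, contrary to the
  Blaschke identity for two points of the open disc.\<close>

lemma blaschke_den_nonzero_factor:
  assumes b: "cmod b < 1" and \<tau>: "0 < \<tau>" "\<tau> < 1" and z: "cmod z \<le> 1"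
  shows "1 + of_real \<tau> * b - (cnj b + of_real \<tau>) * z \<noteq> 0"
proof
  assume "1 + of_real \<tau> * b - (cnj b + of_real \<tau>) * z = 0"
  then have "cmod (1 + of_real \<tau> * b) = cmod (cnj b + of_real \<tau>) * cmod z"
    by (simp flip: norm_mult)
  also have "\<dots> \<le> cmod (cnj b + of_real \<tau>) * 1" using z by (intro mult_left_mono) auto
  also have "cmod (cnj b + of_real \<tau>) = cmod (b + of_real \<tau>)"
    by (metis complex_cnj_add complex_cnj_complex_of_real complex_mod_cnj)
  finally have "(cmod (1 + of_real \<tau> * b))\<^sup>2 \<le> (cmod (b + of_real \<tau>))\<^sup>2"
    by (intro power_mono) auto
  moreover have "(cmod (1 + of_real \<tau> * b))\<^sup>2 - (cmod (b + of_real \<tau>))\<^sup>2 = (1 - \<tau>\<^sup>2) * (1 - (cmod b)\<^sup>2)"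
    using blaschke_identity[of "- of_real \<tau>" b] \<tau> by simp
  moreover have "0 < (1 - \<tau>\<^sup>2) * (1 - (cmod b)\<^sup>2)"
    using b \<tau> by (intro mult_pos_pos) (auto simp: power_less_one_iff)
  ultimately show False by linarith
qed

lemma summable_on_two_sided_geometric:
  assumes "0 \<le> q" "q < 1"
  shows "(\<lambda>n :: int. if n < 0 then q ^ nat (- n - 1) else 0 :: real) summable_on UNIV"
proof -
  have "(\<lambda>j. q ^ j) summable_on UNIV"
    using assms by (intro norm_summable_imp_summable_on) (simp add: summable_geometric)
  moreover have bij: "bij_betw (\<lambda>j :: nat. - int j - 1) UNIV {..<0}"
    by (rule bij_betwI[where g = "\<lambda>n. nat (- n - 1)"]) auto
  ultimately have "(\<lambda>n :: int. if n < 0 then q ^ nat (- n - 1) else 0) summable_on {..<0}"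
    using summable_on_reindex_bij_betw[OF bij, of "\<lambda>n. if n < 0 then q ^ nat (- n - 1) else 0"] by simp
  then show ?thesis
    by (rule summable_on_cong_neutral[THEN iffD1, rotated -1]) auto
qed

context ell2_model
begin

text \<open>The vector y is chosen so that r M - b maps it to a sequence supported on n >= 0; below
  0 this forces a geometric sequence of ratio b / r^2, and |b| < r^2 makes it square-summable.
  Numerator and denominator have equal norm at y in a weighted norm where r M is isometric. The
  denominator contains the factor r M - b, so its value lies where the two norms agree, whereas the
  numerator keeps a coordinate at -1, where the norm of the space is strictly larger.\<close>

lemma shift_norm_gap:
  fixes b :: complex
  assumes r: "0 < r" "r < 1" and b: "cmod b < r\<^sup>2" and \<tau>: "0 < \<tau>" "\<tau> < 1"
  defines "M \<equiv> shift_op (\<lambda>n. two_sided_weight r (n - 1)) (- 1)"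
  shows "\<exists>y\<in>C. nrm (poly_apply L M (blaschke_den r \<tau> b) y) < nrm (poly_apply L M (blaschke_num r \<tau> b) y)"
proof -
  have r2: "r\<^sup>2 < 1" using r by (simp add: power_less_one_iff)
  have b1: "cmod b < 1" using b r2 by linarith
  have w_le: "cmod (two_sided_weight r (n - 1)) \<le> 1 / r" for n
    using r mult_le_one[of r r] by (auto simp: two_sided_weight_def norm_divide le_divide_eq)
  have M: "bounded_op L M" unfolding M_def by (rule shift_bounded[OF w_le])
  interpret hilbert_operator L M by unfold_locales (rule M)
  have coord_M: "coord (M x) n = two_sided_weight r (n - 1) * coord x (n - 1)" for x n
    by (simp add: M_def weighted_shift_def)
  define q where "q = b / of_real (r\<^sup>2)"
  have q: "cmod q < 1" using b r by (simp add: q_def norm_divide norm_power)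
  \<comment> \<open>\<open>y = (r M - b)\<^sup>-\<^sup>1 x0\<close> with \<open>x0\<close> a multiple of the basis vector at \<open>0\<close>\<close>
  define \<eta> :: "int \<Rightarrow> complex" where "\<eta> n = (if n < 0 then q ^ nat (- n - 1) else 0)" for n
  have "\<eta> \<in> ell2"
  proof -
    have "(cmod (\<eta> n))\<^sup>2 = (if n < 0 then ((cmod q)\<^sup>2) ^ nat (- n - 1) else 0)" for n
      by (simp add: \<eta>_def norm_power flip: power_mult) (simp add: mult.commute)
    moreover have "(cmod q)\<^sup>2 < 1" using q by (simp add: power_less_one_iff)
    ultimately show ?thesis using summable_on_two_sided_geometric[of "(cmod q)\<^sup>2"] by (simp add: ell2_def)
  qed
  define y where "y = e \<eta>"
  have y: "y \<in> C" using \<open>\<eta> \<in> ell2\<close> by (simp add: y_def)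
  define x0 where "x0 = pa [:- b, of_real r:] y"
  have x0: "x0 \<in> C" using y by (simp add: x0_def)
  have coord_x0: "coord x0 n = 0" if "n < 0" for n
  proof -
    have "coord x0 n = - b * \<eta> n + of_real r * (two_sided_weight r (n - 1) * \<eta> (n - 1))"
      using y by (simp add: x0_def pa_pCons op_scale coord_M) (simp add: y_def)
    also have "\<dots> = 0"
    proof -
      have "nat (- (n - 1) - 1) = Suc (nat (- n - 1))" using that by simp
      then have "\<eta> (n - 1) = q * \<eta> n" using that by (simp add: \<eta>_def)
      moreover have "of_real r * (of_real r * q) = b" using r by (simp add: q_def power2_eq_square)
      ultimately show ?thesis using that by (simp add: two_sided_weight_def mult.assoc[symmetric])
    qed
    finally show ?thesis .
  qed
  \<comment> \<open>M only moves sequences to the right, so no polynomial of M can reach negative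
    indices from x0.\<close>
  have coord_pa_x0: "\<forall>n<0. coord (pa Q x0) n = 0" for Q
  proof (induction Q)
    case (pCons c Q)
    then show ?case using x0 coord_x0 by (simp add: pa_pCons coord_M)
  qed simp
  \<comment> \<open>In the weights \<open>\<rho>\<close> the operator \<open>r M\<close> is an isometry; they agree with the norm of \<open>\<ell>\<^sup>2\<close> exactly on
    the sequences supported on \<open>n \<ge> 0\<close>.\<close>
  define \<rho> :: "int \<Rightarrow> real" where "\<rho> n = (if 0 \<le> n then 1 else r ^ (4 * nat (- n)))" for n
  have \<rho>: "\<bar>\<rho> n\<bar> \<le> 1" "0 \<le> \<rho> n" for n using r by (auto simp: \<rho>_def power_le_one)
  define B where "B p s = weighted_ip \<rho> (coord (pa p y)) (coord (pa s y))" for p s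
  interpret J: poly_form B
  proof
    fix p s u c
    show "B (p + s) u = B p u + B s u"
      using y \<rho>(1) by (simp add: B_def pa_add weighted_ip_add_left)
    show "B (Polynomial.smult c p) s = c * B p s"
      using y by (simp add: B_def pa_smult weighted_ip_scale_left)
    show "B s p = cnj (B p s)" by (simp add: B_def weighted_ip_commute[of \<rho> "coord (pa s y)"])
    show "0 \<le> Re (B p p)"
      using y \<rho> by (simp add: B_def weighted_ip_self infsum_nonneg)
  qed
  have E: "J.E p = infsum (\<lambda>n. \<rho> n * (cmod (coord (pa p y) n))\<^sup>2) UNIV" for p
    using y \<rho>(1) by (simp add: J.E_def B_def weighted_ip_self(2))
  have iso: "B (Polynomial.monom 1 1 * p) (Polynomial.monom 1 1 * s) = of_real ((1 / r)\<^sup>2) * B p s" for p s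
  proof -
    define g where "g n = of_real (\<rho> (n + 1)) * ((two_sided_weight r n * coord (pa p y) n) * cnj (two_sided_weight r n * coord (pa s y) n))" for n
    have "B (Polynomial.monom 1 1 * p) (Polynomial.monom 1 1 * s) = infsum (\<lambda>n. g (n + - 1)) UNIV"
      using y by (simp add: B_def weighted_ip_def monom_altdef pa_pCons coord_M g_def)
    also have "\<dots> = infsum g UNIV" by (rule shift_infsum)
    also have "g = (\<lambda>n. of_real ((1 / r)\<^sup>2) * (of_real (\<rho> n) * (coord (pa p y) n * cnj (coord (pa s y) n))))"
    proof
      fix n
      \<comment> \<open>For n < 0 the squared weight is r^2 and the required scaling is 1/r^2, so
        each step to the left must multiply rho by r^4.\<close>
      have "of_real (\<rho> (n + 1)) * (two_sided_weight r n * cnj (two_sided_weight r n)) = complex_of_real ((1 / r)\<^sup>2 * \<rho> n)"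
      proof (cases "0 \<le> n")
        case True
        then show ?thesis by (simp add: \<rho>_def two_sided_weight_def power2_eq_square)
      next
        case False
        define j where "j = nat (- n - 1)"
        have n: "n = - int j - 1" using False by (simp add: j_def)
        have "\<rho> (n + 1) = r ^ (4 * j)" by (cases j) (simp_all add: \<rho>_def n nat_add_distrib)
        moreover have "\<rho> n = r ^ (4 * j) * r ^ 4" by (simp add: \<rho>_def n nat_add_distrib power_add)
        moreover have "two_sided_weight r n = of_real r" by (simp add: two_sided_weight_def n)
        ultimately show ?thesis using r by (simp add: power2_eq_square power4_eq_xxxx field_simps)
      qed
      then show "g n = of_real ((1 / r)\<^sup>2) * (of_real (\<rho> n) * (coord (pa p y) n * cnj (coord (pa s y) n)))"
        by (simp add: g_def)
    qed
    finally show ?thesis by (simp only: infsum_cmult_right' B_def weighted_ip_def)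
  qed
  have swap: "J.E ([:- d, c * of_real r:] * Q) = J.E ([:cnj c, - cnj d * of_real r:] * Q)" for c d Q
    by (rule J.E_linear_factor_swap[OF iso]) (use r in simp)
  have "J.E (blaschke_num r \<tau> b) = J.E (blaschke_den r \<tau> b)"
  proof -
    define N where "N = [:- (b + of_real \<tau>), (1 + of_real \<tau> * cnj b) * of_real r:]"
    define D where "D = [:1 + of_real \<tau> * b, - (cnj b + of_real \<tau>) * of_real r:]"
    have ND: "J.E (N * Q) = J.E (D * Q)" for Q
      using swap[of "b + of_real \<tau>" "1 + of_real \<tau> * cnj b" Q] by (simp add: N_def D_def)
    have "J.E (blaschke_num r \<tau> b) = J.E (D * (N * [:1, - cnj b * of_real r:]))"
      unfolding blaschke_num_def N_def[symmetric] by (rule ND)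
    also have "\<dots> = J.E (N * (D * [:1, - cnj b * of_real r:]))" by (simp only: mult.left_commute)
    also have "\<dots> = J.E (D * (D * [:1, - cnj b * of_real r:]))" by (rule ND)
    \<comment> \<open>The factor producing the pole is reflected the other way: 1 - cnj b * r z
      belongs to the numerator and becomes r z - b.\<close>
    also have "\<dots> = J.E ([:cnj 1, - cnj b * of_real r:] * (D * D))" by (simp only: mult_ac complex_cnj_one)
    also have "\<dots> = J.E ([:- b, 1 * of_real r:] * (D * D))" by (rule swap[symmetric])
    also have "\<dots> = J.E (blaschke_den r \<tau> b)"
      unfolding blaschke_den_def D_def[symmetric] by (simp only: mult_ac mult_1)
    finally show ?thesis .
  qed
  also have "J.E (blaschke_den r \<tau> b) = (nrm (pa (blaschke_den r \<tau> b) y))\<^sup>2"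
  proof -
    have "pa (blaschke_den r \<tau> b) y = pa ([:1 + of_real \<tau> * b, - (cnj b + of_real \<tau>) * of_real r:] *
        [:1 + of_real \<tau> * b, - (cnj b + of_real \<tau>) * of_real r:]) x0"
      unfolding x0_def blaschke_den_def mult.assoc[symmetric] by (rule pa_mult[OF y])
    then have "\<forall>n<0. coord (pa (blaschke_den r \<tau> b) y) n = 0" using coord_pa_x0 by simp
    then have *: "\<rho> n * (cmod (coord (pa (blaschke_den r \<tau> b) y) n))\<^sup>2 = (cmod (coord (pa (blaschke_den r \<tau> b) y) n))\<^sup>2" for n
      by (cases "n < 0") (simp_all add: \<rho>_def)
    show ?thesis unfolding E nrm_coord[OF pa_closed[OF y]] * ..
  qed
  finally have eq: "(nrm (pa (blaschke_den r \<tau> b) y))\<^sup>2 = J.E (blaschke_num r \<tau> b)" by simp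
  define x where "x = pa (blaschke_num r \<tau> b) y"
  have x: "x \<in> C" using y by (simp add: x_def)
  have "coord x (- 1) \<noteq> 0"
  proof -
    \<comment> \<open>The residue of the quotient up to a nonzero factor: the value of the numerator
      at the zero of r z - b. Dividing by r z - b gives the numerator as v + Q (r z - b), and only v
      y contributes at index -1.\<close>
    define v where "v = poly (blaschke_num r \<tau> b) (b / of_real r)"
    have "v = (of_real \<tau> * (b * cnj b - 1)) * ((of_real \<tau> * (b * cnj b - 1)) * (1 - b * cnj b))"
      using r by (simp add: v_def blaschke_num_def) (simp add: algebra_simps)
    moreover have "b * cnj b \<noteq> 1"
    proof
      assume "b * cnj b = 1"
      then have "(cmod b)\<^sup>2 = 1" using complex_norm_square[of b] by (simp flip: of_real_power add: of_real_eq_1_iff)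
      then show False using b1 norm_ge_zero[of b] by (simp add: power2_eq_1_iff)
    qed
    ultimately have v: "v \<noteq> 0" using \<tau> by simp
    have "[:- (b / of_real r), 1:] dvd blaschke_num r \<tau> b - [:v:]"
      by (simp add: dvd_iff_poly_eq_0 v_def)
    then obtain Q where "blaschke_num r \<tau> b - [:v:] = [:- (b / of_real r), 1:] * Q" by (elim dvdE)
    moreover have "[:- (b / of_real r), 1:] * Q = Polynomial.smult (1 / of_real r) Q * [:- b, of_real r:]"
    proof -
      have "[:- (b / of_real r), 1:] = Polynomial.smult (1 / of_real r) [:- b, of_real r:]" using r by simp
      then show ?thesis by (simp only: mult_smult_left mult_smult_right mult.commute)
    qed
    ultimately have "blaschke_num r \<tau> b = [:v:] + Polynomial.smult (1 / of_real r) Q * [:- b, of_real r:]"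
      by (simp add: algebra_simps)
    then have "x = pa [:v:] y \<oplus>\<^bsub>L\<^esub> pa (Polynomial.smult (1 / of_real r) Q) x0"
      by (simp only: x_def x0_def pa_add[OF y] pa_mult[OF y])
    then have "x = v \<odot>\<^bsub>L\<^esub> y \<oplus>\<^bsub>L\<^esub> pa (Polynomial.smult (1 / of_real r) Q) x0"
      using y by (simp add: pa_pCons)
    then have "coord x (- 1) = v * \<eta> (- 1)"
      using y x0 coord_pa_x0[of "Polynomial.smult (1 / of_real r) Q"] by (simp add: y_def)
    then show ?thesis using v by (simp add: \<eta>_def)
  qed
  have S: "(\<lambda>n. (cmod (coord x n))\<^sup>2) summable_on UNIV"
    using coord_ell2[OF x] by (simp add: ell2_def)
  have S\<rho>: "(\<lambda>n. \<rho> n * (cmod (coord x n))\<^sup>2) summable_on UNIV"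
    by (rule weighted_ip_self(1)[OF coord_ell2[OF x] \<rho>(1)])
  have S': "(\<lambda>n. (1 - \<rho> n) * (cmod (coord x n))\<^sup>2) summable_on UNIV"
    using summable_on_add[OF S summable_on_cmult_right[OF S\<rho>, of "-1"]] by (simp add: algebra_simps)
  have "0 < (1 - \<rho> (- 1)) * (cmod (coord x (- 1)))\<^sup>2"
    using \<open>coord x (- 1) \<noteq> 0\<close> r by (simp add: \<rho>_def power_less_one_iff)
  also have "\<dots> = (\<Sum>n\<in>{- 1}. (1 - \<rho> n) * (cmod (coord x n))\<^sup>2)" by simp
  also have "\<dots> \<le> infsum (\<lambda>n. (1 - \<rho> n) * (cmod (coord x n))\<^sup>2) UNIV"
    using \<rho>(1) by (intro finite_sum_le_infsum S') (auto simp: abs_le_iff)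
  finally have "0 < infsum (\<lambda>n. (1 - \<rho> n) * (cmod (coord x n))\<^sup>2) UNIV" .
  moreover have "infsum (\<lambda>n. (1 - \<rho> n) * (cmod (coord x n))\<^sup>2) UNIV + infsum (\<lambda>n. \<rho> n * (cmod (coord x n))\<^sup>2) UNIV
      = infsum (\<lambda>n. (cmod (coord x n))\<^sup>2) UNIV"
    unfolding infsum_add[OF S' S\<rho>, symmetric] by (simp add: algebra_simps)
  ultimately have "(nrm (pa (blaschke_den r \<tau> b) y))\<^sup>2 < (nrm x)\<^sup>2"
    unfolding eq E nrm_coord[OF x] x_def[symmetric] by linarith
  then have "nrm (pa (blaschke_den r \<tau> b) y) < nrm x"
    using x y by (auto intro: power2_less_imp_less)
  then show ?thesis using y unfolding x_def by blast
qed

text \<open>Multiplication by w belongs to the class precisely when |w| lies between r and 1/r.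
  Every nonzero vector is then a joint eigenvector, so \<open>kappa0 r w\<close> lies in the Taylor
  spectrum.\<close>

lemma minimality_spectral_case:
  assumes r: "0 < r" "r < 1" and w: "r \<le> cmod w" "cmod w \<le> 1 / r" and Y: "kappa0 r w \<notin> Y"
  shows "\<exists>(H, T)\<in>(PA_class r :: ('a chilbert \<times> ('a \<Rightarrow> 'a)) set). \<not> von_neumann_set Y H (kappa0_op r H T)"
proof -
  define T where "T = shift_op (\<lambda>_. w) 0"
  have w0: "w \<noteq> 0" using w r by auto
  have PA: "(L, T) \<in> PA_class r"
    unfolding T_def
  proof (rule shift_op_PA)
    define t where "t = (cmod w)\<^sup>2"
    have t: "r\<^sup>2 \<le> t" "t \<le> 1 / r\<^sup>2" "0 < t"
      using w r w0 power_mono[of r "cmod w" 2] power_mono[of "cmod w" "1 / r" 2] by (auto simp: t_def power_divide)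
    \<comment> \<open>The class condition t + 1/t <= r^2 + 1/r^2 is this sign condition divided by
      t.\<close>
    have "(t - r\<^sup>2) * (t - 1 / r\<^sup>2) \<le> 0" using t by (intro mult_nonneg_nonpos) auto
    moreover have "(t - r\<^sup>2) * (t - 1 / r\<^sup>2) = t * t + r\<^sup>2 * (1 / r\<^sup>2) - (r\<^sup>2 + 1 / r\<^sup>2) * t"
      by (simp only: ring_distribs) (simp add: mult_ac)
    moreover have "r\<^sup>2 * (1 / r\<^sup>2) = 1" using r by simp
    ultimately have "t * t + 1 \<le> (r\<^sup>2 + 1 / r\<^sup>2) * t" by linarith
    then have "(t * t + 1) / t \<le> r\<^sup>2 + 1 / r\<^sup>2" using t(3) by (simp only: divide_le_eq) simp
    then have "t + 1 / t \<le> r\<^sup>2 + 1 / r\<^sup>2" using t(3) by (simp add: add_divide_distrib)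
    then show "(cmod w)\<^sup>2 + 1 / (cmod w)\<^sup>2 \<le> r\<^sup>2 + 1 / r\<^sup>2" by (simp add: t_def)
  qed (rule w0)
  have T: "invertible_op L T" using PA by (simp add: PA_class_iff)
  define s :: "int \<Rightarrow> complex" where "s n = (if n = 0 then 1 else 0)" for n
  have "s \<in> ell2"
  proof -
    have "(\<lambda>n. (cmod (s n))\<^sup>2) summable_on {0}" by simp
    then have "(\<lambda>n. (cmod (s n))\<^sup>2) summable_on UNIV"
      by (rule summable_on_cong_neutral[THEN iffD1, rotated -1]) (auto simp: s_def)
    then show ?thesis by (simp add: ell2_def)
  qed
  then have x: "e s \<in> C" by simp
  have "e s \<noteq> \<zero>\<^bsub>L\<^esub>"
  proof
    assume "e s = \<zero>\<^bsub>L\<^esub>"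
    then have "coord (e s) = coord \<zero>\<^bsub>L\<^esub>" by (rule arg_cong)
    then have "s 0 = 0" by (simp add: fun_eq_iff)
    then show False by (simp add: s_def)
  qed
  have Tx: "T z = w \<odot>\<^bsub>L\<^esub> z" if "z \<in> C" for z
    using that bounded_opD(1)[OF op_inv(1)[OF T] that]
    by (intro eqI) (auto simp: T_def weighted_shift_def)
  have Ux: "op_inv L T (e s) = inverse w \<odot>\<^bsub>L\<^esub> e s"
    by (rule op_inv_eqI[OF T]) (use x w0 Tx[of "inverse w \<odot>\<^bsub>L\<^esub> e s"] in \<open>simp_all add: scale_scale\<close>)
  have "kappa0 r w \<in> taylor_spectrum L (kappa0_op r L T)"
  proof (rule joint_eigenvalue_in_taylor_spectrum[OF kappa0_op_bounded[OF T] x \<open>e s \<noteq> _\<close>])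
    fix i :: 2
    show "(kappa0_op r L T $ i) (e s) = kappa0 r w $ i \<odot>\<^bsub>L\<^esub> e s"
      using x by (cases "i = 1") (simp_all add: kappa0_op_def kappa0_def Tx Ux scale_scale divide_inverse mult.commute)
  qed
  then have "\<not> von_neumann_set Y L (kappa0_op r L T)" using Y by (auto simp: von_neumann_set_def)
  then show ?thesis using PA by (intro bexI[of _ "(L, T)"]) auto
qed

text \<open>Here w lies outside the spectrum of T, so the quotient with pole at w can be formed at
  T. It is bounded by 1 on Y, yet not contractive at T: otherwise duality would carry the comparison
  over to M and contradict \<open>shift_norm_gap\<close>.\<close>

lemma minimality_inner_case:
  assumes r: "0 < r" "r < 1" and w: "cmod w < r" and \<epsilon>: "0 < \<epsilon>"
    and Y: "Y \<subseteq> kappa0 r ` (cball 0 (1 / r) - {0})"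
    and far: "\<And>z. z \<noteq> 0 \<Longrightarrow> kappa0 r z \<in> Y \<Longrightarrow> \<epsilon> \<le> cmod (z - w)"
  shows "\<exists>(H, T)\<in>(PA_class r :: ('a chilbert \<times> ('a \<Rightarrow> 'a)) set). \<not> von_neumann_set Y H (kappa0_op r H T)"
proof -
  define c where "c = two_sided_weight r"
  define T where "T = shift_op c 1"
  define M where "M = shift_op (\<lambda>n. two_sided_weight r (n - 1)) (- 1)"
  have r1: "r < 1 / r" using r mult_strict_mono[of r 1 r 1] by (simp add: less_divide_eq)
  have PA: "(L, T) \<in> PA_class r"
    unfolding T_def
  proof (rule shift_op_PA)
    fix n :: int
    show "c n \<noteq> 0" using r by (simp add: c_def two_sided_weight_def)
    have "r\<^sup>2 \<le> 1 / r\<^sup>2" using r1 r power_mono[of r "1 / r" 2] by (simp add: power_divide)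
    then show "(cmod (c (n - 1)))\<^sup>2 + 1 / (cmod (c n))\<^sup>2 \<le> r\<^sup>2 + 1 / r\<^sup>2"
      using r by (auto simp: c_def two_sided_weight_def norm_divide power_divide)
  qed
  have T: "invertible_op L T" using PA by (simp add: PA_class_iff)
  note i = op_inv[OF T]
  have QA: "op_norm L T \<le> 1 / r" "op_norm L (op_inv L T) \<le> 1 / r"
    using PA_class_subset_QA_class[OF r] PA by (auto simp: QA_class_def)
  have norm_le: "nrm (A x) \<le> 1 / r * nrm x" if "bounded_op L A" "op_norm L A \<le> 1 / r" "x \<in> C" for A x
  proof -
    have "nrm (A x) \<le> op_norm L A * nrm x" by (rule nrm_le_op_norm[OF that(1,3)])
    also have "\<dots> \<le> 1 / r * nrm x" using that by (intro mult_right_mono) auto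
    finally show ?thesis .
  qed
  interpret T: norm_bounded_operator L T "1 / r"
    by unfold_locales (use i(1) r norm_le[OF i(1) QA(1)] in auto)
  interpret U: norm_bounded_operator L "op_inv L T" "1 / r"
    by unfold_locales (use i(2) r norm_le[OF i(2) QA(2)] in auto)
  have c_le: "cmod (c n) \<le> 1 / r" for n
    using r r1 by (auto simp: c_def two_sided_weight_def norm_divide)
  have c_cnj: "cnj (c n) = c n" for n by (simp add: c_def two_sided_weight_def)
  have M: "bounded_op L M" unfolding M_def by (rule shift_bounded[where K = "1 / r"]) (use c_le in \<open>simp add: c_def\<close>)
  have adj: "ip (T x) y = ip x (M y)" if "x \<in> C" "y \<in> C" for x y
    using shift_adjoint[OF c_le that, where k = 1] by (simp add: T_def M_def c_cnj) (simp add: c_def)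
  \<comment> \<open>The pole in the rescaled variable r z; |w| < r becomes |b| < r^2, the hypothesis
    of the gap lemma.\<close>
  define b where "b = of_real r * w"
  have b: "cmod b < r\<^sup>2" using w r by (simp add: b_def norm_mult power2_eq_square)
  have "r\<^sup>2 < 1" using r by (simp add: power_less_one_iff)
  then have b1: "cmod b < 1" using b by linarith
  \<comment> \<open>A distance of at least epsilon from w becomes at least r * epsilon after
    rescaling; the constants are those of \<open>blaschke_product_le\<close>.\<close>
  define \<tau> where "\<tau> = min (1 / 4) (r * \<epsilon> / 12)"
  have \<tau>: "0 < \<tau>" "\<tau> \<le> 1 / 4" "\<tau> \<le> r * \<epsilon> / 12" "\<tau> < 1" using r \<epsilon> by (auto simp: \<tau>_def)
  define P where "P = blaschke_num r \<tau> b"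
  define G where "G = blaschke_den r \<tau> b"
  have polyP: "poly P z = ((1 + of_real \<tau> * cnj b) * (of_real r * z) - (b + of_real \<tau>))\<^sup>2 * (1 - cnj b * (of_real r * z))" for z
    unfolding P_def blaschke_num_def by (simp add: power2_eq_square) (simp add: algebra_simps)
  have polyG: "poly G z = ((1 + of_real \<tau> * b) - (cnj b + of_real \<tau>) * (of_real r * z))\<^sup>2 * (of_real r * z - b)" for z
    unfolding G_def blaschke_den_def by (simp add: power2_eq_square) (simp add: algebra_simps)
  have rz: "cmod (of_real r * z) \<le> 1" if "cmod z \<le> 1 / r" for z
    using that r by (simp add: norm_mult field_simps)
  have D: "invertible_op L (T.pa [:1 + of_real \<tau> * b, - (cnj b + of_real \<tau>) * of_real r:])"
  proof (rule T.pa_invertible)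
    fix z assume "cmod z \<le> 1 / r"
    from blaschke_den_nonzero_factor[OF b1 \<tau>(1,4) rz[OF this]]
    show "poly [:1 + of_real \<tau> * b, - (cnj b + of_real \<tau>) * of_real r:] z \<noteq> 0"
      by (simp add: algebra_simps)
  qed
  \<comment> \<open>Although b / r lies in the disc, r T - b is invertible: it equals T (r - b
    T^-1), and |b u| < r whenever |u| <= 1/r, which bounds the norm of T^-1.\<close>
  have F: "invertible_op L (T.pa [:- b, of_real r:])"
  proof (rule invertible_op_cong)
    show "invertible_op L (\<lambda>x. T (U.pa [:of_real r, - b:] x))"
    proof (rule invertible_op_comp[OF T U.pa_invertible])
      fix u assume u: "cmod u \<le> 1 / r"
      have "cmod (u * b) \<le> 1 / r * cmod b" unfolding norm_mult using u by (rule mult_right_mono) simp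
      also have "\<dots> < 1 / r * r\<^sup>2" using b r by (intro mult_strict_left_mono) auto
      also have "\<dots> = r" using r by (simp add: power2_eq_square)
      finally have "u * b \<noteq> of_real r" using r by auto
      then show "poly [:of_real r, - b:] u \<noteq> 0" by simp
    qed
    fix x assume x: "x \<in> C"
    then show "T.pa [:- b, of_real r:] x = T (U.pa [:of_real r, - b:] x)"
      by (simp add: T.pa_pCons U.pa_pCons U.op_scale T.op_add T.op_scale i M.a_comm)
  qed
  have G_inv: "invertible_op L (T.pa G)"
    by (rule invertible_op_cong[OF invertible_op_comp[OF D invertible_op_comp[OF D F]]])
      (simp only: G_def blaschke_den_def T.pa_mult T.pa_closed)
  have G0: "G \<noteq> 0"
  proof
    assume "G = 0"
    then have "((1 + of_real \<tau> * b) - (cnj b + of_real \<tau>) * 1)\<^sup>2 * (1 - b) = 0"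
      using polyG[of "1 / of_real r"] r by simp
    moreover have "1 + of_real \<tau> * b - (cnj b + of_real \<tau>) * 1 \<noteq> 0"
      by (rule blaschke_den_nonzero_factor[OF b1 \<tau>(1,4)]) simp
    moreover have "b \<noteq> 1" using b1 by auto
    ultimately show False by simp
  qed
  have "\<not> von_neumann_set Y L (kappa0_op r L T)"
  proof
    assume vN: "von_neumann_set Y L (kappa0_op r L T)"
    have le: "nrm (T.pa P x) \<le> nrm (T.pa G x)" if "x \<in> C" for x
    proof (rule von_neumann_set_poly_le[OF T r(1) _ vN G_inv G0 _ that])
      show "Y \<subseteq> kappa0 r ` (- {0})" using Y by blast
      fix z :: complex assume z: "z \<noteq> 0" "kappa0 r z \<in> Y"
      obtain z' where "kappa0 r z = kappa0 r z'" "z' \<in> cball 0 (1 / r) - {0}" using Y z(2) by blast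
      then have z': "kappa0 r z = kappa0 r z'" "cmod z' \<le> 1 / r" by auto
      have "0 < 1 / r\<^sup>2 + r\<^sup>2" using r by (intro add_pos_pos) auto
      then have "z = z'"
        using z'(1) by (simp add: vec_eq_iff forall_2 kappa0_def)
      then have \<zeta>: "cmod (of_real r * z) \<le> 1" using z'(2) rz by simp
      have "of_real r * z - b = of_real r * (z - w)" by (simp add: b_def algebra_simps)
      then have "cmod (of_real r * z - b) = r * cmod (z - w)" using r by (simp add: norm_mult)
      then have dist: "r * \<epsilon> \<le> cmod (of_real r * z - b)" using far[OF z] r by simp
      have "0 < r * \<epsilon>" using r \<epsilon> by simp
      then have "of_real r * z - b \<noteq> 0" using dist by auto
      then have "poly G z \<noteq> 0"
        using blaschke_den_nonzero_factor[OF b1 \<tau>(1,4) \<zeta>] by (simp add: polyG)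
      moreover have "cmod (poly P z) \<le> cmod (poly G z)"
        using blaschke_product_le[OF b1 \<zeta> dist \<tau>(1-3)] by (simp only: polyP polyG norm_mult norm_power)
      ultimately show "poly G z \<noteq> 0 \<and> cmod (poly P z) \<le> cmod (poly G z)" by simp
    qed
    note lin = adjoint_polys_linear[OF i(1) M adj]
    note mul = adjoint_polys_mult[OF i(1) M]
    \<comment> \<open>Conjugating the coefficients replaces b by cnj b, so the gap is needed at cnj
      b, which has the same modulus.\<close>
    have "adjoint_polys T M P (blaschke_num r \<tau> (cnj b))"
      unfolding P_def blaschke_num_def
      using lin[where \<alpha> = "- (b + of_real \<tau>)" and \<beta> = "(1 + of_real \<tau> * cnj b) * of_real r"]
        lin[where \<alpha> = 1 and \<beta> = "- cnj b * of_real r"]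
      by (intro mul) simp_all
    moreover have "adjoint_polys T M G (blaschke_den r \<tau> (cnj b))"
      unfolding G_def blaschke_den_def
      using lin[where \<alpha> = "1 + of_real \<tau> * b" and \<beta> = "- (cnj b + of_real \<tau>) * of_real r"]
        lin[where \<alpha> = "- b" and \<beta> = "of_real r"]
      by (intro mul) simp_all
    ultimately have "nrm (poly_apply L M (blaschke_num r \<tau> (cnj b)) y) \<le> nrm (poly_apply L M (blaschke_den r \<tau> (cnj b)) y)"
      if "y \<in> C" for y
      using adjoint_polys_norm_le[OF i(1) M _ _ le G_inv that] by blast
    moreover obtain y where "y \<in> C"
      "nrm (poly_apply L M (blaschke_den r \<tau> (cnj b)) y) < nrm (poly_apply L M (blaschke_num r \<tau> (cnj b)) y)"
      using shift_norm_gap[OF r, of "cnj b" \<tau>] b \<tau> unfolding M_def by auto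
    ultimately show False by fastforce
  qed
  then show ?thesis using PA by (intro bexI[of _ "(L, T)"]) auto
qed

lemma PA_class_minimality:
  assumes r: "0 < r" "r < 1" and Y: "closed Y" "Y \<subset> kappa0 r ` (cball 0 (1 / r) - {0})"
  shows "\<exists>(H, T)\<in>(PA_class r :: ('a chilbert \<times> ('a \<Rightarrow> 'a)) set). \<not> von_neumann_set Y H (kappa0_op r H T)"
proof -
  obtain w where "w \<in> cball 0 (1 / r) - {0}" "kappa0 r w \<notin> Y" using Y(2) by blast
  then have w: "w \<noteq> 0" "cmod w \<le> 1 / r" "kappa0 r w \<notin> Y" by auto
  show ?thesis
  proof (cases "r \<le> cmod w")
    case True
    show ?thesis by (rule minimality_spectral_case[OF r True w(2,3)])
  next
    \<comment> \<open>Closedness and continuity enlarge the omitted point to an omitted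
      neighbourhood of w. This is indispensable because the quotient is unbounded near its
      pole.\<close>
    case False
    have "\<forall>\<^sub>F z in at w. kappa0 r z \<in> - Y"
      using isCont_kappa0[OF w(1), of r] Y(1) w(3) unfolding isCont_def by (intro topological_tendstoD) auto
    then obtain \<epsilon> where \<epsilon>: "0 < \<epsilon>" "\<forall>z. z \<noteq> w \<and> dist z w < \<epsilon> \<longrightarrow> kappa0 r z \<notin> Y"
      unfolding eventually_at by auto
    have "\<epsilon> \<le> cmod (z - w)" if "kappa0 r z \<in> Y" for z
    proof (rule ccontr)
      assume "\<not> \<epsilon> \<le> cmod (z - w)"
      then show False using \<epsilon>(2) w(3) that by (cases "z = w") (auto simp: dist_norm)
    qed
    then show ?thesis
      using False Y(2) by (intro minimality_inner_case[OF r _ \<epsilon>(1), of w]) auto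
  qed
qed

end

theorem theorem6p5:
  fixes r :: real
  assumes "0 < r" and "r < 1"
    and universe: "(UNIV :: complex set) \<lesssim> (UNIV :: 'a set)"
  shows "minimal_closed_von_neumann_set (kappa0 r ` (cball 0 (1 / r) - {0}))
           (kappa0_class r (PA_class r :: ('a chilbert \<times> ('a \<Rightarrow> 'a)) set))
       \<and> minimal_closed_von_neumann_set (kappa0 r ` (cball 0 (1 / r) - {0}))
           (kappa0_class r (QA_class r :: ('a chilbert \<times> ('a \<Rightarrow> 'a)) set))"
proof -
  define Y where "Y = kappa0 r ` (cball 0 (1 / r) - {0})"
  \<comment> \<open>The space of square-summable sequences has the cardinality of the continuum, so
    it fits into any universe that contains a copy of \<open>complex\<close>.\<close>
  obtain g :: "(int \<Rightarrow> complex) \<Rightarrow> complex" where g: "inj g" using ex_inj_int_functions_complex by blast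
  obtain f :: "complex \<Rightarrow> 'a" where f: "inj f" using universe by (auto simp: lepoll_def)
  interpret ell2_model "f \<circ> g" by unfold_locales (rule inj_compose[OF f g])
  have sub: "PA_class r \<subseteq> (QA_class r :: ('a chilbert \<times> ('a \<Rightarrow> 'a)) set)"
    by (rule PA_class_subset_QA_class[OF assms(1,2)])
  \<comment> \<open>Both classes are settled at once: the von Neumann property is inherited from the
    larger class, and the witnesses for minimality come from the smaller one.\<close>
  have main: "minimal_closed_von_neumann_set Y (kappa0_class r \<C>)"
    if "PA_class r \<subseteq> \<C>" "\<C> \<subseteq> QA_class r" for \<C> :: "('a chilbert \<times> ('a \<Rightarrow> 'a)) set"
    unfolding minimal_closed_von_neumann_set_def
  proof (intro conjI allI impI)
    show "closed Y" unfolding Y_def by (rule closed_kappa0_image[OF assms(1)])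
    show "\<forall>(H, S)\<in>kappa0_class r \<C>. von_neumann_set Y H S"
    proof (clarsimp simp: kappa0_class_def)
      fix H T assume "(H, T) \<in> \<C>"
      then show "von_neumann_set Y H (kappa0_op r H T)"
        unfolding Y_def using that(2) by (intro QA_class_von_neumann_set[OF assms(1)]) auto
    qed
    fix Y\<^sub>1 assume "closed Y\<^sub>1 \<and> Y\<^sub>1 \<subset> Y"
    then obtain H T where "(H, T) \<in> (PA_class r :: ('a chilbert \<times> ('a \<Rightarrow> 'a)) set)" "\<not> von_neumann_set Y\<^sub>1 H (kappa0_op r H T)"
      using PA_class_minimality[OF assms(1,2), of Y\<^sub>1] by (auto simp: Y_def)
    moreover from this have "(H, kappa0_op r H T) \<in> kappa0_class r \<C>"
      unfolding kappa0_class_def using that(1) by (intro image_eqI[of _ _ "(H, T)"]) auto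
    ultimately show "\<exists>(H, S)\<in>kappa0_class r \<C>. \<not> von_neumann_set Y\<^sub>1 H S"
      by (intro bexI[of _ "(H, kappa0_op r H T)"]) auto
  qed
  show ?thesis
    unfolding Y_def[symmetric] using main[OF order_refl sub] main[OF sub order_refl] by blast
qed

end
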